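(* Let $d\in\mathbb{N}$ and $\alpha>-1$. For all integers $1\le r\le l$ there exists a constant $C=C(d,\alpha,l,r)>0$ such that for all $u\in \mathrm{H}^l_\alpha$ and all $N\in\mathbb{N}$, $$\left\| u-S^\alpha_N(u)\right\|_{\mathrm{H}^r_\alpha}\le C\,N^{-1/2+2r-l}\,\|u\|_{\mathrm{H}^l_\alpha}.$$
   Context: $\mathbb{N}=\{1,2,3,\dots\}$, $\mathbb{N}_0=\mathbb{N}\cup\{0\}$. $B^d$ is the (open) unit ball of $\mathbb{R}^d$ with respect to the Euclidean norm $\|\cdot\|$, and $W_\alpha(x)=(1-\|x\|^2)^\alpha$ for $x\in B^d$. $\mathrm{L}^2_\alpha=W_\alpha^{-1/2}\mathrm{L}^2(B^d)$ is the weighted Lebesgue space of complex-valued functions with inner product $\langle u,v\rangle_\alpha=\int_{B^d}u\,\overline{v}\,W_\alpha$ and squared norm $\|u\|_\alpha^2=\int_{B^d}|u|^2W_\alpha$. For $l\in\mathbb{N}_0$, $\mathrm{H}^l_\alpha$ is the weighted Sobolev space of functions all of whose weak derivatives of order at most $l$ lie in $\mathrm{L}^2_\alpha$, with squared norm $\|u\|_{\mathrm{H}^l_\alpha}^2=\sum_{k=0}^l\|\nabla_k u\|_\alpha^2$, where $\nabla_k u$ is the $k$-dimensional array of all $k$-th order weak partial derivatives and $\|\nabla_k u\|_\alpha^2=\sum_{|\gamma|=k}\binom{k}{\gamma}\|\partial_\gamma u\|_\alpha^2$, the sum being over multi-indices $\gamma\in\mathbb{N}_0^d$ with $|\gamma|=\gamma_1+\dots+\gamma_d=k$,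 and $\binom{k}{\gamma}=k!/(\gamma_1!\cdots\gamma_d!)$. $\Pi^d_N$ is the space of $d$-variate polynomials (complex coefficients) of total degree at most $N$, and $S^\alpha_N$ is the orthogonal projector from $\mathrm{L}^2_\alpha$ onto $\Pi^d_N$. *)

theory Defs
  imports "HOL-Analysis.Analysis"
begin

text \<open>The dimension \<open>d\<close> is \<open>CARD('n)\<close>, and \<open>B\<^sup>d\<close> is \<open>ball 0 1 :: (real ^ 'n) set\<close>.
  Function spaces consist of representatives: functions on the whole of \<open>real ^ 'n\<close>
  of which only the values on the unit ball matter, not identified almost everywhere.\<close>

section \<open>Multi-indices\<close>

type_synonym 'n multi_index = "'n \<Rightarrow> nat"

definition mi_abs :: "'n::finite multi_index \<Rightarrow> nat" where
  "mi_abs \<gamma> = (\<Sum>i\<in>UNIV. \<gamma> i)"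

definition multinomial :: "nat \<Rightarrow> 'n::finite multi_index \<Rightarrow> real" where
  "multinomial k \<gamma> = fact k / (\<Prod>i\<in>UNIV. fact (\<gamma> i))"

lemma finite_mi_abs_le: "finite {\<gamma> :: 'n::finite multi_index. mi_abs \<gamma> \<le> N}"
proof (rule finite_subset)
  have "\<gamma> i \<le> mi_abs \<gamma>" for \<gamma> :: "'n multi_index" and i
    unfolding mi_abs_def by (rule member_le_sum) auto
  then show "{\<gamma> :: 'n multi_index. mi_abs \<gamma> \<le> N}
      \<subseteq> {\<gamma>. \<forall>i. (i \<in> UNIV \<longrightarrow> \<gamma> i \<in> {..N}) \<and> (i \<notin> UNIV \<longrightarrow> \<gamma> i = 0)}"
    by (auto intro: order_trans)
  show "finite {\<gamma> :: 'n multi_index.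
      \<forall>i. (i \<in> UNIV \<longrightarrow> \<gamma> i \<in> {..N}) \<and> (i \<notin> UNIV \<longrightarrow> \<gamma> i = 0)}"
    by (rule finite_set_of_finite_funs) auto
qed

section \<open>Classical partial derivatives and test functions\<close>

definition partial_deriv :: "'n::finite \<Rightarrow> (real ^ 'n \<Rightarrow> real) \<Rightarrow> real ^ 'n \<Rightarrow> real" where
  "partial_deriv i f x = deriv (\<lambda>t. f (x + t *\<^sub>R axis i 1)) 0"

definition iter_partial :: "'n::finite list \<Rightarrow> (real ^ 'n \<Rightarrow> real) \<Rightarrow> real ^ 'n \<Rightarrow> real" where
  "iter_partial is f = foldr partial_deriv is f"

text \<open>The index type carries no order, so a list of directions realising a multi-index is chosen
  arbitrarily. For smooth functions, the only ones \<open>mi_deriv\<close> is applied to, the order of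
  differentiation is immaterial.\<close>

definition mi_list :: "'n::finite multi_index \<Rightarrow> 'n list" where
  "mi_list \<gamma> = (SOME is. \<forall>i. count_list is i = \<gamma> i)"

lemma count_list_mi_list: "count_list (mi_list \<gamma>) i = \<gamma> i"
proof -
  obtain xs where "mset xs = Abs_multiset \<gamma>"
    using ex_mset by blast
  then have "count_list xs j = \<gamma> j" for j
    by (metis count_mset count_Abs_multiset finite)
  then have "\<exists>is. \<forall>i. count_list is i = \<gamma> i"
    by blast
  then show ?thesis
    unfolding mi_list_def by (rule someI_ex[THEN spec])
qed

definition mi_deriv :: "'n::finite multi_index \<Rightarrow> (real ^ 'n \<Rightarrow> real) \<Rightarrow> real ^ 'n \<Rightarrow> real" where
  "mi_deriv \<gamma> f = iter_partial (mi_list \<gamma>) f"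

text \<open>\<open>C\<^sup>\<infinity>\<close>: differentiability of all iterated partial derivatives makes them all continuous.\<close>

definition smooth :: "(real ^ 'n::finite \<Rightarrow> real) \<Rightarrow> bool" where
  "smooth f \<longleftrightarrow> (\<forall>is. iter_partial is f differentiable_on UNIV)"

text \<open>Real-valued test functions suffice for weak derivatives of complex-valued functions,
  by linearity.\<close>

definition test_functions :: "(real ^ 'n::finite \<Rightarrow> real) set" where
  "test_functions = {\<phi>. smooth \<phi> \<and> compact (closure {x. \<phi> x \<noteq> 0}) \<and>
     closure {x. \<phi> x \<noteq> 0} \<subseteq> ball 0 1}"

section \<open>Weak derivatives\<close>

definition loc_integrable :: "(real ^ 'n::finite \<Rightarrow> complex) \<Rightarrow> bool" where
  "loc_integrable u \<longleftrightarrow> (\<forall>K. compact K \<and> K \<subseteq> ball 0 1 \<longrightarrow> set_integrable lebesgue K u)"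

definition is_weak_deriv ::
  "'n::finite multi_index \<Rightarrow> (real ^ 'n \<Rightarrow> complex) \<Rightarrow> (real ^ 'n \<Rightarrow> complex) \<Rightarrow> bool" where
  "is_weak_deriv \<gamma> u v \<longleftrightarrow> loc_integrable u \<and> loc_integrable v \<and>
     (\<forall>\<phi>\<in>test_functions.
        (LINT x|lebesgue_on (ball 0 1). u x * of_real (mi_deriv \<gamma> \<phi> x)) =
        (- 1) ^ mi_abs \<gamma> * (LINT x|lebesgue_on (ball 0 1). v x * of_real (\<phi> x)))"

text \<open>A representative of the weak derivative, which is unique up to a null set of the ball.\<close>

definition weak_deriv ::
  "'n::finite multi_index \<Rightarrow> (real ^ 'n \<Rightarrow> complex) \<Rightarrow> real ^ 'n \<Rightarrow> complex" where
  "weak_deriv \<gamma> u = (SOME v. is_weak_deriv \<gamma> u v)"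

section \<open>Weighted Lebesgue and Sobolev spaces\<close>

definition weight :: "real \<Rightarrow> real ^ 'n::finite \<Rightarrow> real" where
  "weight \<alpha> x = (1 - (norm x)\<^sup>2) powr \<alpha>"

definition L2 :: "real \<Rightarrow> (real ^ 'n::finite \<Rightarrow> complex) set" where
  "L2 \<alpha> = {u. u \<in> borel_measurable (lebesgue_on (ball 0 1)) \<and>
     integrable (lebesgue_on (ball 0 1)) (\<lambda>x. (cmod (u x))\<^sup>2 * weight \<alpha> x)}"

definition L2_inner ::
  "real \<Rightarrow> (real ^ 'n::finite \<Rightarrow> complex) \<Rightarrow> (real ^ 'n \<Rightarrow> complex) \<Rightarrow> complex" where
  "L2_inner \<alpha> u v =
     (LINT x|lebesgue_on (ball 0 1). u x * cnj (v x) * of_real (weight \<alpha> x))"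

definition L2_norm :: "real \<Rightarrow> (real ^ 'n::finite \<Rightarrow> complex) \<Rightarrow> real" where
  "L2_norm \<alpha> u =
     sqrt (LINT x|lebesgue_on (ball 0 1). (cmod (u x))\<^sup>2 * weight \<alpha> x)"

definition Sobolev :: "real \<Rightarrow> nat \<Rightarrow> (real ^ 'n::finite \<Rightarrow> complex) set" where
  "Sobolev \<alpha> l = {u \<in> L2 \<alpha>. \<forall>\<gamma>. mi_abs \<gamma> \<le> l \<longrightarrow> (\<exists>v\<in>L2 \<alpha>. is_weak_deriv \<gamma> u v)}"

definition grad_norm :: "real \<Rightarrow> nat \<Rightarrow> (real ^ 'n::finite \<Rightarrow> complex) \<Rightarrow> real" where
  "grad_norm \<alpha> k u =
     sqrt (\<Sum>\<gamma> | mi_abs \<gamma> = k. multinomial k \<gamma> * (L2_norm \<alpha> (weak_deriv \<gamma> u))\<^sup>2)"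

definition Sobolev_norm :: "real \<Rightarrow> nat \<Rightarrow> (real ^ 'n::finite \<Rightarrow> complex) \<Rightarrow> real" where
  "Sobolev_norm \<alpha> l u = sqrt (\<Sum>k\<le>l. (grad_norm \<alpha> k u)\<^sup>2)"

section \<open>Polynomials and the orthogonal projector\<close>

definition polys :: "nat \<Rightarrow> (real ^ 'n::finite \<Rightarrow> complex) set" where
  "polys N = {p. \<exists>c. p = (\<lambda>x. \<Sum>\<gamma> | mi_abs \<gamma> \<le> N. c \<gamma> * of_real (\<Prod>i\<in>UNIV. (x $ i) ^ \<gamma> i))}"

text \<open>For \<open>\<alpha> > -1\<close> and \<open>u \<in> L2 \<alpha>\<close> the polynomial described here exists and is unique as a
  function on the whole space, since a polynomial vanishing almost everywhere on the ball is zero.\<close>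

definition ortho_proj ::
  "real \<Rightarrow> nat \<Rightarrow> (real ^ 'n::finite \<Rightarrow> complex) \<Rightarrow> real ^ 'n \<Rightarrow> complex" where
  "ortho_proj \<alpha> N u =
     (THE p. p \<in> polys N \<and> (\<forall>q\<in>polys N. L2_inner \<alpha> (\<lambda>x. u x - p x) q = 0))"

end

theory Submission
  imports Defs "HOL-Real_Asymp.Real_Asymp"
begin

text \<open>Write \<open>S\<^bsub>n\<^esub>\<close> for the projection for the weight exponent \<open>\<alpha>\<close>, and \<open>T\<^bsub>n\<^esub>\<close> for the one for
  \<open>\<alpha> + 1\<close>. The form \<open>\<integral> (\<nabla>u \<cdot> \<nabla>v - (x \<cdot> \<nabla>u) (x \<cdot> \<nabla>v)) W\<^bsub>\<alpha>\<^esub>\<close> has the polynomials of degree \<open>k\<close> that are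
  orthogonal to all lower degrees as eigenfunctions, with eigenvalue \<open>k (k + d + 2 \<alpha>)\<close>. Its spectral
  gap bounds \<open>N \<parallel>u - S\<^bsub>N\<^esub> u\<parallel>\<close> by the errors of approximating the \<open>\<partial>\<^sub>i u\<close> in degree \<open>N - 1\<close>, and iteration
  gives the rate \<open>N\<^bsup>-l\<^esup>\<close> in \<open>L\<^sup>2\<close>. Moreover \<open>\<partial>\<^sub>i S\<^bsub>N\<^esub> u = T\<^bsub>N-1\<^esub> \<partial>\<^sub>i u\<close>. For a function \<open>v\<close>, the polynomial
  \<open>S\<^bsub>n\<^esub> v - T\<^bsub>n\<^esub> v\<close> has components only in the degrees \<open>n\<close> and \<open>n - 1\<close> with respect to the exponent
  \<open>\<alpha> + 1\<close>, and on those degrees passing from \<open>W\<^bsub>\<alpha>+1\<^esub>\<close> back to \<open>W\<^bsub>\<alpha>\<^esub>\<close> costs only \<open>\<surd>n\<close>: this is the loss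
  for one derivative. Each further derivative costs a Markov factor \<open>N\<^sup>2\<close>.\<close>

section \<open>Partial derivatives of smooth functions\<close>

text \<open>Differentiation turns S into T, while the Sobolev norm measures every derivative with
  the same \<alpha>. For v = \<partial>_i u the error is therefore split as \<partial>_i (u - S_N u)
  = (v - S_(N-1) v) + (S_(N-1) v - T_(N-1) v). The first summand is again a projection error, with
  one order less of smoothness and of differentiation. The second is a polynomial of size N^(1/2)
  N^(1-l), and k - 1 further derivatives multiply it by N^(2k-2). This is the origin of the exponent
  2k - 1/2 - l; the first summand never exceeds that rate. The other obstacle is the boundary. Weak
  derivatives are tested only with functions supported inside the open ball, and W_\<alpha> is not
  among them; for \<alpha> < 0 it is even unbounded. Weakly differentiable functions are therefore
  paired with polynomial fields X times a truncated weight. The derivative of the cutoff is large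
  near the sphere, but harmless if x . X contains the factor 1 - |x|^2. Two such fields carry the
  proof: G - x (x . G) leads to the second order operator, and (1 - |x|^2) q in a single direction
  links the exponents \<alpha> and \<alpha> + 1.\<close>

lemma partial_deriv_eq:
  fixes f :: "real ^ 'n::finite \<Rightarrow> real"
  assumes "(f has_derivative D) (at x)"
  shows "partial_deriv i f x = D (axis i 1)"
proof -
  have D: "(f has_derivative D) (at (x + 0 *\<^sub>R axis i 1))"
    using assms by simp
  have "((\<lambda>t. f (x + t *\<^sub>R axis i 1)) has_derivative (\<lambda>t. D (t *\<^sub>R axis i 1))) (at 0)"
    by (rule has_derivative_compose[where f = "\<lambda>t. x + t *\<^sub>R axis i 1" and g = f and g' = D]) (use D in \<open>auto intro!: derivative_eq_intros\<close>)
  moreover have "D (t *\<^sub>R axis i 1) = D (axis i 1) * t" for t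
    using has_derivative_linear[OF assms] by (simp add: linear_cmul mult.commute)
  ultimately have "((\<lambda>t. f (x + t *\<^sub>R axis i 1)) has_field_derivative D (axis i 1)) (at 0)"
    by (simp add: has_field_derivative_def)
  then show ?thesis
    unfolding partial_deriv_def by (rule DERIV_imp_deriv)
qed

lemma partial_deriv_has_real_derivative:
  fixes f :: "real ^ 'n::finite \<Rightarrow> real"
  assumes "f differentiable_on UNIV"
  shows "((\<lambda>t. f (x + t *\<^sub>R axis i 1)) has_real_derivative partial_deriv i f (x + s *\<^sub>R axis i 1)) (at s)"
proof -
  obtain D where D: "(f has_derivative D) (at (x + s *\<^sub>R axis i 1))"
    using assms by (auto simp: differentiable_on_def differentiable_def)
  have "((\<lambda>t. f (x + t *\<^sub>R axis i 1)) has_derivative (\<lambda>t. D (t *\<^sub>R axis i 1))) (at s)"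
    by (rule has_derivative_compose[where f = "\<lambda>t. x + t *\<^sub>R axis i 1" and g = f and g' = D]) (use D in \<open>auto intro!: derivative_eq_intros\<close>)
  moreover have "D (t *\<^sub>R axis i 1) = D (axis i 1) * t" for t
    using has_derivative_linear[OF D] by (simp add: linear_cmul mult.commute)
  ultimately show ?thesis
    by (simp add: has_field_derivative_def partial_deriv_eq[OF D])
qed

lemma iter_partial_Nil [simp]: "iter_partial [] f = f"
  and iter_partial_Cons [simp]: "iter_partial (i # is) f = partial_deriv i (iter_partial is f)"
  by (simp_all add: iter_partial_def)

lemma iter_partial_append: "iter_partial (xs @ ys) f = iter_partial xs (iter_partial ys f)"
  by (simp add: iter_partial_def)

lemma smooth_iter_partial: "smooth f \<Longrightarrow> smooth (iter_partial is f)"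
  unfolding smooth_def by (metis iter_partial_append)

lemma smooth_partial_deriv: "smooth f \<Longrightarrow> smooth (partial_deriv i f)"
  using smooth_iter_partial[of f "[i]"] by simp

lemma smooth_imp_differentiable: "smooth f \<Longrightarrow> f differentiable_on UNIV"
  unfolding smooth_def by (metis iter_partial_Nil)

lemma smooth_imp_continuous: "smooth f \<Longrightarrow> continuous_on S f"
  using smooth_imp_differentiable differentiable_imp_continuous_on continuous_on_subset by blast

text \<open>Both mixed partials are limits of the same second difference quotient.\<close>

lemma second_difference_mvt:
  fixes f :: "real ^ 'n::finite \<Rightarrow> real"
  assumes "smooth f" "h > 0"
  obtains s t where "0 < s" "s < h" "0 < t" "t < h"
    "f (x + h *\<^sub>R axis i 1 + h *\<^sub>R axis j 1) - f (x + h *\<^sub>R axis i 1) - f (x + h *\<^sub>R axis j 1) + f x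
      = h * h * partial_deriv j (partial_deriv i f) (x + s *\<^sub>R axis i 1 + t *\<^sub>R axis j 1)"
proof -
  let ?e = "\<lambda>k. axis k (1::real) :: real ^ 'n"
  define g where "g r = f (x + h *\<^sub>R ?e j + r *\<^sub>R ?e i) - f (x + r *\<^sub>R ?e i)" for r
  have g: "(g has_real_derivative partial_deriv i f (x + h *\<^sub>R ?e j + r *\<^sub>R ?e i)
      - partial_deriv i f (x + r *\<^sub>R ?e i)) (at r)" for r
    unfolding g_def
    by (intro DERIV_diff partial_deriv_has_real_derivative smooth_imp_differentiable assms)
  obtain s where s: "0 < s" "s < h" "g h - g 0 = (h - 0) * (partial_deriv i f (x + h *\<^sub>R ?e j + s *\<^sub>R ?e i)
      - partial_deriv i f (x + s *\<^sub>R ?e i))"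
    using MVT2[OF assms(2), of g, OF g] by blast
  have k: "((\<lambda>t. partial_deriv i f (x + s *\<^sub>R ?e i + t *\<^sub>R ?e j)) has_real_derivative
     partial_deriv j (partial_deriv i f) (x + s *\<^sub>R ?e i + t *\<^sub>R ?e j)) (at t)" for t
    by (intro partial_deriv_has_real_derivative smooth_imp_differentiable smooth_partial_deriv assms)
  obtain t where t: "0 < t" "t < h" "partial_deriv i f (x + s *\<^sub>R ?e i + h *\<^sub>R ?e j)
      - partial_deriv i f (x + s *\<^sub>R ?e i + 0 *\<^sub>R ?e j)
      = (h - 0) * partial_deriv j (partial_deriv i f) (x + s *\<^sub>R ?e i + t *\<^sub>R ?e j)"
    using MVT2[OF assms(2), of "\<lambda>t. partial_deriv i f (x + s *\<^sub>R ?e i + t *\<^sub>R ?e j)", OF k] by blast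
  have "f (x + h *\<^sub>R ?e i + h *\<^sub>R ?e j) - f (x + h *\<^sub>R ?e i) - f (x + h *\<^sub>R ?e j) + f x = g h - g 0"
    by (simp add: g_def algebra_simps)
  also have "\<dots> = h * h * partial_deriv j (partial_deriv i f) (x + s *\<^sub>R ?e i + t *\<^sub>R ?e j)"
    using s(3) t(3) by (simp add: algebra_simps)
  finally show ?thesis
    using that s t by blast
qed

lemma partial_deriv_commute:
  fixes f :: "real ^ 'n::finite \<Rightarrow> real"
  assumes "smooth f"
  shows "partial_deriv i (partial_deriv j f) = partial_deriv j (partial_deriv i f)"
proof
  fix x
  let ?e = "\<lambda>k. axis k (1::real) :: real ^ 'n"
  define Q where "Q k = (let h = 1 / real (Suc k) in
    (f (x + h *\<^sub>R ?e i + h *\<^sub>R ?e j) - f (x + h *\<^sub>R ?e i) - f (x + h *\<^sub>R ?e j) + f x) / (h * h))" for k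
  have lim: "Q' \<longlonglongrightarrow> partial_deriv b (partial_deriv a f) x"
    if Q': "\<And>k. \<exists>s t. 0 < s \<and> s < 1 / real (Suc k) \<and> 0 < t \<and> t < 1 / real (Suc k) \<and>
      Q' k = partial_deriv b (partial_deriv a f) (x + s *\<^sub>R ?e a + t *\<^sub>R ?e b)" for a b Q'
  proof -
    obtain s t where st: "\<And>k. 0 < s k \<and> s k < 1 / real (Suc k) \<and> 0 < t k \<and> t k < 1 / real (Suc k) \<and>
      Q' k = partial_deriv b (partial_deriv a f) (x + s k *\<^sub>R ?e a + t k *\<^sub>R ?e b)"
      using Q' by metis
    have lim0: "(\<lambda>k. 1 / real (Suc k)) \<longlonglongrightarrow> 0"
      using LIMSEQ_inverse_real_of_nat by (simp add: inverse_eq_divide)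
    have "s \<longlonglongrightarrow> 0" "t \<longlonglongrightarrow> 0"
      using st by (intro tendsto_sandwich[OF _ _ tendsto_const lim0] always_eventually allI; simp add: less_imp_le)+
    then have "(\<lambda>k. x + s k *\<^sub>R ?e a + t k *\<^sub>R ?e b) \<longlonglongrightarrow> x + 0 *\<^sub>R ?e a + 0 *\<^sub>R ?e b"
      by (intro tendsto_intros)
    moreover have "isCont (partial_deriv b (partial_deriv a f)) x"
      using smooth_imp_continuous[OF smooth_partial_deriv[OF smooth_partial_deriv[OF assms]]]
      by (metis continuous_on_eq_continuous_at open_UNIV UNIV_I)
    ultimately have "(\<lambda>k. partial_deriv b (partial_deriv a f) (x + s k *\<^sub>R ?e a + t k *\<^sub>R ?e b))
       \<longlonglongrightarrow> partial_deriv b (partial_deriv a f) x"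
      using isCont_tendsto_compose by fastforce
    then show ?thesis using st by presburger
  qed
  have "Q \<longlonglongrightarrow> partial_deriv j (partial_deriv i f) x"
  proof (rule lim)
    fix k
    have "(0::real) < 1 / real (Suc k)" by simp
    from second_difference_mvt[OF assms this, of x i j] obtain s t where
      "0 < s" "s < 1 / real (Suc k)" "0 < t" "t < 1 / real (Suc k)"
      "Q k = partial_deriv j (partial_deriv i f) (x + s *\<^sub>R ?e i + t *\<^sub>R ?e j)"
      unfolding Q_def Let_def by (metis nonzero_mult_div_cancel_left mult_eq_0_iff less_irrefl \<open>(0::real) < 1 / real (Suc k)\<close>)
    then show "\<exists>s t. 0 < s \<and> s < 1 / real (Suc k) \<and> 0 < t \<and> t < 1 / real (Suc k) \<and>
      Q k = partial_deriv j (partial_deriv i f) (x + s *\<^sub>R ?e i + t *\<^sub>R ?e j)" by blast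
  qed
  moreover have "Q \<longlonglongrightarrow> partial_deriv i (partial_deriv j f) x"
  proof (rule lim)
    fix k
    have "(0::real) < 1 / real (Suc k)" by simp
    from second_difference_mvt[OF assms this, of x j i] obtain s t where
      st: "0 < s" "s < 1 / real (Suc k)" "0 < t" "t < 1 / real (Suc k)" and
      eq: "f (x + (1 / real (Suc k)) *\<^sub>R axis j 1 + (1 / real (Suc k)) *\<^sub>R axis i 1) - f (x + (1 / real (Suc k)) *\<^sub>R axis j 1) - f (x + (1 / real (Suc k)) *\<^sub>R axis i 1) + f x
      = (1 / real (Suc k)) * (1 / real (Suc k)) * partial_deriv i (partial_deriv j f) (x + s *\<^sub>R ?e j + t *\<^sub>R ?e i)"
      by blast
    have "Q k = ((1 / real (Suc k)) * (1 / real (Suc k)) * partial_deriv i (partial_deriv j f) (x + s *\<^sub>R ?e j + t *\<^sub>R ?e i)) / ((1 / real (Suc k)) * (1 / real (Suc k)))"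
      unfolding Q_def Let_def eq[symmetric] by (simp add: algebra_simps)
    also have "\<dots> = partial_deriv i (partial_deriv j f) (x + s *\<^sub>R ?e j + t *\<^sub>R ?e i)"
      by (rule nonzero_mult_div_cancel_left) simp
    finally show "\<exists>s t. 0 < s \<and> s < 1 / real (Suc k) \<and> 0 < t \<and> t < 1 / real (Suc k) \<and>
      Q k = partial_deriv i (partial_deriv j f) (x + s *\<^sub>R ?e j + t *\<^sub>R ?e i)" using st by blast
  qed
  ultimately show "partial_deriv i (partial_deriv j f) x = partial_deriv j (partial_deriv i f) x"
    using LIMSEQ_unique by blast
qed

lemma iter_partial_snoc_commute:
  assumes "smooth f"
  shows "iter_partial (xs @ [i]) f = iter_partial (i # xs) f"
proof (induction xs)
  case (Cons a xs)
  have "iter_partial ((a # xs) @ [i]) f = partial_deriv a (partial_deriv i (iter_partial xs f))"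
    using Cons by simp
  then show ?case
    using partial_deriv_commute[OF smooth_iter_partial[OF assms]] by simp
qed simp

text \<open>\<open>mi_list\<close> fixes an arbitrary ordering of the directions, so computing with
  \<open>mi_deriv\<close> rests on the order being irrelevant for smooth functions.\<close>

lemma iter_partial_perm:
  assumes "smooth f" "mset xs = mset ys"
  shows "iter_partial xs f = iter_partial ys f"
  using assms(2)
proof (induction xs arbitrary: ys)
  case (Cons a xs)
  then obtain us vs where ys: "ys = us @ a # vs"
    by (metis list.set_intros(1) set_mset_mset split_list)
  with Cons.prems have "mset xs = mset (us @ vs)" by simp
  from Cons.IH[OF this] have "iter_partial (a # xs) f = partial_deriv a (iter_partial us (iter_partial vs f))"
    by (simp add: iter_partial_append)
  also have "\<dots> = iter_partial (us @ [a]) (iter_partial vs f)"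
    using iter_partial_snoc_commute[OF smooth_iter_partial[OF assms(1)]] by simp
  finally show ?case by (simp add: ys iter_partial_append)
qed simp

lemma mset_mi_list_eq:
  "(\<And>i. count_list xs i = \<gamma> i) \<Longrightarrow> mset (mi_list \<gamma>) = mset xs"
  by (rule multiset_eqI) (simp add: count_mset count_list_mi_list)

lemma mi_deriv_eq_iter_partial:
  assumes "smooth f" "\<And>i. count_list xs i = \<gamma> i"
  shows "mi_deriv \<gamma> f = iter_partial xs f"
  unfolding mi_deriv_def using assms(1) mset_mi_list_eq[OF assms(2)] by (rule iter_partial_perm)

definition inc :: "'n \<Rightarrow> 'n multi_index \<Rightarrow> 'n multi_index" where
  "inc i \<gamma> = \<gamma>(i := Suc (\<gamma> i))"

text \<open>The outermost form lets \<open>wpd_inc\<close> apply the definition of a first weak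
  derivative to the test function \<open>mi_deriv \<gamma> \<phi>\<close>; the innermost form
  handles the unit multi-index.\<close>

lemma mi_deriv_inc:
  assumes "smooth f"
  shows "mi_deriv (inc i \<gamma>) f = mi_deriv \<gamma> (partial_deriv i f)"
    and "mi_deriv (inc i \<gamma>) f = partial_deriv i (mi_deriv \<gamma> f)"
proof -
  have "mi_deriv (inc i \<gamma>) f = iter_partial (mi_list \<gamma> @ [i]) f"
    by (rule mi_deriv_eq_iter_partial[OF assms]) (simp add: count_list_mi_list inc_def)
  then show "mi_deriv (inc i \<gamma>) f = mi_deriv \<gamma> (partial_deriv i f)"
    by (simp add: iter_partial_append mi_deriv_def)
  have "mi_deriv (inc i \<gamma>) f = iter_partial (i # mi_list \<gamma>) f"
    by (rule mi_deriv_eq_iter_partial[OF assms]) (simp add: count_list_mi_list inc_def)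
  then show "mi_deriv (inc i \<gamma>) f = partial_deriv i (mi_deriv \<gamma> f)"
    by (simp add: mi_deriv_def)
qed

lemma mi_deriv_zero: "mi_deriv (\<lambda>_. 0) f = f"
proof -
  have "mset (mi_list (\<lambda>_::'a. 0)) = mset []"
    by (rule mset_mi_list_eq) simp
  then show ?thesis by (simp add: mi_deriv_def)
qed

lemma mi_deriv_unit: "smooth f \<Longrightarrow> mi_deriv (inc i (\<lambda>_. 0)) f = partial_deriv i f"
  using mi_deriv_inc(1)[of f i "\<lambda>_. 0"] by (simp add: mi_deriv_zero)

lemma test_functions_partial_deriv:
  assumes "\<phi> \<in> test_functions"
  shows "partial_deriv i \<phi> \<in> test_functions"
proof -
  have "partial_deriv i \<phi> x = 0" if "x \<notin> closure {x. \<phi> x \<noteq> 0}" for x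
  proof -
    have "(\<phi> has_derivative (\<lambda>_. 0)) (at x)"
      by (rule has_derivative_transform_within_open[OF has_derivative_const[of 0], of "- closure {x. \<phi> x \<noteq> 0}"])
        (use that closure_subset[of "{x. \<phi> x \<noteq> 0}"] in auto)
    from partial_deriv_eq[OF this] show ?thesis .
  qed
  then have sub: "closure {x. partial_deriv i \<phi> x \<noteq> 0} \<subseteq> closure {x. \<phi> x \<noteq> 0}"
    by (intro closure_minimal) auto
  from assms have "compact (closure {x. \<phi> x \<noteq> 0} \<inter> closure {x. partial_deriv i \<phi> x \<noteq> 0})"
    by (intro compact_Int_closed) (auto simp: test_functions_def)
  with sub have "compact (closure {x. partial_deriv i \<phi> x \<noteq> 0})"
    by (simp add: Int_absorb1)
  with assms sub show ?thesis
    by (auto simp: test_functions_def smooth_partial_deriv)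
qed

section \<open>Truncated weights as test functions\<close>

text \<open>Composed with \<open>t = n (1 - \<parallel>x\<parallel>\<^sup>2) - 1\<close>, the function \<open>cutoff 0 b\<close> is
  \<open>n\<^sup>b\<close> times a smoothly truncated weight with exponent \<open>b\<close>; the parameter \<open>k\<close> closes the
  family under differentiation.\<close>

definition cutoff :: "nat \<Rightarrow> real \<Rightarrow> real \<Rightarrow> real" where
  "cutoff k b t = (if t > 0 then (1 / t) ^ k * exp (- 1 / t) * (1 + t) powr b else 0)"

lemma cutoff_has_real_derivative:
  "(cutoff k b has_real_derivative
     - real k * cutoff (Suc k) b t + cutoff (Suc (Suc k)) b t + b * cutoff k (b - 1) t) (at t)"
proof -
  consider "t > 0" | "t < 0" | "t = 0" by linarith
  then show ?thesis
  proof cases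
    case 1
    let ?g = "\<lambda>t::real. (1 / t) ^ k * exp (- 1 / t) * (1 + t) powr b"
    have "((\<lambda>t::real. (1 / t) ^ k) has_real_derivative - real k * (1 / t) ^ Suc k) (at t)"
    proof -
      have "((\<lambda>t::real. 1 / t) has_real_derivative - ((1 / t) ^ 2)) (at t)"
        using 1 by (auto intro!: derivative_eq_intros simp: power2_eq_square)
      moreover have "of_nat k * (- ((1 / t) ^ 2) * (1 / t) ^ (k - Suc 0)) = - real k * (1 / t) ^ Suc k"
        by (cases k) (simp_all del: power_one_over power_divide of_nat_Suc add: power2_eq_square)
      ultimately show ?thesis
        using DERIV_power[where f = "\<lambda>t::real. 1 / t" and n = k] by fastforce
    qed
    moreover have "((\<lambda>t::real. exp (- 1 / t)) has_real_derivative exp (- 1 / t) * (1 / t) ^ 2) (at t)"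
      using 1 by (auto intro!: derivative_eq_intros simp: field_simps power2_eq_square)
    moreover have "((\<lambda>t::real. (1 + t) powr b) has_real_derivative b * (1 + t) powr (b - 1)) (at t)"
      using 1 by (auto intro!: derivative_eq_intros)
    ultimately have "(?g has_real_derivative
      (- real k * (1 / t) ^ Suc k * exp (- 1 / t) + exp (- 1 / t) * (1 / t) ^ 2 * (1 / t) ^ k) * (1 + t) powr b
      + b * (1 + t) powr (b - 1) * ((1 / t) ^ k * exp (- 1 / t))) (at t)"
      by (intro DERIV_mult)
    also have "(- real k * (1 / t) ^ Suc k * exp (- 1 / t) + exp (- 1 / t) * (1 / t) ^ 2 * (1 / t) ^ k) * (1 + t) powr b
      + b * (1 + t) powr (b - 1) * ((1 / t) ^ k * exp (- 1 / t)) =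
      - real k * cutoff (Suc k) b t + cutoff (Suc (Suc k)) b t + b * cutoff k (b - 1) t"
      using 1 by (simp add: cutoff_def algebra_simps power2_eq_square)
    finally have "(?g has_real_derivative
     - real k * cutoff (Suc k) b t + cutoff (Suc (Suc k)) b t + b * cutoff k (b - 1) t) (at t)" .
    then show ?thesis
      by (rule has_field_derivative_transform_within_open[of _ _ _ "{0<..}"]) (use 1 in \<open>auto simp: cutoff_def\<close>)
  next
    case 2
    have "((\<lambda>_. 0) has_real_derivative 0) (at t)" by simp
    then have "(cutoff k b has_real_derivative 0) (at t)"
      by (rule has_field_derivative_transform_within_open[of _ _ _ "{..<0}"]) (use 2 in \<open>auto simp: cutoff_def\<close>)
    then show ?thesis using 2 by (simp add: cutoff_def)
  next
    case 3
    \<comment> \<open>The exponential beats every power of 1 / h, so the difference quotient from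
      the right tends to 0; from the left it is 0 throughout.\<close>
    have "((\<lambda>h::real. (1 / h) ^ Suc k * exp (- 1 / h) * (1 + h) powr b) \<longlongrightarrow> 0) (at_right 0)"
      by real_asymp
    then have "((\<lambda>h. (cutoff k b (0 + h) - cutoff k b 0) / h) \<longlongrightarrow> 0) (at_right 0)"
      by (rule Lim_transform_eventually)
         (auto simp: eventually_at_right_field cutoff_def intro!: exI[of _ 1])
    moreover have "((\<lambda>h. (cutoff k b (0 + h) - cutoff k b 0) / h) \<longlongrightarrow> 0) (at_left 0)"
      by (rule Lim_transform_eventually[OF tendsto_const])
         (auto simp: eventually_at_left_field cutoff_def intro!: exI[of _ "-1"])
    ultimately have "((\<lambda>h. (cutoff k b (0 + h) - cutoff k b 0) / h) \<longlongrightarrow> 0) (at 0)"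
      by (simp add: filterlim_split_at)
    then show ?thesis using 3 by (simp add: DERIV_def cutoff_def)
  qed
qed

definition rcut :: "real \<Rightarrow> nat \<Rightarrow> real \<Rightarrow> real ^ 'n::finite \<Rightarrow> real" where
  "rcut n k b x = cutoff k b (n * (1 - (norm x)\<^sup>2) - 1)"

text \<open>The factor of \<open>x\<close> in the gradient of \<open>rcut n k b\<close>: the inner
  function n (1 - |x|^2) - 1 has gradient - 2 n x.\<close>

definition rcut' :: "real \<Rightarrow> nat \<Rightarrow> real \<Rightarrow> real ^ 'n::finite \<Rightarrow> real" where
  "rcut' n k b x = - 2 * n *
     (- real k * rcut n (Suc k) b x + rcut n (Suc (Suc k)) b x + b * rcut n k (b - 1) x)"

lemma rcut_has_derivative:
  fixes x :: "real ^ 'n::finite"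
  shows "(rcut n k b has_derivative (\<lambda>h. rcut' n k b x * (x \<bullet> h))) (at x)"
proof -
  have eq: "rcut n k b = (\<lambda>x::real ^ 'n. cutoff k b (n * (1 - x \<bullet> x) - 1))"
    by (simp add: rcut_def fun_eq_iff power2_norm_eq_inner)
  show ?thesis
    unfolding eq rcut'_def rcut_def power2_norm_eq_inner
    by (rule has_derivative_eq_rhs, rule has_derivative_compose
        [OF _ cutoff_has_real_derivative[unfolded has_field_derivative_def]])
       (auto intro!: derivative_eq_intros simp: fun_eq_iff inner_commute algebra_simps)
qed

text \<open>\<open>smooth\<close> quantifies over all iterated partials. This class contains the
  truncated weights and is closed under partial derivatives and under products with monomials, so
  differentiability of its members already gives smoothness of all truncated weights times
  monomials.\<close>

inductive cut_poly :: "real \<Rightarrow> (real ^ 'n::finite \<Rightarrow> real) \<Rightarrow> bool" for n :: real where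
  base: "cut_poly n (rcut n k b)"
| add: "cut_poly n f \<Longrightarrow> cut_poly n g \<Longrightarrow> cut_poly n (\<lambda>x. f x + g x)"
| cmult: "cut_poly n f \<Longrightarrow> cut_poly n (\<lambda>x. c * f x)"
| coord: "cut_poly n f \<Longrightarrow> cut_poly n (\<lambda>x. x $ i * f x)"

lemma cut_poly_derivative:
  fixes f :: "real ^ 'n::finite \<Rightarrow> real"
  shows "cut_poly n f \<Longrightarrow> \<exists>D. \<forall>x. (f has_derivative D x) (at x) \<and> (\<forall>i. cut_poly n (\<lambda>x. D x (axis i 1)))"
proof (induction rule: cut_poly.induct)
  case (base k b)
  have "cut_poly n (\<lambda>x. rcut' n k b x * (x \<bullet> axis i 1))" for i :: "'n"
  proof -
    have "cut_poly n (\<lambda>x::real^'n. x $ i * (- 2 * n *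
      ((- real k) * rcut n (Suc k) b x + rcut n (Suc (Suc k)) b x + b * rcut n k (b - 1) x)))"
      by (intro cut_poly.intros)
    then show ?thesis by (simp add: inner_axis rcut'_def mult.commute)
  qed
  then show ?case using rcut_has_derivative by (intro exI[of _ "\<lambda>x h. rcut' n k b x * (x \<bullet> h)"]) blast
next
  case (add f g)
  then obtain D E where "\<forall>x. (f has_derivative D x) (at x) \<and> (\<forall>i. cut_poly n (\<lambda>x. D x (axis i 1)))"
     "\<forall>x. (g has_derivative E x) (at x) \<and> (\<forall>i. cut_poly n (\<lambda>x. E x (axis i 1)))" by blast
  then show ?case
    by (intro exI[of _ "\<lambda>x h. D x h + E x h"]) (auto intro!: derivative_intros cut_poly.intros)
next
  case (cmult f c)
  then obtain D where "\<forall>x. (f has_derivative D x) (at x) \<and> (\<forall>i. cut_poly n (\<lambda>x. D x (axis i 1)))" by blast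
  then show ?case
    by (intro exI[of _ "\<lambda>x h. c * D x h"]) (auto intro!: derivative_intros cut_poly.intros)
next
  case (coord f j)
  then obtain D where D: "\<And>x. (f has_derivative D x) (at x)" "\<And>i. cut_poly n (\<lambda>x. D x (axis i 1))" by blast
  have "((\<lambda>x. x $ j * f x) has_derivative (\<lambda>h. x $ j * D x h + h $ j * f x)) (at x)" for x
    by (intro has_derivative_mult D bounded_linear.has_derivative[OF bounded_linear_vec_nth] has_derivative_ident)
  moreover have "cut_poly n (\<lambda>x. x $ j * D x (axis i 1) + axis i 1 $ j * f x)" for i
    using D coord by (intro cut_poly.intros)
  ultimately show ?case by (intro exI[of _ "\<lambda>x h. x $ j * D x h + h $ j * f x"]) blast
qed

lemma cut_poly_iter_partial: "cut_poly n f \<Longrightarrow> cut_poly n (iter_partial is f)"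
proof (induction "is")
  case (Cons i "is")
  then obtain D where D: "\<And>x. (iter_partial is f has_derivative D x) (at x)"
     "\<And>i. cut_poly n (\<lambda>x. D x (axis i 1))"
    using cut_poly_derivative by blast
  have "partial_deriv i (iter_partial is f) = (\<lambda>x. D x (axis i 1))"
    using partial_deriv_eq[OF D(1)] by (simp add: fun_eq_iff)
  with D(2) show ?case by simp
qed simp

lemma cut_poly_smooth: "cut_poly n f \<Longrightarrow> smooth f"
  unfolding smooth_def differentiable_on_def
  by (metis cut_poly_iter_partial cut_poly_derivative differentiableI differentiable_at_withinI)

lemma cut_poly_zero: "cut_poly n f \<Longrightarrow> n * (1 - (norm x)\<^sup>2) \<le> 1 \<Longrightarrow> f x = 0"
  by (induction rule: cut_poly.induct) (auto simp: rcut_def cutoff_def)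

lemma cut_poly_test_function:
  fixes f :: "real ^ 'n::finite \<Rightarrow> real"
  assumes "cut_poly n f" "n > 0"
  shows "f \<in> test_functions"
proof -
  \<comment> \<open>The points where the argument of \<open>cutoff\<close> is nonnegative: a closed
    set away from the sphere, outside which f vanishes.\<close>
  define K where "K = {x :: real ^ 'n. n * (1 - (norm x)\<^sup>2) \<ge> 1}"
  have "closed K" unfolding K_def by (intro closed_Collect_le continuous_intros)
  have sub: "K \<subseteq> ball 0 1"
  proof
    fix x :: "real ^ 'n" assume "x \<in> K"
    then have "0 < n * (1 - (norm x)\<^sup>2)" by (simp add: K_def)
    then have "(norm x)\<^sup>2 < 1" using assms(2) by (simp add: zero_less_mult_iff)
    then show "x \<in> ball 0 1" by (simp add: power_less_one_iff abs_square_less_1)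
  qed
  then have "compact K"
    using \<open>closed K\<close> bounded_subset bounded_ball compact_eq_bounded_closed by metis
  have cl: "closure {x. f x \<noteq> 0} \<subseteq> K"
    using cut_poly_zero[OF assms(1)] \<open>closed K\<close> by (intro closure_minimal) (force simp: K_def)+
  then have "compact (K \<inter> closure {x. f x \<noteq> 0})"
    using \<open>compact K\<close> by (intro compact_Int_closed) auto
  with cl sub cut_poly_smooth[OF assms(1)] show ?thesis
    by (auto simp: test_functions_def Int_absorb1)
qed

text \<open>Truncations of the weight with exponent \<open>b\<close>; \<open>trunc_weight' n b x\<close> is the factor
  multiplying \<open>x\<close> in their gradient.\<close>

definition trunc_weight :: "nat \<Rightarrow> real \<Rightarrow> real ^ 'n::finite \<Rightarrow> real" where
  "trunc_weight n b x = real (Suc n) powr (- b) * rcut (real (Suc n)) 0 b x"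

definition trunc_weight' :: "nat \<Rightarrow> real \<Rightarrow> real ^ 'n::finite \<Rightarrow> real" where
  "trunc_weight' n b x = real (Suc n) powr (- b) * rcut' (real (Suc n)) 0 b x"

lemma trunc_weight_has_derivative:
  fixes x :: "real ^ 'n::finite"
  shows "(trunc_weight n b has_derivative (\<lambda>h. trunc_weight' n b x * (x \<bullet> h))) (at x)"
proof -
  have "((\<lambda>x. real (Suc n) powr (- b) * rcut (real (Suc n)) 0 b x) has_derivative
      (\<lambda>h. real (Suc n) powr (- b) * (rcut' (real (Suc n)) 0 b x * (x \<bullet> h)))) (at x)"
    by (intro has_derivative_mult_right rcut_has_derivative)
  then show ?thesis by (simp add: trunc_weight_def[abs_def] trunc_weight'_def mult.assoc)
qed

lemma cut_poly_trunc_weight: "cut_poly (real (Suc n)) (trunc_weight n b)"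
  unfolding trunc_weight_def[abs_def] by (intro cut_poly.intros)

lemma rcut_eq:
  assumes "n > 0" "norm x < 1"
  defines "t \<equiv> n * (1 - (norm x)\<^sup>2) - 1"
  shows "n powr (- b) * rcut n k b x = (if t > 0 then (1 / t) ^ k * exp (- 1 / t) else 0) * weight b x"
proof -
  have "0 \<le> 1 - (norm x)\<^sup>2" using assms(2) by (simp add: power_le_one)
  then show ?thesis
    using assms(1) by (simp add: rcut_def cutoff_def t_def weight_def powr_mult powr_minus)
qed

text \<open>With y = 1 / t these compare 1, y and y^2 / 2 with exp y.\<close>

lemma exp_cutoff_bounds:
  fixes t :: real assumes "t > 0"
  shows "exp (- 1 / t) \<le> 1" "1 / t * exp (- 1 / t) \<le> 1" "(1 / t) ^ 2 * exp (- 1 / t) \<le> 2"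
proof -
  define y where "y = 1 / t"
  have y: "y > 0" using assms by (simp add: y_def)
  have e: "exp (- 1 / t) = 1 / exp y" by (simp add: y_def exp_minus inverse_eq_divide)
  have "y \<le> exp y" using exp_ge_add_one_self[of y] by linarith
  moreover have "y ^ 2 \<le> 2 * exp y" using exp_lower_Taylor_quadratic[of y] y by simp
  ultimately show "exp (- 1 / t) \<le> 1" "1 / t * exp (- 1 / t) \<le> 1" "(1 / t) ^ 2 * exp (- 1 / t) \<le> 2"
    using y unfolding e y_def[symmetric] by (simp_all add: field_simps)
qed

lemma trunc_weight_bounds:
  assumes "norm x < 1"
  shows "0 \<le> trunc_weight n b x" "trunc_weight n b x \<le> weight b x"
proof -
  have w: "0 \<le> weight b x" by (simp add: weight_def)
  show "0 \<le> trunc_weight n b x" "trunc_weight n b x \<le> weight b x"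
    unfolding trunc_weight_def using w assms exp_cutoff_bounds(1)
    by (auto simp: rcut_eq intro!: mult_left_le_one_le mult_nonneg_nonneg)
qed

text \<open>Differentiating the cutoff produces a factor n, which the multiplier 1 - |x|^2 turns
  into t + 1. What remains is a function of t alone times the weight, so bounds and limits in n
  become bounds and limits in t.\<close>

lemma trunc_weight'_eq:
  fixes n :: nat
  assumes "norm x < 1"
  defines "t \<equiv> real (Suc n) * (1 - (norm x)\<^sup>2) - 1"
  shows "trunc_weight' n b x * (1 - (norm x)\<^sup>2) =
     - 2 * (if t > 0 then (t + 1) * ((1 / t) ^ 2 * exp (- 1 / t)) + b * exp (- 1 / t) else 0) * weight b x"
proof -
  define s where "s = 1 - (norm x)\<^sup>2"
  define m where "m = real (Suc n)"
  have s: "s > 0" using assms(1) by (simp add: s_def abs_square_less_1)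
  have m: "m > 0" by (simp add: m_def)
  have w: "weight (b - 1) x * s = weight b x" using s by (simp add: weight_def powr_diff s_def)
  have r1: "m powr (- b) * rcut m 2 b x = (if t > 0 then (1 / t) ^ 2 * exp (- 1 / t) else 0) * weight b x"
    using rcut_eq[OF m assms(1), of b 2] by (simp add: t_def m_def)
  have r2: "m powr (- (b - 1)) * rcut m 0 (b - 1) x = (if t > 0 then exp (- 1 / t) else 0) * weight (b - 1) x"
    using rcut_eq[OF m assms(1), of "b - 1" 0] by (simp add: t_def m_def)
  have m': "m powr (- b) * m = m powr (- (b - 1))" using m by (simp add: powr_diff powr_minus field_simps)
  have "trunc_weight' n b x * s = - 2 * (m * s * (m powr (- b) * rcut m 2 b x)
     + b * s * ((m powr (- b) * m) * rcut m 0 (b - 1) x))"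
    unfolding trunc_weight'_def rcut'_def m_def[symmetric] by (simp add: numeral_2_eq_2 algebra_simps)
  also have "\<dots> = - 2 * ((t + 1) * ((if t > 0 then (1 / t) ^ 2 * exp (- 1 / t) else 0) * weight b x)
     + b * (if t > 0 then exp (- 1 / t) else 0) * (weight (b - 1) x * s))"
    unfolding r1 m' r2 by (simp add: t_def s_def m_def)
  also have "\<dots> = - 2 * (if t > 0 then (t + 1) * ((1 / t) ^ 2 * exp (- 1 / t)) + b * exp (- 1 / t) else 0) * weight b x"
    unfolding w by (simp add: algebra_simps)
  finally show ?thesis by (simp add: s_def)
qed

lemma trunc_weight'_bound:
  assumes "norm x < 1"
  shows "\<bar>trunc_weight' n b x * (1 - (norm x)\<^sup>2)\<bar> \<le> (6 + 2 * \<bar>b\<bar>) * weight b x"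
proof -
  define t where "t = real (Suc n) * (1 - (norm x)\<^sup>2) - 1"
  have w: "0 \<le> weight b x" by (simp add: weight_def)
  \<comment> \<open>Splitting t + 1 leaves exp (- 1 / t) times 1 / t, at most 1, and times 1 / t^2,
    at most 2; doubling the sum gives 6.\<close>
  have "\<bar>2 * (if t > 0 then (t + 1) * ((1 / t) ^ 2 * exp (- 1 / t)) + b * exp (- 1 / t) else 0)\<bar> \<le> 6 + 2 * \<bar>b\<bar>"
  proof (cases "t > 0")
    case True
    have "(t + 1) * ((1 / t) ^ 2 * exp (- 1 / t)) = 1 / t * exp (- 1 / t) + (1 / t) ^ 2 * exp (- 1 / t)"
      using True by (simp add: field_simps power2_eq_square)
    moreover have "0 \<le> 1 / t * exp (- 1 / t)" "0 \<le> (1 / t) ^ 2 * exp (- 1 / t)" using True by auto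
    moreover have "\<bar>b * exp (- 1 / t)\<bar> \<le> \<bar>b\<bar>"
      using exp_cutoff_bounds(1)[OF True] by (simp add: abs_mult mult_left_le)
    moreover have "\<bar>2 * (A + C + E)\<bar> \<le> 6 + 2 * \<bar>b\<bar>" if "0 \<le> A" "A \<le> 1" "0 \<le> C" "C \<le> 2" "\<bar>E\<bar> \<le> \<bar>b\<bar>"
      for A C E :: real using that by (smt (verit))
    ultimately have "\<bar>2 * ((t + 1) * ((1 / t) ^ 2 * exp (- 1 / t)) + b * exp (- 1 / t))\<bar> \<le> 6 + 2 * \<bar>b\<bar>"
      using exp_cutoff_bounds(2,3)[OF True] by presburger
    then show ?thesis using True by simp
  qed simp
  then have "\<bar>2 * (if t > 0 then (t + 1) * ((1 / t) ^ 2 * exp (- 1 / t)) + b * exp (- 1 / t) else 0)\<bar> * weight b x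
     \<le> (6 + 2 * \<bar>b\<bar>) * weight b x"
    by (rule mult_right_mono[OF _ w])
  then show ?thesis
    unfolding trunc_weight'_eq[OF assms] t_def using w by (simp add: abs_mult)
qed

lemma cutoff_parameter_at_top:
  assumes "norm x < 1"
  shows "filterlim (\<lambda>n. real (Suc n) * (1 - (norm x)\<^sup>2) - 1) at_top sequentially"
proof -
  have "1 - (norm x)\<^sup>2 > 0" using assms by (simp add: abs_square_less_1)
  then show ?thesis by real_asymp
qed

lemma trunc_weight_tendsto:
  assumes "norm x < 1"
  shows "(\<lambda>n. trunc_weight n b x) \<longlonglongrightarrow> weight b x"
proof -
  have "((\<lambda>t::real. (if t > 0 then exp (- 1 / t) else 0) * weight b x) \<longlongrightarrow> 1 * weight b x) at_top"
  proof (rule tendsto_mult[OF _ tendsto_const])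
    have "((\<lambda>t::real. exp (- 1 / t)) \<longlongrightarrow> 1) at_top" by real_asymp
    then show "((\<lambda>t::real. (if t > 0 then exp (- 1 / t) else 0)) \<longlongrightarrow> 1) at_top"
      by (rule Lim_transform_eventually) (auto intro: eventually_mono[OF eventually_gt_at_top[of 0]])
  qed
  from filterlim_compose[OF this cutoff_parameter_at_top[OF assms]]
  show ?thesis using assms by (simp add: trunc_weight_def rcut_eq del: of_nat_Suc cong: if_cong)
qed

text \<open>The cutoff term (t + 1) / t^2 times exp (- 1 / t) dies out as t grows. What is left
  belongs to the gradient of W_b, which is - 2 b x W_(b-1), multiplied by 1 - |x|^2.\<close>

lemma trunc_weight'_tendsto:
  assumes "norm x < 1"
  shows "(\<lambda>n. trunc_weight' n b x * (1 - (norm x)\<^sup>2)) \<longlonglongrightarrow> - 2 * b * weight b x"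
proof -
  let ?f = "\<lambda>t::real. (t + 1) * ((1 / t) ^ 2 * exp (- 1 / t)) + b * exp (- 1 / t)"
  have "((\<lambda>t::real. - 2 * (if t > 0 then ?f t else 0) * weight b x) \<longlongrightarrow> - 2 * b * weight b x) at_top"
  proof (intro tendsto_mult tendsto_const)
    have "((\<lambda>t::real. (t + 1) * ((1 / t) ^ 2 * exp (- 1 / t))) \<longlongrightarrow> 0) at_top" "((\<lambda>t::real. exp (- 1 / t)) \<longlongrightarrow> 1) at_top"
      by real_asymp+
    from tendsto_add[OF this(1) tendsto_mult[OF tendsto_const[of b] this(2)]]
    have "(?f \<longlongrightarrow> b) at_top" by simp
    then show "((\<lambda>t::real. (if t > 0 then ?f t else 0)) \<longlongrightarrow> b) at_top"
      by (rule Lim_transform_eventually) (auto intro: eventually_mono[OF eventually_gt_at_top[of 0]])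
  qed
  from filterlim_compose[OF this cutoff_parameter_at_top[OF assms]]
  show ?thesis using assms by (simp add: trunc_weight'_eq del: of_nat_Suc)
qed

section \<open>Polynomials\<close>

definition rmono :: "'n::finite multi_index \<Rightarrow> real ^ 'n \<Rightarrow> real" where
  "rmono \<gamma> x = (\<Prod>i\<in>UNIV. (x $ i) ^ \<gamma> i)"

text \<open>Strict degree bounds keep the orthogonality relations below free of truncated subtraction:
  \<open>polys_below 0\<close> is the zero space.\<close>

definition polys_below :: "nat \<Rightarrow> (real ^ 'n::finite \<Rightarrow> complex) set" where
  "polys_below N = {p. \<exists>c. p = (\<lambda>x. \<Sum>\<gamma> | mi_abs \<gamma> < N. c \<gamma> * of_real (rmono \<gamma> x))}"

lemma polys_eq_below: "polys N = polys_below (Suc N)"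
  by (simp add: polys_def polys_below_def rmono_def less_Suc_eq_le)

lemma finite_mi_abs_less: "finite {\<gamma> :: 'n::finite multi_index. mi_abs \<gamma> < N}"
  by (rule finite_subset[OF _ finite_mi_abs_le[of N]]) auto

lemma rmono_zero [simp]: "rmono (\<lambda>_. 0) x = 1"
  by (simp add: rmono_def)

lemma mi_abs_zero [simp]: "mi_abs (\<lambda>_. 0) = 0"
  by (simp add: mi_abs_def)

lemma mi_abs_inc [simp]: "mi_abs (inc i \<gamma>) = Suc (mi_abs \<gamma>)"
  by (simp add: mi_abs_def inc_def sum.remove[of UNIV i])

lemma rmono_inc: "rmono (inc i \<gamma>) x = x $ i * rmono \<gamma> x"
  by (simp add: rmono_def inc_def prod.remove[of UNIV i])

lemma mi_abs_Suc_cases: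
  assumes "mi_abs \<gamma> = Suc k"
  obtains \<delta> i where "\<gamma> = inc i \<delta>" "mi_abs \<delta> = k"
proof -
  from assms obtain i where i: "\<gamma> i \<noteq> 0"
    by (metis mi_abs_def nat.distinct(1) sum.neutral)
  let ?d = "\<gamma>(i := \<gamma> i - 1)"
  have eq: "\<gamma> = inc i ?d" using i by (auto simp: fun_eq_iff inc_def)
  moreover have "mi_abs ?d = k"
    using arg_cong[OF eq, of mi_abs] assms unfolding mi_abs_inc by linarith
  ultimately show ?thesis by (rule that)
qed

lemma polys_below_zero: "(\<lambda>x. 0) \<in> polys_below N"
  by (auto simp: polys_below_def intro!: exI[of _ "\<lambda>_. 0"])

lemma polys_below_0 [simp]: "p \<in> polys_below 0 \<longleftrightarrow> p = (\<lambda>x. 0)"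
  by (auto simp: polys_below_def)

lemma polys_below_add: "p \<in> polys_below N \<Longrightarrow> q \<in> polys_below N \<Longrightarrow> (\<lambda>x. p x + q x) \<in> polys_below N"
proof -
  assume "p \<in> polys_below N" "q \<in> polys_below N"
  then obtain c d where "p = (\<lambda>x. \<Sum>\<gamma> | mi_abs \<gamma> < N. c \<gamma> * of_real (rmono \<gamma> x))"
     "q = (\<lambda>x. \<Sum>\<gamma> | mi_abs \<gamma> < N. d \<gamma> * of_real (rmono \<gamma> x))"
    by (auto simp: polys_below_def)
  then show ?thesis unfolding polys_below_def
    by (auto simp: sum.distrib[symmetric] distrib_right[symmetric] intro!: exI[of _ "\<lambda>\<gamma>. c \<gamma> + d \<gamma>"])
qed

lemma polys_below_cmult: "p \<in> polys_below N \<Longrightarrow> (\<lambda>x. c * p x) \<in> polys_below N"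
proof -
  assume "p \<in> polys_below N"
  then obtain d where "p = (\<lambda>x. \<Sum>\<gamma> | mi_abs \<gamma> < N. d \<gamma> * of_real (rmono \<gamma> x))"
    by (auto simp: polys_below_def)
  then show ?thesis unfolding polys_below_def
    by (auto simp: sum_distrib_left mult.assoc[symmetric] intro!: exI[of _ "\<lambda>\<gamma>. c * d \<gamma>"])
qed

lemma polys_below_minus: "p \<in> polys_below N \<Longrightarrow> (\<lambda>x. - p x) \<in> polys_below N"
  using polys_below_cmult[of p N "-1"] by simp

lemma polys_below_diff: "p \<in> polys_below N \<Longrightarrow> q \<in> polys_below N \<Longrightarrow> (\<lambda>x. p x - q x) \<in> polys_below N"
  using polys_below_add[OF _ polys_below_minus, of p N q] by simp

lemma polys_below_sum:
  "(\<And>i. i \<in> A \<Longrightarrow> p i \<in> polys_below N) \<Longrightarrow> (\<lambda>x. \<Sum>i\<in>A. p i x) \<in> polys_below N"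
  by (induction A rule: infinite_finite_induct) (auto intro: polys_below_zero polys_below_add)

lemma polys_below_mono: "N \<le> M \<Longrightarrow> polys_below N \<subseteq> polys_below M"
proof
  fix p :: "real ^ 'n \<Rightarrow> complex" assume "N \<le> M" "p \<in> polys_below N"
  then obtain c where c: "p = (\<lambda>x. \<Sum>\<gamma> | mi_abs \<gamma> < N. c \<gamma> * of_real (rmono \<gamma> x))"
    by (auto simp: polys_below_def)
  have "p = (\<lambda>x. \<Sum>\<gamma> | mi_abs \<gamma> < M. (if mi_abs \<gamma> < N then c \<gamma> else 0) * of_real (rmono \<gamma> x))"
    unfolding c using \<open>N \<le> M\<close>
    by (intro ext sum.mono_neutral_cong_left finite_mi_abs_less) auto
  then show "p \<in> polys_below M" unfolding polys_below_def mem_Collect_eq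
    by (rule exI[where x = "\<lambda>\<gamma>. if mi_abs \<gamma> < N then c \<gamma> else 0"])
qed

lemma polys_below_rmono:
  assumes "mi_abs \<gamma> < N"
  shows "(\<lambda>x. c * of_real (rmono \<gamma> x)) \<in> polys_below N"
proof -
  have "(\<Sum>\<delta> | mi_abs \<delta> < N. (if \<delta> = \<gamma> then c else 0) * of_real (rmono \<delta> x)) = c * of_real (rmono \<gamma> x)" for x
    using assms by (simp add: if_distrib[of "\<lambda>a. a * _"] sum.delta finite_mi_abs_less cong: if_cong)
  then show ?thesis unfolding polys_below_def by (auto intro!: exI[of _ "\<lambda>\<delta>. if \<delta> = \<gamma> then c else 0"])
qed

text \<open>Membership of the partial sum is kept as a hypothesis because distributing a derivative
  over the sum needs its differentiability.\<close>

lemma polys_below_induct [consumes 1, case_names zero add]: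
  assumes "p \<in> polys_below N"
    and "P (\<lambda>x. 0)"
    and "\<And>\<gamma> c p. mi_abs \<gamma> < N \<Longrightarrow> p \<in> polys_below N \<Longrightarrow> P p \<Longrightarrow> P (\<lambda>x. c * of_real (rmono \<gamma> x) + p x)"
  shows "P p"
proof -
  obtain c where c: "p = (\<lambda>x. \<Sum>\<gamma> | mi_abs \<gamma> < N. c \<gamma> * of_real (rmono \<gamma> x))"
    using assms(1) by (auto simp: polys_below_def)
  have "P (\<lambda>x. \<Sum>\<gamma>\<in>A. c \<gamma> * of_real (rmono \<gamma> x))"
    if "A \<subseteq> {\<gamma>. mi_abs \<gamma> < N}" for A
    using finite_subset[OF that finite_mi_abs_less] that
  proof (induction A rule: finite_induct)
    case (insert \<gamma> A)
    have "(\<lambda>x. \<Sum>\<gamma>\<in>A. c \<gamma> * of_real (rmono \<gamma> x)) \<in> polys_below N"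
      using insert by (intro polys_below_sum polys_below_rmono) auto
    with insert assms(3) show ?case by auto
  qed (use assms in auto)
  then show ?thesis unfolding c by blast
qed

lemma polys_below_const: "0 < N \<Longrightarrow> (\<lambda>x. c) \<in> polys_below N"
  using polys_below_rmono[of "\<lambda>_. 0" N c] by simp

lemma polys_below_coord:
  assumes "p \<in> polys_below N"
  shows "(\<lambda>x. of_real (x $ i) * p x) \<in> polys_below (Suc N)"
  using assms
proof (induction rule: polys_below_induct)
  case (add \<gamma> c p)
  have "(\<lambda>x. c * of_real (rmono (inc i \<gamma>) x) + of_real (x $ i) * p x) \<in> polys_below (Suc N)"
    using add by (intro polys_below_add polys_below_rmono) auto
  then show ?case by (simp add: rmono_inc algebra_simps)
qed (simp add: polys_below_zero)

lemma polys_below_norm: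
  assumes "p \<in> polys_below N"
  shows "(\<lambda>x. of_real ((norm x)\<^sup>2) * p x) \<in> polys_below (Suc (Suc N))"
proof -
  have "(\<lambda>x. \<Sum>i\<in>UNIV. of_real (x $ i) * (of_real (x $ i) * p x)) \<in> polys_below (Suc (Suc N))"
    by (intro polys_below_sum polys_below_coord assms)
  then show ?thesis
    by (simp add: power2_norm_eq_inner inner_vec_def sum_distrib_right mult.assoc)
qed

lemma polys_below_one_minus_norm:
  assumes "p \<in> polys_below N"
  shows "(\<lambda>x. of_real (1 - (norm x)\<^sup>2) * p x) \<in> polys_below (Suc (Suc N))"
proof -
  have "p \<in> polys_below (Suc (Suc N))" using assms polys_below_mono[of N "Suc (Suc N)"] by auto
  then have "(\<lambda>x. p x - of_real ((norm x)\<^sup>2) * p x) \<in> polys_below (Suc (Suc N))"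
    using polys_below_norm[OF assms] by (rule polys_below_diff)
  then show ?thesis by (simp add: algebra_simps)
qed

section \<open>Partial derivatives and the Euler operator on polynomials\<close>

definition pd :: "'n::finite \<Rightarrow> (real ^ 'n \<Rightarrow> complex) \<Rightarrow> real ^ 'n \<Rightarrow> complex" where
  "pd i p x = frechet_derivative p (at x) (axis i 1)"

definition pdiff :: "(real ^ 'n::finite \<Rightarrow> complex) \<Rightarrow> bool" where
  "pdiff p \<longleftrightarrow> (\<forall>x. p differentiable (at x))"

lemma pd_eq: "(p has_derivative D) (at x) \<Longrightarrow> pd i p x = D (axis i 1)"
  by (simp add: pd_def frechet_derivative_at[symmetric])

lemma pdiff_has_derivative: "pdiff p \<Longrightarrow> (p has_derivative frechet_derivative p (at x)) (at x)"
  by (simp add: pdiff_def frechet_derivative_works)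

lemma has_derivative_imp_pdiff: "(\<And>x. (p has_derivative D x) (at x)) \<Longrightarrow> pdiff p"
  unfolding pdiff_def differentiable_def by blast

lemma has_derivative_coord [derivative_intros]:
  "((\<lambda>x::real ^ 'n::finite. x $ i) has_derivative (\<lambda>h. h $ i)) F"
  by (intro bounded_linear.has_derivative[OF bounded_linear_vec_nth] has_derivative_ident)

lemma has_derivative_of_real_complex [derivative_intros]:
  "(f has_derivative D) F \<Longrightarrow> ((\<lambda>x. complex_of_real (f x)) has_derivative (\<lambda>h. complex_of_real (D h))) F"
  by (rule bounded_linear.has_derivative[OF bounded_linear_of_real])

lemma
  assumes "pdiff p" "pdiff q"
  shows pdiff_add: "pdiff (\<lambda>x. p x + q x)" and pd_add: "pd i (\<lambda>x. p x + q x) x = pd i p x + pd i q x"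
    and pd_diff: "pd i (\<lambda>x. p x - q x) x = pd i p x - pd i q x"
    and pdiff_mult: "pdiff (\<lambda>x. p x * q x)"
    and pd_mult: "pd i (\<lambda>x. p x * q x) x = p x * pd i q x + pd i p x * q x"
proof -
  note D = pdiff_has_derivative[OF assms(1)] pdiff_has_derivative[OF assms(2)]
  show "pdiff (\<lambda>x. p x + q x)" "pdiff (\<lambda>x. p x * q x)"
    by (rule has_derivative_imp_pdiff, rule derivative_intros D, rule D, rule D)+
  show "pd i (\<lambda>x. p x + q x) x = pd i p x + pd i q x"
    by (subst pd_eq[OF has_derivative_add[OF D]]) (simp add: pd_def)
  show "pd i (\<lambda>x. p x - q x) x = pd i p x - pd i q x"
    by (subst pd_eq[OF has_derivative_diff[OF D]]) (simp add: pd_def)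
  show "pd i (\<lambda>x. p x * q x) x = p x * pd i q x + pd i p x * q x"
    by (subst pd_eq[OF has_derivative_mult[OF D]]) (simp add: pd_def)
qed

lemma pdiff_const: "pdiff (\<lambda>x. c)" and pd_const [simp]: "pd i (\<lambda>x. c) x = 0"
proof -
  show "pdiff (\<lambda>x. c)" by (rule has_derivative_imp_pdiff) (rule has_derivative_const)
  show "pd i (\<lambda>x. c) x = 0" by (subst pd_eq[OF has_derivative_const]) simp
qed

lemma pdiff_coord: "pdiff (\<lambda>x. of_real (x $ j))"
  and pd_coord: "pd i (\<lambda>x. of_real (x $ j)) x = (if j = i then 1 else 0)"
proof -
  show "pdiff (\<lambda>x. of_real (x $ j))" by (rule has_derivative_imp_pdiff) (rule derivative_intros)+
  show "pd i (\<lambda>x. of_real (x $ j)) x = (if j = i then 1 else 0)"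
    by (subst pd_eq[OF has_derivative_of_real_complex[OF has_derivative_coord]]) (simp add: axis_def)
qed

lemma pdiff_cmult: "pdiff p \<Longrightarrow> pdiff (\<lambda>x. c * p x)"
  and pd_cmult: "pdiff p \<Longrightarrow> pd i (\<lambda>x. c * p x) x = c * pd i p x"
  by (simp_all add: pdiff_mult pd_mult pdiff_const)

lemma rmono_induct:
  assumes "P (\<lambda>_. 0)" and "\<And>\<gamma> i. P \<gamma> \<Longrightarrow> P (inc i \<gamma>)"
  shows "P (\<gamma> :: 'n::finite multi_index)"
proof (induction "mi_abs \<gamma>" arbitrary: \<gamma>)
  case 0
  then have "\<gamma> = (\<lambda>_. 0)" by (auto simp: mi_abs_def fun_eq_iff)
  with assms(1) show ?case by simp
next
  case (Suc k)
  then show ?case by (metis mi_abs_Suc_cases assms(2))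
qed

lemma pdiff_rmono: "pdiff (\<lambda>x. of_real (rmono \<gamma> x))"
  by (induction \<gamma> rule: rmono_induct) (auto simp: rmono_inc pdiff_const intro: pdiff_mult pdiff_coord)

lemma pd_rmono_below: "mi_abs \<gamma> < N \<Longrightarrow> pd i (\<lambda>x. of_real (rmono \<gamma> x)) \<in> polys_below (N - 1)"
proof (induction \<gamma> arbitrary: N rule: rmono_induct)
  case 1
  then show ?case by (simp add: fun_eq_iff[symmetric] polys_below_zero pd_const[abs_def])
next
  case (2 \<gamma> j)
  then have N: "mi_abs \<gamma> < N - 1" by simp
  have "pd i (\<lambda>x. of_real (rmono (inc j \<gamma>) x)) =
     (\<lambda>x. of_real (x $ j) * pd i (\<lambda>x. of_real (rmono \<gamma> x)) x + (if j = i then 1 else 0) * of_real (rmono \<gamma> x))"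
    by (simp add: fun_eq_iff rmono_inc pd_mult pdiff_coord pdiff_rmono pd_coord)
  \<comment> \<open>Here \<open>N - 1\<close> is positive, so the coordinate factor raises the bound
    \<open>N - 1 - 1\<close> exactly to \<open>N - 1\<close>.\<close>
  also have "\<dots> \<in> polys_below (N - 1)"
    using polys_below_coord[OF 2(1)[OF N], of j] N Suc_diff_1[of "N - 1"] by (intro polys_below_add polys_below_rmono) auto
  finally show ?case .
qed

lemma polys_below_pdiff: "p \<in> polys_below N \<Longrightarrow> pdiff p"
  by (induction rule: polys_below_induct) (auto intro!: pdiff_const pdiff_add pdiff_cmult pdiff_rmono)

lemma pd_polys_below: "p \<in> polys_below N \<Longrightarrow> pd i p \<in> polys_below (N - 1)"
proof (induction rule: polys_below_induct)
  case zero
  then show ?case by (simp add: pd_const[abs_def] polys_below_zero)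
next
  case (add \<gamma> c p)
  have "pd i (\<lambda>x. c * of_real (rmono \<gamma> x) + p x) = (\<lambda>x. c * pd i (\<lambda>x. of_real (rmono \<gamma> x)) x + pd i p x)"
    using add by (simp add: fun_eq_iff pd_add pd_cmult pdiff_rmono pdiff_cmult polys_below_pdiff)
  also have "\<dots> \<in> polys_below (N - 1)"
    using add by (intro polys_below_add polys_below_cmult pd_rmono_below)
  finally show ?case .
qed

definition euler :: "(real ^ 'n::finite \<Rightarrow> complex) \<Rightarrow> real ^ 'n \<Rightarrow> complex" where
  "euler p x = (\<Sum>i\<in>UNIV. of_real (x $ i) * pd i p x)"

lemma euler_add: "pdiff p \<Longrightarrow> pdiff q \<Longrightarrow> euler (\<lambda>x. p x + q x) x = euler p x + euler q x"
  by (simp add: euler_def pd_add algebra_simps sum.distrib)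

lemma euler_cmult: "pdiff p \<Longrightarrow> euler (\<lambda>x. c * p x) x = c * euler p x"
  by (simp add: euler_def pd_cmult sum_distrib_left mult.left_commute)

lemma euler_rmono: "euler (\<lambda>x. of_real (rmono \<gamma> x)) x = of_nat (mi_abs \<gamma>) * of_real (rmono \<gamma> x)"
proof (induction \<gamma> rule: rmono_induct)
  case 1
  then show ?case by (simp add: euler_def)
next
  case (2 \<gamma> j)
  have "euler (\<lambda>x. of_real (x $ j) * of_real (rmono \<gamma> x)) x =
    of_real (x $ j) * euler (\<lambda>x. of_real (rmono \<gamma> x)) x + of_real (x $ j) * of_real (rmono \<gamma> x)"
    by (simp add: euler_def pd_mult pdiff_coord pdiff_rmono pd_coord algebra_simps sum.distrib
        sum_distrib_left if_distrib[of "\<lambda>a. _ * a"] cong: if_cong)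
  then show ?case using 2 by (simp add: rmono_inc algebra_simps)
qed

text \<open>Each monomial is an eigenfunction of the Euler operator with its degree as eigenvalue.
  Subtracting k times the polynomial therefore cancels the part of degree k.\<close>

lemma euler_polys_below: "p \<in> polys_below N \<Longrightarrow> euler p \<in> polys_below N"
  and euler_top: "p \<in> polys_below (Suc k) \<Longrightarrow> (\<lambda>x. euler p x - of_nat k * p x) \<in> polys_below k"
proof -
  show "euler p \<in> polys_below N" if "p \<in> polys_below N"
    using that
  proof (induction rule: polys_below_induct)
    case zero
    then show ?case by (simp add: euler_def[abs_def] polys_below_zero)
  next
    case (add \<gamma> c p)
    have "euler (\<lambda>x. c * of_real (rmono \<gamma> x) + p x) = (\<lambda>x. (c * of_nat (mi_abs \<gamma>)) * of_real (rmono \<gamma> x) + euler p x)"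
      using add by (simp add: fun_eq_iff euler_add euler_cmult pdiff_rmono pdiff_cmult polys_below_pdiff euler_rmono)
    also have "\<dots> \<in> polys_below N"
      using add by (intro polys_below_add polys_below_rmono)
    finally show ?case .
  qed
  show "(\<lambda>x. euler p x - of_nat k * p x) \<in> polys_below k" if "p \<in> polys_below (Suc k)"
    using that
  proof (induction rule: polys_below_induct)
    case zero
    then show ?case by (simp add: euler_def[abs_def] polys_below_zero)
  next
    case (add \<gamma> c p)
    have "(\<lambda>x. euler (\<lambda>x. c * of_real (rmono \<gamma> x) + p x) x - of_nat k * (c * of_real (rmono \<gamma> x) + p x)) =
       (\<lambda>x. (c * (of_nat (mi_abs \<gamma>) - of_nat k)) * of_real (rmono \<gamma> x) + (euler p x - of_nat k * p x))"
      using add by (simp add: fun_eq_iff euler_add euler_cmult pdiff_rmono pdiff_cmult polys_below_pdiff euler_rmono algebra_simps)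
    also have "\<dots> \<in> polys_below k"
    proof (cases "mi_abs \<gamma> = k")
      case False
      with add show ?thesis by (intro polys_below_add polys_below_rmono) auto
    qed (use add in auto)
    finally show ?case .
  qed
qed

lemma polys_below_Suc: "p \<in> polys_below N \<Longrightarrow> p \<in> polys_below (Suc N)"
  using polys_below_mono[of N "Suc N"] by auto

text \<open>The second order operator \<open>u \<mapsto> W\<^sub>\<alpha>\<inverse> div (W\<^sub>\<alpha> (\<nabla>u - x (x \<cdot> \<nabla>u)))\<close>.\<close>

definition sturm :: "real \<Rightarrow> (real ^ 'n::finite \<Rightarrow> complex) \<Rightarrow> real ^ 'n \<Rightarrow> complex" where
  "sturm a p x = (\<Sum>i\<in>UNIV. pd i (\<lambda>x. pd i p x - of_real (x $ i) * euler p x) x) - of_real (2 * a) * euler p x"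

definition eigval :: "'n::finite itself \<Rightarrow> real \<Rightarrow> nat \<Rightarrow> real" where
  "eigval _ a k = real k * (real k + real CARD('n) + 2 * a)"

lemma sturm_eq:
  fixes p :: "real ^ 'n::finite \<Rightarrow> complex"
  assumes "p \<in> polys_below N"
  shows "sturm a p x = (\<Sum>i\<in>UNIV. pd i (pd i p) x) - of_real (real CARD('n) + 2 * a) * euler p x - euler (euler p) x"
proof -
  have d: "pdiff p" "pdiff (pd i p)" "pdiff (euler p)" for i
    using assms pd_polys_below euler_polys_below polys_below_pdiff by blast+
  have "pd i (\<lambda>x. pd i p x - of_real (x $ i) * euler p x) x
      = pd i (pd i p) x - of_real (x $ i) * pd i (euler p) x - euler p x" for i
    by (simp add: pd_diff pd_mult d pdiff_coord pdiff_mult pd_coord)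
  then have "(\<Sum>i\<in>UNIV. pd i (\<lambda>x. pd i p x - of_real (x $ i) * euler p x) x)
      = (\<Sum>i\<in>UNIV. pd i (pd i p) x - of_real (x $ i) * pd i (euler p) x - euler p x)"
    by (rule sum.cong[OF refl])
  then show ?thesis
    by (simp add: sturm_def sum_subtractf sum.distrib euler_def[of "euler p"] algebra_simps)
qed

lemma sturm_polys_below:
  assumes "p \<in> polys_below N"
  shows "sturm a p \<in> polys_below N"
proof -
  have "pd i (pd i p) \<in> polys_below N" for i
    using pd_polys_below[OF pd_polys_below[OF assms], of i i] polys_below_mono[of "N - 1 - 1" N] by auto
  then have "(\<lambda>x. (\<Sum>i\<in>UNIV. pd i (pd i p) x) - of_real (real CARD('a) + 2 * a) * euler p x - euler (euler p) x) \<in> polys_below N"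
    by (intro polys_below_diff polys_below_sum polys_below_cmult euler_polys_below assms)
  then show ?thesis by (simp add: sturm_eq[OF assms, abs_def])
qed

text \<open>The Laplacian lowers the degree by two, and the Euler operator acts on the part of
  degree k as multiplication by k. By \<open>sturm_eq\<close>, \<open>- sturm a\<close> acts there
  as k^2 + (d + 2 a) k.\<close>

lemma sturm_top:
  fixes p :: "real ^ 'n::finite \<Rightarrow> complex"
  assumes "p \<in> polys_below (Suc k)"
  shows "(\<lambda>x. sturm a p x + of_real (eigval TYPE('n) a k) * p x) \<in> polys_below k"
proof -
  define q where "q = (\<lambda>x. euler p x - of_nat k * p x)"
  have q: "q \<in> polys_below k" using euler_top[OF assms] by (simp add: q_def)
  have e: "euler p = (\<lambda>x. of_nat k * p x + q x)" by (simp add: q_def)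
  have d: "pdiff p" "pdiff q" using assms q polys_below_pdiff by blast+
  have ee: "euler (euler p) x = of_nat k * (of_nat k * p x + q x) + euler q x" for x
    by (subst e) (simp add: euler_add euler_cmult pdiff_cmult d, simp add: e)
  have "pd i (pd i p) \<in> polys_below k" for i
    using pd_polys_below[OF pd_polys_below[OF assms], of i i] polys_below_mono[of "Suc k - 1 - 1" k] by auto
  then have "(\<lambda>x. (\<Sum>i\<in>UNIV. pd i (pd i p) x) - of_real (real CARD('n) + 2 * a + real k) * q x - euler q x) \<in> polys_below k"
    by (intro polys_below_diff polys_below_sum polys_below_cmult euler_polys_below q)
  moreover have "sturm a p x + of_real (eigval TYPE('n) a k) * p x =
    (\<Sum>i\<in>UNIV. pd i (pd i p) x) - of_real (real CARD('n) + 2 * a + real k) * q x - euler q x" for x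
    unfolding sturm_eq[OF assms] ee by (subst e) (simp add: eigval_def algebra_simps)
  ultimately show ?thesis by simp
qed

lemma pdiff_isCont: "pdiff p \<Longrightarrow> isCont p x"
  unfolding pdiff_def by (simp add: differentiable_imp_continuous_within)

lemma polys_below_continuous: "p \<in> polys_below N \<Longrightarrow> continuous_on S p"
  by (meson polys_below_pdiff pdiff_isCont continuous_at_imp_continuous_on)

lemma polys_below_bounded:
  assumes "p \<in> polys_below N"
  obtains K where "K \<ge> 0" "\<And>x. norm x \<le> 1 \<Longrightarrow> cmod (p x) \<le> K"
proof -
  have "bounded (p ` cball 0 1)"
    using compact_continuous_image[OF polys_below_continuous[OF assms] compact_cball] compact_imp_bounded by blast
  then obtain K where "\<forall>x\<in>cball 0 1. cmod (p x) \<le> K" by (auto simp: bounded_iff)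
  then show ?thesis using that[of "max K 0"] by (auto simp: le_max_iff_disj)
qed

section \<open>Integration by parts\<close>

abbreviation lball :: "(real ^ 'n::finite) measure" where
  "lball \<equiv> lebesgue_on (ball 0 1)"

lemma finite_measure_lball: "finite_measure lball"
  by (rule finite_measure_lebesgue_on) simp

lemma measurable_lball_borel: "f \<in> borel_measurable borel \<Longrightarrow> f \<in> borel_measurable lball"
  by (intro measurable_restrict_space1 measurable_completion) simp

lemma measurable_lball_continuous: "continuous_on UNIV f \<Longrightarrow> f \<in> borel_measurable lball"
  by (intro measurable_lball_borel borel_measurable_continuous_onI)

lemma weight_measurable: "weight a \<in> borel_measurable lball"
  unfolding weight_def[abs_def] by (intro measurable_lball_borel) measurable

lemma weight_nonneg [simp]: "0 \<le> weight a x"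
  by (simp add: weight_def)

lemma weight_Suc: "norm x < 1 \<Longrightarrow> weight (a + 1) x = (1 - (norm x)\<^sup>2) * weight a x"
  using abs_square_less_1[of "norm x"] by (simp add: weight_def powr_add mult.commute)

lemma pd_zero_off_closed:
  assumes "closed K" "\<And>x. x \<notin> K \<Longrightarrow> f x = 0" "x \<notin> K"
  shows "pd i f x = 0"
proof -
  have "(f has_derivative (\<lambda>_. 0)) (at x)"
    by (rule has_derivative_transform_within_open[OF has_derivative_const[of 0], of "- K"])
      (use assms in auto)
  from pd_eq[OF this] show ?thesis .
qed

lemma pdiff_line_derivative:
  assumes "pdiff f"
  shows "((\<lambda>t. f (x + t *\<^sub>R axis i 1)) has_vector_derivative pd i f (x + s *\<^sub>R axis i 1)) (at s)"
proof -
  let ?D = "frechet_derivative f (at (x + s *\<^sub>R axis i 1))"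
  note D = pdiff_has_derivative[OF assms, of "x + s *\<^sub>R axis i 1"]
  have "((\<lambda>t. f (x + t *\<^sub>R axis i 1)) has_derivative (\<lambda>t. ?D (t *\<^sub>R axis i 1))) (at s)"
    by (rule has_derivative_compose[where f = "\<lambda>t. x + t *\<^sub>R axis i 1" and g = f and g' = ?D])
      (use D in \<open>auto intro!: derivative_eq_intros\<close>)
  moreover have "?D (t *\<^sub>R axis i 1) = t *\<^sub>R ?D (axis i 1)" for t
    using has_derivative_linear[OF D] by (simp add: linear_cmul)
  ultimately show ?thesis by (simp add: has_vector_derivative_def pd_def)
qed

text \<open>Difference quotients have integral zero by translation invariance.\<close>

lemma integral_pd_eq_zero:
  fixes f :: "real ^ 'n::finite \<Rightarrow> complex"
  assumes f: "pdiff f" and cont: "continuous_on UNIV (pd i f)"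
    and K: "closed K" "K \<subseteq> ball 0 1" "\<And>x. x \<notin> K \<Longrightarrow> f x = 0"
  shows "integrable lball (pd i f)" "(LINT x|lball. pd i f x) = 0"
proof -
  let ?e = "axis i (1::real) :: real ^ 'n"
  have z: "pd i f x = 0" if "x \<notin> K" for x by (rule pd_zero_off_closed[OF K(1,3) that])
  have cf: "continuous_on UNIV f"
    using f by (simp add: continuous_at_imp_continuous_on pdiff_isCont)
  have ind: "(\<lambda>x. indicator (cball 0 1) x *\<^sub>R g x) = g" if "\<And>x. x \<notin> K \<Longrightarrow> g x = 0"
    for g :: "real ^ 'n \<Rightarrow> complex"
    using that K(2) by (fastforce simp: indicator_def fun_eq_iff)
  have int: "integrable lborel f" "integrable lborel (pd i f)"
    using borel_integrable_compact[OF compact_cball continuous_on_subset[OF cf], of 0 1]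
      borel_integrable_compact[OF compact_cball continuous_on_subset[OF cont], of 0 1] ind[OF K(3)] ind[OF z]
    by simp_all
  obtain C where C: "\<And>x. norm (pd i f x) \<le> C"
  proof -
    have "bounded (pd i f ` cball 0 1)"
      by (rule compact_imp_bounded[OF compact_continuous_image[OF continuous_on_subset[OF cont] compact_cball]]) simp
    then obtain C where C: "\<forall>x\<in>cball 0 1. norm (pd i f x) \<le> C" by (auto simp: bounded_iff)
    have "norm (pd i f x) \<le> C" for x
    proof (cases "x \<in> cball 0 1")
      case False
      then have "x \<notin> K" using K(2) by fastforce
      moreover have "0 \<le> C" using C norm_ge_zero order_trans by (metis centre_in_cball zero_le_one)
      ultimately show ?thesis using z by simp
    qed (use C in auto)
    then show ?thesis by (rule that)
  qed
  define h where "h n = 1 / real (Suc n)" for n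
  have h: "0 < h n" "h n \<le> 1" for n by (simp_all add: h_def)
  define q where "q n x = (1 / h n) *\<^sub>R (f (x + h n *\<^sub>R ?e) - f x)" for n x
  have lip: "norm (f (x + s *\<^sub>R ?e) - f x) \<le> C * \<bar>s\<bar>" for x s
  proof -
    have "norm (f (x + s *\<^sub>R ?e) - f (x + 0 *\<^sub>R ?e)) \<le> C * norm (s - 0)"
      by (rule differentiable_bound[where S = UNIV, OF _
            has_derivative_at_withinI[OF pdiff_line_derivative[OF f, unfolded has_vector_derivative_def]]])
        (auto intro!: onorm_le mult_left_mono C simp: mult.commute[of C])
    then show ?thesis by simp
  qed
  have fm: "f \<in> borel_measurable borel" by (rule borel_measurable_continuous_onI[OF cf])
  have tr: "integrable lborel (\<lambda>x. f (x + s *\<^sub>R ?e))" "(LINT x|lborel. f (x + s *\<^sub>R ?e)) = (LINT x|lborel. f x)" for s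
  proof -
    have "integrable (distr lborel borel ((+) (s *\<^sub>R ?e))) f" "(LINT x|distr lborel borel ((+) (s *\<^sub>R ?e)). f x) = (LINT x|lborel. f x)"
      using int by (simp_all add: lborel_distr_plus)
    then show "integrable lborel (\<lambda>x. f (x + s *\<^sub>R ?e))" "(LINT x|lborel. f (x + s *\<^sub>R ?e)) = (LINT x|lborel. f x)"
      using fm by (simp_all add: integrable_distr_eq integral_distr add.commute)
  qed
  have q0: "(LINT x|lborel. q n x) = 0" for n
    unfolding q_def using int tr by simp
  have "(\<lambda>n. LINT x|lborel. q n x) \<longlonglongrightarrow> (LINT x|lborel. pd i f x)"
  proof (rule integral_dominated_convergence)
    show "pd i f \<in> borel_measurable lborel" using int by auto
    show "q n \<in> borel_measurable lborel" for n
      unfolding q_def[abs_def] by (intro borel_measurable_integrable Bochner_Integration.integrable_diff integrable_scaleR_right tr int)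
    \<comment> \<open>The step h n is at most 1, so the quotients vanish off the ball of radius 2;
      on it the Lipschitz bound \<open>lip\<close> dominates them.\<close>
    show "integrable lborel (\<lambda>x. C * indicator (cball (0::real^'n) 2) x)"
      by (intro integrable_mult_right integrable_real_indicator) (use emeasure_bounded_finite[OF bounded_cball[of "0::real^'n" 2]] in auto)
    show "AE x in lborel. (\<lambda>n. q n x) \<longlonglongrightarrow> pd i f x"
    proof (rule AE_I2)
      fix x
      have "((\<lambda>t. (1 / t) *\<^sub>R (f (x + (0 + t) *\<^sub>R ?e) - f (x + 0 *\<^sub>R ?e))) \<longlongrightarrow> pd i f (x + 0 *\<^sub>R ?e)) (at 0)"
      proof -
        have "((\<lambda>t. norm (f (x + (0 + t) *\<^sub>R ?e) - f (x + 0 *\<^sub>R ?e) - t *\<^sub>R pd i f (x + 0 *\<^sub>R ?e)) / norm t) \<longlongrightarrow> 0) (at 0)"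
          using pdiff_line_derivative[OF f, of x i 0] by (simp add: has_vector_derivative_def has_derivative_at)
        then have "((\<lambda>t. norm ((1 / t) *\<^sub>R (f (x + (0 + t) *\<^sub>R ?e) - f (x + 0 *\<^sub>R ?e)) - pd i f (x + 0 *\<^sub>R ?e))) \<longlongrightarrow> 0) (at 0)"
        proof (rule Lim_transform_eventually)
          have "norm (f (x + (0 + t) *\<^sub>R ?e) - f (x + 0 *\<^sub>R ?e) - t *\<^sub>R pd i f (x + 0 *\<^sub>R ?e)) / norm t
            = norm ((1 / t) *\<^sub>R (f (x + (0 + t) *\<^sub>R ?e) - f (x + 0 *\<^sub>R ?e)) - pd i f (x + 0 *\<^sub>R ?e))" if "t \<noteq> 0" for t
          proof -
            have "(1 / t) *\<^sub>R (f (x + (0 + t) *\<^sub>R ?e) - f (x + 0 *\<^sub>R ?e)) - pd i f (x + 0 *\<^sub>R ?e)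
              = (1 / t) *\<^sub>R (f (x + (0 + t) *\<^sub>R ?e) - f (x + 0 *\<^sub>R ?e) - t *\<^sub>R pd i f (x + 0 *\<^sub>R ?e))"
              using that by (simp add: scaleR_diff_right)
            then show ?thesis by (simp only: norm_scaleR) simp
          qed
          then show "\<forall>\<^sub>F t in at 0. norm (f (x + (0 + t) *\<^sub>R ?e) - f (x + 0 *\<^sub>R ?e) - t *\<^sub>R pd i f (x + 0 *\<^sub>R ?e)) / norm t
            = norm ((1 / t) *\<^sub>R (f (x + (0 + t) *\<^sub>R ?e) - f (x + 0 *\<^sub>R ?e)) - pd i f (x + 0 *\<^sub>R ?e))"
            by (auto simp: eventually_at_filter)
        qed
        then show ?thesis by (rule LIM_zero_cancel[OF tendsto_norm_zero_cancel])
      qed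
      moreover have "filterlim h (at 0) sequentially"
        unfolding filterlim_at using h(1) LIMSEQ_inverse_real_of_nat
        by (auto simp: h_def[abs_def] inverse_eq_divide)
      ultimately have "(\<lambda>n. (1 / h n) *\<^sub>R (f (x + (0 + h n) *\<^sub>R ?e) - f (x + 0 *\<^sub>R ?e))) \<longlonglongrightarrow> pd i f (x + 0 *\<^sub>R ?e)"
        by (rule filterlim_compose)
      then show "(\<lambda>n. q n x) \<longlonglongrightarrow> pd i f x" by (simp add: q_def)
    qed
    show "AE x in lborel. norm (q n x) \<le> C * indicator (cball (0::real^'n) 2) x" for n
    proof (rule AE_I2)
      fix x :: "real ^ 'n"
      have "0 \<le> C" using C norm_ge_zero order_trans by blast
      show "norm (q n x) \<le> C * indicator (cball (0::real^'n) 2) x"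
      proof (cases "x \<in> cball 0 2")
        case True
        have "norm (q n x) = norm (f (x + h n *\<^sub>R ?e) - f x) / h n" using h[of n] by (simp add: q_def)
        also have "\<dots> \<le> C" using lip[of x "h n"] h[of n] by (simp add: divide_le_eq)
        finally show ?thesis using True by simp
      next
        case False
        have "norm x \<le> norm (x + h n *\<^sub>R ?e) + norm (h n *\<^sub>R ?e)"
          using norm_triangle_ineq4[of "x + h n *\<^sub>R ?e" "h n *\<^sub>R ?e"] by simp
        then have "norm (x + h n *\<^sub>R ?e) > 1" using False h[of n] by simp
        then have "x + h n *\<^sub>R ?e \<notin> K" "x \<notin> K" using K(2) False by auto
        then show ?thesis using False K(3) by (simp add: q_def)
      qed
    qed
  qed
  then have eq0: "(LINT x|lborel. pd i f x) = 0"
    using q0 LIMSEQ_unique by (simp add: LIMSEQ_const_iff)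
  have ifz: "(\<lambda>x. if x \<in> ball 0 1 then pd i f x else 0) = pd i f"
    using K(2) z by (intro ext) (metis subsetD)
  have pm: "pd i f \<in> borel_measurable lborel" using int by auto
  show "integrable lball (pd i f)"
    using Lebesgue_Measure.integrable_restrict_UNIV[of "ball 0 1" "pd i f"] int(2) integrable_completion[OF pm] ifz by simp
  show "(LINT x|lball. pd i f x) = 0"
    using Lebesgue_Measure.integral_restrict_UNIV[of "ball 0 1" "pd i f"] integral_completion[OF pm] ifz eq0 by simp
qed

section \<open>The weighted inner product\<close>

lemma trunc_weight_continuous: "continuous_on UNIV (trunc_weight n b)"
  by (intro continuous_at_imp_continuous_on ballI has_derivative_continuous[OF trunc_weight_has_derivative])

lemma trunc_weight'_continuous: "continuous_on UNIV (trunc_weight' n b)"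
proof -
  have "continuous_on UNIV (rcut m k c)" for m k c
    by (intro continuous_at_imp_continuous_on ballI has_derivative_continuous[OF rcut_has_derivative])
  then show ?thesis
    unfolding trunc_weight'_def[abs_def] rcut'_def by (intro continuous_intros)
qed

lemma trunc_weight_support:
  obtains K :: "(real ^ 'n::finite) set" where "compact K" "K \<subseteq> ball 0 1" "\<And>x. x \<notin> K \<Longrightarrow> trunc_weight n b x = 0"
proof -
  have "trunc_weight n b \<in> (test_functions :: (real ^ 'n \<Rightarrow> real) set)"
    by (rule cut_poly_test_function[OF cut_poly_trunc_weight]) simp
  then show ?thesis
    using closure_subset[of "{x. trunc_weight n b x \<noteq> 0}"]
    by (intro that[of "closure {x. trunc_weight n b x \<noteq> 0}"]) (auto simp: test_functions_def)
qed

lemma trunc_weight_eq: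
  fixes n :: nat
  assumes "norm x < 1"
  defines "t \<equiv> real (Suc n) * (1 - (norm x)\<^sup>2) - 1"
  shows "trunc_weight n b x = (if t > 0 then exp (- 1 / t) else 0) * weight b x"
  unfolding trunc_weight_def t_def using rcut_eq[OF _ assms(1), of "real (Suc n)" b 0] by simp

lemma norm_sq_vec: "(norm x)\<^sup>2 = (\<Sum>i\<in>UNIV. (x $ i)\<^sup>2)" for x :: "real ^ 'n::finite"
  unfolding power2_norm_eq_inner by (simp add: inner_vec_def power2_eq_square)

text \<open>Apply the divergence theorem to the field \<open>x W\<close> with a truncated weight of exponent
  \<open>a + 1\<close>: its divergence is \<open>2 (a + 1) W\<^sub>a\<close> up to bounded terms and terms of one sign.\<close>

lemma weight_integrable:
  assumes a: "a > -1"
  shows "integrable (lball :: (real ^ 'n::finite) measure) (weight a)"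
proof -
  interpret finite_measure "lball :: (real ^ 'n) measure" by (rule finite_measure_lball)
  define V where "V = measure (lball :: (real ^ 'n) measure) (ball 0 1)"
  have bnd: "integrable lball g" if "g \<in> borel_measurable lball" "\<And>x. norm x < 1 \<Longrightarrow> \<bar>g x\<bar> \<le> K" for K and g :: "real ^ 'n \<Rightarrow> real"
    using that by (intro integrable_const_bound[of _ K]) auto
  \<comment> \<open>The divergence identity will bound 2 (a + 1) times the integral of the truncated
    weight by (d + 2 (a + 1)) V, since the weight with exponent a + 1 is at most 1.\<close>
  define C where "C = (real CARD('n) + 2 * (a + 1)) * V / (2 * (a + 1))"
  have cc: "continuous_on UNIV (\<lambda>x::real^'n. x $ i)" for i by (intro continuous_intros)
  have le1: "weight (a + 1) x \<le> 1" if "norm x < 1" for x :: "real ^ 'n"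
    using that a by (simp add: weight_def powr_le1 power_le_one abs_square_le_1)
  have tw1: "\<bar>trunc_weight n (a + 1) x\<bar> \<le> 1" if "norm x < 1" for n and x :: "real ^ 'n"
    using trunc_weight_bounds[OF that, of n "a + 1"] le1[OF that] by linarith
  have le: "(LINT x|(lball :: (real ^ 'n) measure). trunc_weight n a x) \<le> C"
    and int_tw: "integrable (lball :: (real ^ 'n) measure) (trunc_weight n a)" for n
  proof -
    obtain K :: "(real ^ 'n) set" where K: "compact K" "K \<subseteq> ball 0 1"
      "\<And>x. x \<notin> K \<Longrightarrow> trunc_weight n (a + 1) x = 0"
      using trunc_weight_support by blast
    define f where "f i = (\<lambda>x::real ^ 'n. complex_of_real (x $ i * trunc_weight n (a + 1) x))" for i
    have df: "(f i has_derivative (\<lambda>h. of_real (x $ i * (trunc_weight' n (a + 1) x * (x \<bullet> h)) + h $ i * trunc_weight n (a + 1) x))) (at x)"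
      for i x unfolding f_def
      by (intro has_derivative_of_real_complex has_derivative_mult has_derivative_coord trunc_weight_has_derivative)
    have pdf: "pd i (f i) = (\<lambda>x. of_real (trunc_weight' n (a + 1) x * (x $ i)\<^sup>2 + trunc_weight n (a + 1) x))" for i
      by (rule ext, subst pd_eq[OF df]) (simp add: inner_axis power2_eq_square algebra_simps)
    have fi: "integrable lball (pd i (f i))" "(LINT x|lball. pd i (f i) x) = 0" for i
    proof -
      have "continuous_on UNIV (pd i (f i))"
        unfolding pdf by (intro continuous_intros trunc_weight'_continuous trunc_weight_continuous cc)
      then show "integrable lball (pd i (f i))" "(LINT x|lball. pd i (f i) x) = 0"
        using integral_pd_eq_zero[OF has_derivative_imp_pdiff[OF df] _ compact_imp_closed[OF K(1)] K(2)] K(3)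
        by (auto simp: f_def)
    qed
    have "integrable lball (\<lambda>x. trunc_weight' n (a + 1) x * (x $ i)\<^sup>2 + trunc_weight n (a + 1) x)"
      "(LINT x|lball. trunc_weight' n (a + 1) x * (x $ i)\<^sup>2 + trunc_weight n (a + 1) x) = 0" for i :: 'n
      using fi[of i] unfolding pdf
      by (simp_all only: complex_of_real_integrable_eq integral_complex_of_real of_real_eq_0_iff)
    then have s: "integrable lball (\<lambda>x::real^'n. \<Sum>i\<in>UNIV. trunc_weight' n (a + 1) x * (x $ i)\<^sup>2 + trunc_weight n (a + 1) x)"
      "(LINT x|lball. (\<Sum>i\<in>(UNIV::'n set). trunc_weight' n (a + 1) x * (x $ i)\<^sup>2 + trunc_weight n (a + 1) x)) = 0"
      by (simp_all only: Bochner_Integration.integrable_sum Bochner_Integration.integral_sum sum.neutral_const)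
    have "(\<Sum>i\<in>UNIV. trunc_weight' n (a + 1) x * (x $ i)\<^sup>2 + trunc_weight n (a + 1) x)
      = trunc_weight' n (a + 1) x * (norm x)\<^sup>2 + real CARD('n) * trunc_weight n (a + 1) x" for x :: "real ^ 'n"
      by (simp add: sum.distrib norm_sq_vec sum_distrib_left)
    with s have s: "integrable lball (\<lambda>x::real^'n. trunc_weight' n (a + 1) x * (norm x)\<^sup>2 + real CARD('n) * trunc_weight n (a + 1) x)"
      "(LINT x|lball. trunc_weight' n (a + 1) (x::real^'n) * (norm x)\<^sup>2 + real CARD('n) * trunc_weight n (a + 1) x) = 0"
      by simp_all
    have i1: "integrable (lball::(real^'n) measure) (trunc_weight n (a + 1))"
      using tw1 by (intro bnd[where K = 1] measurable_lball_continuous trunc_weight_continuous)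
    \<comment> \<open>In \<open>e'\<close> the contribution of the cutoff to
      \<open>trunc_weight'\<close> has a favourable sign and is dropped; this is what makes the
      bound uniform in n.\<close>
    have e: "trunc_weight n (a + 1) x = (1 - (norm x)\<^sup>2) * trunc_weight n a x"
      and e': "trunc_weight' n (a + 1) x \<le> - 2 * (a + 1) * trunc_weight n a x" if x: "norm x < 1" for x :: "real ^ 'n"
    proof -
      have s: "1 - (norm x)\<^sup>2 > 0" using x abs_square_less_1[of "norm x"] by simp
      show e: "trunc_weight n (a + 1) x = (1 - (norm x)\<^sup>2) * trunc_weight n a x"
        using x by (simp add: trunc_weight_eq weight_Suc del: of_nat_Suc)
      have "trunc_weight' n (a + 1) x * (1 - (norm x)\<^sup>2) \<le> - 2 * (a + 1) * trunc_weight n (a + 1) x"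
      proof -
        define t where "t = real (Suc n) * (1 - (norm x)\<^sup>2) - 1"
        have ineq: "- 2 * (A + (a + 1) * E) * w \<le> - 2 * (a + 1) * (E * w)" if "0 \<le> A * w" for A E w :: real
          using that by (simp add: algebra_simps)
        have "0 \<le> (t + 1) * ((1 / t)\<^sup>2 * exp (- 1 / t)) * weight (a + 1) x" if "t > 0"
          using that by simp
        from ineq[OF this] show ?thesis
          unfolding trunc_weight'_eq[OF x] trunc_weight_eq[OF x] t_def[symmetric] by (cases "t > 0") simp_all
      qed
      then have "trunc_weight' n (a + 1) x * (1 - (norm x)\<^sup>2) \<le> (- 2 * (a + 1) * trunc_weight n a x) * (1 - (norm x)\<^sup>2)"
        unfolding e by (simp add: algebra_simps)
      then show "trunc_weight' n (a + 1) x \<le> - 2 * (a + 1) * trunc_weight n a x"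
        using s by simp
    qed
    show int_tw: "integrable (lball :: (real ^ 'n) measure) (trunc_weight n a)"
    proof -
      have "bounded (trunc_weight n a ` cball (0::real^'n) 1)"
        by (rule compact_imp_bounded[OF compact_continuous_image[OF continuous_on_subset[OF trunc_weight_continuous] compact_cball]]) simp
      then obtain K' where "\<forall>x\<in>cball (0::real^'n) 1. norm (trunc_weight n a x) \<le> K'" by (auto simp: bounded_iff)
      then show ?thesis
        by (intro bnd[where K = K'] measurable_lball_continuous trunc_weight_continuous) auto
    qed
    have "0 = (LINT x|lball. trunc_weight' n (a + 1) (x::real^'n) * (norm x)\<^sup>2 + real CARD('n) * trunc_weight n (a + 1) x)"
      using s by simp
    also have "\<dots> \<le> (LINT x|(lball::(real^'n) measure). - (2 * (a + 1)) * trunc_weight n a x + (real CARD('n) + 2 * (a + 1)) * trunc_weight n (a + 1) x)"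
    proof (rule integral_mono)
      fix x :: "real ^ 'n" assume "x \<in> space lball"
      then have x: "norm x < 1" by simp
      have "trunc_weight' n (a + 1) x * (norm x)\<^sup>2 \<le> - 2 * (a + 1) * trunc_weight n a x * (norm x)\<^sup>2"
        by (rule mult_right_mono[OF e'[OF x]]) simp
      also have "\<dots> = - (2 * (a + 1)) * trunc_weight n a x + 2 * (a + 1) * trunc_weight n (a + 1) x"
        unfolding e[OF x] by (simp add: algebra_simps)
      finally show "trunc_weight' n (a + 1) x * (norm x)\<^sup>2 + real CARD('n) * trunc_weight n (a + 1) x
        \<le> - (2 * (a + 1)) * trunc_weight n a x + (real CARD('n) + 2 * (a + 1)) * trunc_weight n (a + 1) x"
        by (simp add: algebra_simps)
    qed (intro s Bochner_Integration.integrable_add integrable_mult_right i1 int_tw)+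
    also have "\<dots> = - (2 * (a + 1)) * (LINT x|(lball::(real^'n) measure). trunc_weight n a x)
       + (real CARD('n) + 2 * (a + 1)) * (LINT x|(lball::(real^'n) measure). trunc_weight n (a + 1) x)"
      using i1 int_tw by simp
    also have "\<dots> \<le> - (2 * (a + 1)) * (LINT x|(lball::(real^'n) measure). trunc_weight n a x)
       + (real CARD('n) + 2 * (a + 1)) * V"
    proof (intro add_left_mono mult_left_mono)
      have "(LINT x|(lball::(real^'n) measure). trunc_weight n (a + 1) x) \<le> (LINT x|(lball::(real^'n) measure). 1)"
        using tw1 i1 by (intro integral_mono) (auto simp: abs_le_iff)
      then show "(LINT x|(lball::(real^'n) measure). trunc_weight n (a + 1) x) \<le> V" by (simp add: V_def)
    qed (use a in simp)
    finally have "2 * (a + 1) * (LINT x|(lball::(real^'n) measure). trunc_weight n a x) \<le> (real CARD('n) + 2 * (a + 1)) * V"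
      using a by (simp add: algebra_simps)
    then show "(LINT x|(lball :: (real ^ 'n) measure). trunc_weight n a x) \<le> C"
      using a by (simp add: C_def le_divide_eq mult.commute)
  qed
  \<comment> \<open>Fatou's lemma along the truncations, whose integrals are all at most C.\<close>
  have "(\<integral>\<^sup>+x. ennreal (weight a x) \<partial>(lball::(real^'n) measure)) = (\<integral>\<^sup>+x. liminf (\<lambda>n. ennreal (trunc_weight n a x)) \<partial>(lball::(real^'n) measure))"
  proof (rule nn_integral_cong)
    fix x :: "real ^ 'n" assume "x \<in> space lball"
    then have "(\<lambda>n. ennreal (trunc_weight n a x)) \<longlonglongrightarrow> ennreal (weight a x)"
      by (intro tendsto_ennrealI trunc_weight_tendsto) simp
    then show "ennreal (weight a x) = liminf (\<lambda>n. ennreal (trunc_weight n a x))"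
      by (simp add: lim_imp_Liminf)
  qed
  also have "\<dots> \<le> liminf (\<lambda>n. \<integral>\<^sup>+x. ennreal (trunc_weight n a x) \<partial>(lball::(real^'n) measure))"
    using int_tw by (intro nn_integral_liminf) auto
  also have "\<dots> \<le> ennreal C"
  proof -
    have "(\<integral>\<^sup>+x. ennreal (trunc_weight n a x) \<partial>(lball::(real^'n) measure)) \<le> ennreal C" for n
      using trunc_weight_bounds(1) int_tw[of n] le[of n]
      by (subst nn_integral_eq_integral) (auto intro!: ennreal_leI AE_I2)
    then show ?thesis
      by (intro Liminf_le always_eventually allI) auto
  qed
  finally have "(\<integral>\<^sup>+x. ennreal (weight a x) \<partial>(lball::(real^'n) measure)) < \<infinity>"
    by (simp add: order_le_less_trans)
  then show ?thesis
    by (intro integrableI_nonneg weight_measurable) (auto intro: AE_I2)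
qed

text \<open>The real part of \<open>L2_inner\<close>, since the inner product of complex numbers as
  real vectors is Re (z cnj w). For orthogonality to \<open>polys_below N\<close> this makes no
  difference, see \<open>L2_inner_eq_zero_iff\<close>.\<close>

definition ip :: "real \<Rightarrow> (real ^ 'n::finite \<Rightarrow> complex) \<Rightarrow> (real ^ 'n \<Rightarrow> complex) \<Rightarrow> real" where
  "ip a u v = (LINT x|lball. (u x \<bullet> v x) * weight a x)"

lemma L2_norm_ip: "L2_norm a u = sqrt (ip a u u)"
  by (simp add: L2_norm_def ip_def power2_norm_eq_inner)

lemma ip_commute: "ip a u v = ip a v u"
  by (simp add: ip_def inner_commute)

lemma ip_nonneg: "0 \<le> ip a u u"
  unfolding ip_def by (intro integral_nonneg_AE) (simp add: AE_I2)

lemma L2_norm_nonneg [simp]: "0 \<le> L2_norm a u"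
  by (simp add: L2_norm_ip ip_nonneg)

lemma L2_norm_sq: "(L2_norm a u)\<^sup>2 = ip a u u"
  by (simp add: L2_norm_ip ip_nonneg)

lemma L2_iff: "u \<in> L2 a \<longleftrightarrow> u \<in> borel_measurable lball \<and> integrable lball (\<lambda>x. (cmod (u x))\<^sup>2 * weight a x)"
  by (simp add: L2_def)

lemma L2_I:
  assumes "u \<in> borel_measurable lball" "integrable lball g"
    and "\<And>x. norm x < 1 \<Longrightarrow> (cmod (u x))\<^sup>2 * weight a x \<le> g x"
  shows "u \<in> L2 a"
  unfolding L2_iff
proof
  show "integrable lball (\<lambda>x. (cmod (u x))\<^sup>2 * weight a x)"
  proof (rule Bochner_Integration.integrable_bound[OF assms(2)])
    show "(\<lambda>x. (cmod (u x))\<^sup>2 * weight a x) \<in> borel_measurable lball"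
      using assms(1) weight_measurable by measurable
    show "AE x in lball. norm ((cmod (u x))\<^sup>2 * weight a x) \<le> norm (g x)"
      using assms(3) by (intro AE_I2) (force intro: order_trans[OF _ abs_ge_self])
  qed
qed (rule assms(1))

lemma L2_measurable: "u \<in> L2 a \<Longrightarrow> u \<in> borel_measurable lball"
  by (simp add: L2_iff)

lemma L2_bounded_mult:
  assumes "u \<in> L2 a" "f \<in> borel_measurable lball" "\<And>x. norm x < 1 \<Longrightarrow> cmod (f x) \<le> K"
  shows "(\<lambda>x. f x * u x) \<in> L2 a"
proof (rule L2_I)
  show "(\<lambda>x. f x * u x) \<in> borel_measurable lball"
    using L2_measurable[OF assms(1)] assms(2) by measurable
  show "integrable lball (\<lambda>x. K\<^sup>2 * ((cmod (u x))\<^sup>2 * weight a x))"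
    using assms(1) by (intro integrable_mult_right) (simp add: L2_iff)
  fix x :: "real ^ 'a" assume "norm x < 1"
  then have "(cmod (f x))\<^sup>2 \<le> K\<^sup>2" by (intro power_mono assms) auto
  then show "(cmod (f x * u x))\<^sup>2 * weight a x \<le> K\<^sup>2 * ((cmod (u x))\<^sup>2 * weight a x)"
    by (simp add: norm_mult power_mult_distrib mult.assoc mult_right_mono)
qed

lemma L2_cmult: "u \<in> L2 a \<Longrightarrow> (\<lambda>x. c * u x) \<in> L2 a"
  by (rule L2_bounded_mult[of u a "\<lambda>_. c" "cmod c"]) auto

lemma L2_add:
  assumes "u \<in> L2 a" "v \<in> L2 a"
  shows "(\<lambda>x. u x + v x) \<in> L2 a"
proof (rule L2_I)
  show "(\<lambda>x. u x + v x) \<in> borel_measurable lball"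
    using assms[THEN L2_measurable] by measurable
  show "integrable lball (\<lambda>x. 2 * ((cmod (u x))\<^sup>2 * weight a x) + 2 * ((cmod (v x))\<^sup>2 * weight a x))"
    using assms by (intro Bochner_Integration.integrable_add integrable_mult_right) (auto simp: L2_iff)
  fix x :: "real ^ 'a"
  have "(cmod (u x + v x))\<^sup>2 \<le> (cmod (u x) + cmod (v x))\<^sup>2"
    by (intro power_mono norm_triangle_ineq) auto
  also have "\<dots> \<le> 2 * (cmod (u x))\<^sup>2 + 2 * (cmod (v x))\<^sup>2"
    using sum_squares_bound[of "cmod (u x)" "cmod (v x)"] by (simp add: power2_sum)
  finally show "(cmod (u x + v x))\<^sup>2 * weight a x \<le> 2 * ((cmod (u x))\<^sup>2 * weight a x) + 2 * ((cmod (v x))\<^sup>2 * weight a x)"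
    using mult_right_mono[OF _ weight_nonneg[of a x]] by (fastforce simp: algebra_simps)
qed

lemma L2_diff: "u \<in> L2 a \<Longrightarrow> v \<in> L2 a \<Longrightarrow> (\<lambda>x. u x - v x) \<in> L2 a"
  using L2_add[OF _ L2_cmult[of v a "-1"], of u] by simp

lemma L2_zero: "(\<lambda>x. 0) \<in> L2 a"
  by (simp add: L2_iff)

lemma L2_sum: "(\<And>i. i \<in> A \<Longrightarrow> u i \<in> L2 a) \<Longrightarrow> (\<lambda>x. \<Sum>i\<in>A. u i x) \<in> L2 a"
  by (induction A rule: infinite_finite_induct) (auto intro: L2_zero L2_add)

lemma L2_const: "a > -1 \<Longrightarrow> (\<lambda>x. c) \<in> L2 a"
  using weight_integrable[of a] by (auto simp: L2_iff)

lemma polys_below_L2: "a > -1 \<Longrightarrow> p \<in> polys_below N \<Longrightarrow> p \<in> L2 a"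
proof -
  assume a: "a > -1" and p: "p \<in> polys_below N"
  obtain K where "\<And>x. norm x \<le> 1 \<Longrightarrow> cmod (p x) \<le> K" using polys_below_bounded[OF p] by blast
  then have "(\<lambda>x. p x * 1) \<in> L2 a"
    by (intro L2_bounded_mult[of _ _ _ K] L2_const[OF a] measurable_lball_continuous polys_below_continuous[OF p]) auto
  then show "p \<in> L2 a" by simp
qed

lemma polys_below_mult_L2: "u \<in> L2 a \<Longrightarrow> p \<in> polys_below N \<Longrightarrow> (\<lambda>x. p x * u x) \<in> L2 a"
  by (rule polys_below_bounded[of p N], assumption, erule L2_bounded_mult)
     (auto intro: measurable_lball_continuous polys_below_continuous less_imp_le)

lemma L2_coord: "u \<in> L2 a \<Longrightarrow> (\<lambda>x. of_real (x $ i) * u x) \<in> L2 a"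
  using polys_below_mult_L2[of u a _ "Suc (Suc 0)", OF _ polys_below_coord[OF polys_below_const[of "Suc 0" 1]]] by simp

lemma L2_mono: "u \<in> L2 a \<Longrightarrow> u \<in> L2 (a + 1)"
proof -
  assume u: "u \<in> L2 a"
  show ?thesis
  proof (rule L2_I[OF L2_measurable[OF u]])
    show "integrable lball (\<lambda>x. (cmod (u x))\<^sup>2 * weight a x)" using u by (simp add: L2_iff)
    fix x :: "real ^ 'a" assume "norm x < 1"
    then show "(cmod (u x))\<^sup>2 * weight (a + 1) x \<le> (cmod (u x))\<^sup>2 * weight a x"
      using abs_square_less_1[of "norm x"] by (intro mult_left_mono) (auto simp: weight_Suc mult_left_le_one_le)
  qed
qed

lemma ip_integrable:
  assumes "u \<in> L2 a" "v \<in> L2 a"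
  shows "integrable lball (\<lambda>x. (u x \<bullet> v x) * weight a x)"
proof (rule Bochner_Integration.integrable_bound)
  show "integrable lball (\<lambda>x. (cmod (u x))\<^sup>2 * weight a x + (cmod (v x))\<^sup>2 * weight a x)"
    using assms by (intro Bochner_Integration.integrable_add) (auto simp: L2_iff)
  show "(\<lambda>x. (u x \<bullet> v x) * weight a x) \<in> borel_measurable lball"
    using assms[THEN L2_measurable] weight_measurable by measurable
  show "AE x in lball. norm ((u x \<bullet> v x) * weight a x) \<le> norm ((cmod (u x))\<^sup>2 * weight a x + (cmod (v x))\<^sup>2 * weight a x)"
  proof (rule AE_I2)
    fix x
    have "\<bar>u x \<bullet> v x\<bar> \<le> cmod (u x) * cmod (v x)" by (rule Cauchy_Schwarz_ineq2)
    also have "\<dots> \<le> 2 * cmod (u x) * cmod (v x)" by simp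
    also have "\<dots> \<le> (cmod (u x))\<^sup>2 + (cmod (v x))\<^sup>2" by (rule sum_squares_bound)
    finally have "\<bar>u x \<bullet> v x\<bar> * weight a x \<le> ((cmod (u x))\<^sup>2 + (cmod (v x))\<^sup>2) * weight a x"
      by (rule mult_right_mono) simp
    then show "norm ((u x \<bullet> v x) * weight a x) \<le> norm ((cmod (u x))\<^sup>2 * weight a x + (cmod (v x))\<^sup>2 * weight a x)"
      by (simp add: abs_mult distrib_right)
  qed
qed

lemma ip_add: "u \<in> L2 a \<Longrightarrow> v \<in> L2 a \<Longrightarrow> w \<in> L2 a \<Longrightarrow> ip a (\<lambda>x. u x + v x) w = ip a u w + ip a v w"
  by (simp add: ip_def inner_add_left distrib_right ip_integrable)

lemma ip_diff: "u \<in> L2 a \<Longrightarrow> v \<in> L2 a \<Longrightarrow> w \<in> L2 a \<Longrightarrow> ip a (\<lambda>x. u x - v x) w = ip a u w - ip a v w"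
  by (simp add: ip_def inner_diff_left left_diff_distrib ip_integrable)

lemma ip_add_right: "u \<in> L2 a \<Longrightarrow> v \<in> L2 a \<Longrightarrow> w \<in> L2 a \<Longrightarrow> ip a w (\<lambda>x. u x + v x) = ip a w u + ip a w v"
  by (simp add: ip_commute[of a w] ip_add)

lemma ip_diff_right: "u \<in> L2 a \<Longrightarrow> v \<in> L2 a \<Longrightarrow> w \<in> L2 a \<Longrightarrow> ip a w (\<lambda>x. u x - v x) = ip a w u - ip a w v"
  by (simp add: ip_commute[of a w] ip_diff)

lemma ip_cmult: "ip a (\<lambda>x. of_real c * u x) v = c * ip a u v"
proof -
  have "((of_real c * u x) \<bullet> v x) * weight a x = c * ((u x \<bullet> v x) * weight a x)" for x
    using inner_scaleR_left[of c "u x" "v x"] by (simp add: scaleR_conv_of_real)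
  then show ?thesis by (simp only: ip_def integral_mult_right_zero)
qed

lemma ip_cmult_right: "ip a u (\<lambda>x. of_real c * v x) = c * ip a u v"
  by (simp add: ip_commute[of a u] ip_cmult)

lemma ip_move: "ip a (\<lambda>x. of_real (f x) * u x) v = ip a u (\<lambda>x. of_real (f x) * v x)"
proof -
  have "(of_real c * z) \<bullet> w = z \<bullet> (of_real c * w)" for c :: real and z w :: complex
    by (simp add: inner_complex_def algebra_simps)
  then show ?thesis by (simp add: ip_def)
qed

lemma ip_sum:
  "(\<And>i. i \<in> A \<Longrightarrow> u i \<in> L2 a) \<Longrightarrow> v \<in> L2 a \<Longrightarrow> ip a (\<lambda>x. \<Sum>i\<in>A. u i x) v = (\<Sum>i\<in>A. ip a (u i) v)"
  by (simp add: ip_def inner_sum_left sum_distrib_right ip_integrable)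

lemma ip_zero [simp]: "ip a (\<lambda>x. 0) v = 0" "ip a u (\<lambda>x. 0) = 0"
  by (simp_all add: ip_def)

lemma inner_of_real_mult: "u \<bullet> (of_real c * v) = c * (u \<bullet> v)" for u v :: complex
  using inner_scaleR_right[of u c v] by (simp add: scaleR_conv_of_real)

text \<open>This is how orthogonality for exponent \<open>a\<close> yields relations for
  \<open>a + 1\<close>: the change of weight becomes a polynomial factor.\<close>

lemma ip_weight_Suc: "ip (a + 1) u v = ip a u (\<lambda>x. of_real (1 - (norm x)\<^sup>2) * v x)"
  unfolding ip_def
  by (rule Bochner_Integration.integral_cong) (simp_all only: weight_Suc inner_of_real_mult space_lebesgue_on mem_ball_0 mult.assoc mult.left_commute)

lemma ip_mono_Suc: "u \<in> L2 a \<Longrightarrow> ip (a + 1) u u \<le> ip a u u"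
  unfolding ip_def
proof (rule integral_mono)
  fix x :: "real ^ 'a" assume "x \<in> space lball"
  then show "(u x \<bullet> u x) * weight (a + 1) x \<le> (u x \<bullet> u x) * weight a x"
    using abs_square_less_1[of "norm x"] by (intro mult_left_mono) (auto simp: weight_Suc mult_left_le_one_le)
qed (auto intro: ip_integrable L2_mono)

lemma ip_sq_add: "u \<in> L2 a \<Longrightarrow> v \<in> L2 a \<Longrightarrow> ip a (\<lambda>x. u x + v x) (\<lambda>x. u x + v x) = ip a u u + 2 * ip a u v + ip a v v"
  by (simp add: ip_add ip_add_right L2_add ip_commute[of a v u])

lemma ip_sq_diff: "u \<in> L2 a \<Longrightarrow> v \<in> L2 a \<Longrightarrow> ip a (\<lambda>x. u x - v x) (\<lambda>x. u x - v x) = ip a u u - 2 * ip a u v + ip a v v"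
  by (simp add: ip_diff ip_diff_right L2_diff ip_commute[of a v u])

lemma ip_Cauchy_Schwarz:
  assumes "u \<in> L2 a" "v \<in> L2 a"
  shows "\<bar>ip a u v\<bar> \<le> L2_norm a u * L2_norm a v"
proof -
  have q: "0 \<le> ip a u u - 2 * t * ip a u v + t\<^sup>2 * ip a v v" for t
    using ip_nonneg[of a "\<lambda>x. u x - of_real t * v x"] assms
    by (simp add: ip_sq_diff L2_cmult ip_cmult ip_cmult_right power2_eq_square mult.assoc)
  have "(ip a u v)\<^sup>2 \<le> ip a u u * ip a v v"
  proof (cases "ip a v v = 0")
    case True
    show ?thesis
    proof (cases "ip a u v = 0")
      case False
      \<comment> \<open>At this t the quadratic takes the value -1, contradicting q. The case arises
        because a function vanishing almost everywhere need not be zero.\<close>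
      then show ?thesis using q[of "(ip a u u + 1) / (2 * ip a u v)"] True by simp
    qed (use True in simp)
  next
    case False
    then have pos: "ip a v v > 0" using ip_nonneg[of a v] by simp
    have "0 \<le> ip a v v * (ip a u u - 2 * (ip a u v / ip a v v) * ip a u v + (ip a u v / ip a v v)\<^sup>2 * ip a v v)"
      by (intro mult_nonneg_nonneg q) (use pos in simp)
    also have "\<dots> = ip a u u * ip a v v - (ip a u v)\<^sup>2"
      using pos by (simp add: field_simps power2_eq_square)
    finally show ?thesis by simp
  qed
  then have "sqrt ((ip a u v)\<^sup>2) \<le> sqrt (ip a u u * ip a v v)" by (rule real_sqrt_le_mono)
  then show ?thesis by (simp add: L2_norm_ip real_sqrt_mult)
qed

lemma L2_norm_triangle:
  assumes "u \<in> L2 a" "v \<in> L2 a"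
  shows "L2_norm a (\<lambda>x. u x + v x) \<le> L2_norm a u + L2_norm a v"
proof (rule power2_le_imp_le)
  show "(L2_norm a (\<lambda>x. u x + v x))\<^sup>2 \<le> (L2_norm a u + L2_norm a v)\<^sup>2"
    using ip_Cauchy_Schwarz[OF assms] assms
    by (simp add: L2_norm_sq ip_sq_add power2_sum)
qed simp

lemma L2_norm_cmult: "L2_norm a (\<lambda>x. of_real c * u x) = \<bar>c\<bar> * L2_norm a u"
  by (simp add: L2_norm_ip ip_cmult ip_cmult_right real_sqrt_mult mult.assoc[symmetric] flip: power2_eq_square)

section \<open>Weak derivatives and density of polynomials\<close>

lemma loc_integrable_add: "loc_integrable u \<Longrightarrow> loc_integrable v \<Longrightarrow> loc_integrable (\<lambda>x. u x + v x)"
  by (simp add: loc_integrable_def)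

lemma loc_integrable_cmult: "loc_integrable u \<Longrightarrow> loc_integrable (\<lambda>x. c * u x)"
  by (simp add: loc_integrable_def)

lemma loc_integrable_continuous:
  assumes "continuous_on UNIV (u :: real ^ 'n::finite \<Rightarrow> complex)"
  shows "loc_integrable u"
  unfolding loc_integrable_def
proof (intro allI impI)
  fix K :: "(real ^ 'n) set" assume "compact K \<and> K \<subseteq> ball 0 1"
  then have "integrable lborel (\<lambda>x. indicator K x *\<^sub>R u x)"
    using borel_integrable_compact continuous_on_subset[OF assms] by blast
  then show "set_integrable lebesgue K u"
    unfolding set_integrable_def by (simp add: integrable_completion)
qed

lemma loc_integrable_set_lball:
  assumes "loc_integrable u" "compact K" "K \<subseteq> ball 0 1"
  shows "set_integrable lball K u"
proof -
  have K: "(\<lambda>x. if x \<in> ball 0 1 then indicat_real K x *\<^sub>R u x else 0) = (\<lambda>x. indicat_real K x *\<^sub>R u x)"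
    using assms(3) by (auto simp: fun_eq_iff indicator_def)
  have "integrable lebesgue (\<lambda>x. if x \<in> ball 0 1 then indicat_real K x *\<^sub>R u x else 0)"
    unfolding K using assms by (simp add: loc_integrable_def set_integrable_def)
  then show ?thesis
    unfolding set_integrable_def by (subst (asm) Lebesgue_Measure.integrable_restrict_UNIV) auto
qed

text \<open>The closed balls of radius 1 - 1 / (n + 1) exhaust the open ball, so u is the pointwise
  limit of its restrictions to them, each of which is integrable.\<close>

lemma loc_integrable_measurable:
  assumes "loc_integrable (u :: real ^ 'n::finite \<Rightarrow> complex)"
  shows "u \<in> borel_measurable lball"
proof -
  let ?K = "\<lambda>n. cball (0 :: real ^ 'n) (1 - 1 / real (Suc n))"
  show ?thesis
  proof (rule borel_measurable_LIMSEQ_metric)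
    show "(\<lambda>x. indicat_real (?K n) x *\<^sub>R u x) \<in> borel_measurable lball" for n
    proof (rule borel_measurable_integrable)
      have "?K n \<subseteq> ball 0 1"
      proof
        fix x :: "real ^ 'n" assume "x \<in> ?K n"
        then have "norm x \<le> 1 - 1 / real (Suc n)" by (simp del: of_nat_Suc)
        also have "\<dots> < 1" by simp
        finally show "x \<in> ball 0 1" by simp
      qed
      then show "integrable lball (\<lambda>x. indicat_real (?K n) x *\<^sub>R u x)"
        using loc_integrable_set_lball[OF assms compact_cball] by (simp add: set_integrable_def)
    qed
    fix x :: "real ^ 'n" assume "x \<in> space lball"
    then have "norm x < 1" by simp
    have "(\<lambda>n. 1 - 1 / real (Suc n)) \<longlonglongrightarrow> 1 - 0"
      using LIMSEQ_inverse_real_of_nat by (intro tendsto_intros) (simp add: inverse_eq_divide)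
    then have "\<forall>\<^sub>F n in sequentially. norm x < 1 - 1 / real (Suc n)"
      using \<open>norm x < 1\<close> by (intro order_tendstoD(1)[where y = "1::real"]) auto
    then have "\<forall>\<^sub>F n in sequentially. u x = indicat_real (?K n) x *\<^sub>R u x"
      by (rule eventually_mono) simp
    then show "(\<lambda>n. indicat_real (?K n) x *\<^sub>R u x) \<longlonglongrightarrow> u x"
      by (rule Lim_transform_eventually[OF tendsto_const])
  qed
qed

lemma test_function_support:
  assumes "\<phi> \<in> test_functions"
  obtains K where "compact K" "K \<subseteq> ball 0 1" "\<And>x. x \<notin> K \<Longrightarrow> \<phi> x = 0"
  using assms closure_subset[of "{x. \<phi> x \<noteq> 0}"]
  by (intro that[of "closure {x. \<phi> x \<noteq> 0}"]) (auto simp: test_functions_def)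

lemma test_function_smooth: "\<phi> \<in> test_functions \<Longrightarrow> smooth \<phi>"
  by (simp add: test_functions_def)

lemma test_function_continuous: "\<phi> \<in> test_functions \<Longrightarrow> continuous_on S \<phi>"
  by (rule smooth_imp_continuous[OF test_function_smooth])

lemma test_function_bounded:
  assumes "\<phi> \<in> test_functions"
  obtains C where "\<And>x. \<bar>\<phi> x\<bar> \<le> C"
proof -
  obtain K where K: "compact K" "K \<subseteq> ball 0 1" "\<And>x. x \<notin> K \<Longrightarrow> \<phi> x = 0"
    by (rule test_function_support[OF assms]) (rule that)
  have "bounded (\<phi> ` K)"
    by (rule compact_imp_bounded[OF compact_continuous_image[OF test_function_continuous[OF assms] K(1)]])
  then obtain C where "\<forall>x\<in>K. \<bar>\<phi> x\<bar> \<le> C" by (auto simp: bounded_iff)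
  then have "\<bar>\<phi> x\<bar> \<le> max C 0" for x using K(3)[of x] by (cases "x \<in> K") (auto simp: le_max_iff_disj)
  then show ?thesis by (rule that)
qed

lemma loc_integrable_test:
  assumes "loc_integrable u" "\<phi> \<in> test_functions"
  shows "integrable lball (\<lambda>x. u x * of_real (\<phi> x))"
proof -
  obtain K where K: "compact K" "K \<subseteq> ball 0 1" "\<And>x. x \<notin> K \<Longrightarrow> \<phi> x = 0"
    by (rule test_function_support[OF assms(2)]) (rule that)
  obtain C where C: "\<And>x. \<bar>\<phi> x\<bar> \<le> C" by (rule test_function_bounded[OF assms(2)]) (rule that)
  have "integrable lball (\<lambda>x. indicat_real K x *\<^sub>R u x)"
    using loc_integrable_set_lball[OF assms(1) K(1,2)] by (simp add: set_integrable_def)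
  then have "integrable lball (\<lambda>x. C * norm (indicat_real K x *\<^sub>R u x))" by (intro integrable_mult_right integrable_norm)
  then show ?thesis
  proof (rule Bochner_Integration.integrable_bound)
    show "(\<lambda>x. u x * of_real (\<phi> x)) \<in> borel_measurable lball"
      using loc_integrable_measurable[OF assms(1)] measurable_lball_continuous[OF test_function_continuous[OF assms(2)]]
      by measurable
    show "AE x in lball. norm (u x * of_real (\<phi> x)) \<le> norm (C * norm (indicat_real K x *\<^sub>R u x))"
    proof (rule AE_I2)
      fix x
      have "0 \<le> C" using C[of x] by linarith
      show "norm (u x * of_real (\<phi> x)) \<le> norm (C * norm (indicat_real K x *\<^sub>R u x))"
        using K(3)[of x] C[of x] \<open>0 \<le> C\<close>
        by (cases "x \<in> K") (auto simp: norm_mult abs_mult mult.commute mult_right_mono)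
    qed
  qed
qed

lemma mi_deriv_test_function: "\<phi> \<in> test_functions \<Longrightarrow> mi_deriv \<gamma> \<phi> \<in> test_functions"
proof -
  assume \<phi>: "\<phi> \<in> test_functions"
  have "iter_partial is \<phi> \<in> test_functions" for "is"
    by (induction "is") (auto intro: \<phi> test_functions_partial_deriv)
  then show ?thesis by (simp add: mi_deriv_def)
qed

lemma is_weak_deriv_loc: "is_weak_deriv \<gamma> u v \<Longrightarrow> loc_integrable u" "is_weak_deriv \<gamma> u v \<Longrightarrow> loc_integrable v"
  by (simp_all add: is_weak_deriv_def)

lemma is_weak_deriv_test:
  "is_weak_deriv \<gamma> u v \<Longrightarrow> \<phi> \<in> test_functions \<Longrightarrow>
     (LINT x|lball. u x * of_real (mi_deriv \<gamma> \<phi> x)) = (- 1) ^ mi_abs \<gamma> * (LINT x|lball. v x * of_real (\<phi> x))"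
  by (simp add: is_weak_deriv_def)

lemma is_weak_deriv_add:
  assumes "is_weak_deriv \<gamma> u v" "is_weak_deriv \<gamma> u' v'"
  shows "is_weak_deriv \<gamma> (\<lambda>x. u x + u' x) (\<lambda>x. v x + v' x)"
  unfolding is_weak_deriv_def
proof (intro conjI ballI)
  fix \<phi> :: "real ^ 'a \<Rightarrow> real" assume \<phi>: "\<phi> \<in> test_functions"
  note i = loc_integrable_test[OF is_weak_deriv_loc(1)[OF assms(1)] mi_deriv_test_function[OF \<phi>]]
    loc_integrable_test[OF is_weak_deriv_loc(1)[OF assms(2)] mi_deriv_test_function[OF \<phi>]]
    loc_integrable_test[OF is_weak_deriv_loc(2)[OF assms(1)] \<phi>] loc_integrable_test[OF is_weak_deriv_loc(2)[OF assms(2)] \<phi>]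
  show "(LINT x|lball. (u x + u' x) * of_real (mi_deriv \<gamma> \<phi> x)) = (- 1) ^ mi_abs \<gamma> * (LINT x|lball. (v x + v' x) * of_real (\<phi> x))"
    using is_weak_deriv_test[OF assms(1) \<phi>] is_weak_deriv_test[OF assms(2) \<phi>] i
    by (simp add: distrib_right distrib_left)
qed (use assms in \<open>auto intro: loc_integrable_add dest: is_weak_deriv_loc\<close>)

lemma is_weak_deriv_cmult:
  assumes "is_weak_deriv \<gamma> u v"
  shows "is_weak_deriv \<gamma> (\<lambda>x. c * u x) (\<lambda>x. c * v x)"
  using assms unfolding is_weak_deriv_def by (auto simp: mult.assoc loc_integrable_cmult)

lemma is_weak_deriv_diff:
  assumes "is_weak_deriv \<gamma> u v" "is_weak_deriv \<gamma> u' v'"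
  shows "is_weak_deriv \<gamma> (\<lambda>x. u x - u' x) (\<lambda>x. v x - v' x)"
  using is_weak_deriv_add[OF assms(1) is_weak_deriv_cmult[OF assms(2), of "-1"]] by simp

lemma is_weak_deriv_zero: "loc_integrable u \<Longrightarrow> is_weak_deriv (\<lambda>_. 0) u u"
  by (simp add: is_weak_deriv_def mi_deriv_zero)

abbreviation wpd :: "'n::finite \<Rightarrow> (real ^ 'n \<Rightarrow> complex) \<Rightarrow> (real ^ 'n \<Rightarrow> complex) \<Rightarrow> bool" where
  "wpd i \<equiv> is_weak_deriv (inc i (\<lambda>_. 0))"

lemma wpd_test:
  "wpd i u v \<Longrightarrow> \<phi> \<in> test_functions \<Longrightarrow>
     (LINT x|lball. u x * of_real (partial_deriv i \<phi> x)) = - (LINT x|lball. v x * of_real (\<phi> x))"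
  using is_weak_deriv_test[of "inc i (\<lambda>_. 0)" u v \<phi>] by (simp add: mi_deriv_unit test_function_smooth)

text \<open>Test the first derivative with \<open>mi_deriv \<gamma> \<phi>\<close>. The equivalence
  lets inductions on the order pass from u to its first derivatives and back.\<close>

lemma wpd_inc:
  assumes "wpd i u v"
  shows "is_weak_deriv (inc i \<gamma>) u w \<longleftrightarrow> is_weak_deriv \<gamma> v w"
proof -
  have "(LINT x|lball. u x * of_real (mi_deriv (inc i \<gamma>) \<phi> x)) = - (LINT x|lball. v x * of_real (mi_deriv \<gamma> \<phi> x))"
    if "\<phi> \<in> test_functions" for \<phi>
    using wpd_test[OF assms mi_deriv_test_function[OF that]] mi_deriv_inc(2)[OF test_function_smooth[OF that]] by simp
  then show ?thesis
    using is_weak_deriv_loc[OF assms] by (auto simp: is_weak_deriv_def)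
qed

text \<open>Integrate the derivative of the compactly supported product of p and \<phi>.\<close>

lemma polys_below_wpd:
  assumes "p \<in> polys_below N"
  shows "wpd i p (pd i p)"
  unfolding is_weak_deriv_def
proof (intro conjI ballI)
  have q: "pd i p \<in> polys_below (N - 1)" by (rule pd_polys_below[OF assms])
  show "loc_integrable p" "loc_integrable (pd i p)"
    by (intro loc_integrable_continuous polys_below_continuous[OF assms] polys_below_continuous[OF q])+
  note loc = this
  fix \<phi> :: "real ^ 'a \<Rightarrow> real" assume \<phi>: "\<phi> \<in> test_functions"
  obtain D where D: "\<And>x. (\<phi> has_derivative D x) (at x)"
    using smooth_imp_differentiable[OF test_function_smooth[OF \<phi>]] by (auto simp: differentiable_on_def differentiable_def) metis
  have d: "pdiff (\<lambda>x. of_real (\<phi> x))" "pd i (\<lambda>x. of_real (\<phi> x)) x = of_real (partial_deriv i \<phi> x)" for x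
    by (rule has_derivative_imp_pdiff, rule has_derivative_of_real_complex[OF D])
       (simp add: pd_eq[OF has_derivative_of_real_complex[OF D]] partial_deriv_eq[OF D])
  have dp: "pdiff p" by (rule polys_below_pdiff[OF assms])
  have e: "pd i (\<lambda>x. p x * of_real (\<phi> x)) = (\<lambda>x. p x * of_real (partial_deriv i \<phi> x) + pd i p x * of_real (\<phi> x))"
    by (simp add: fun_eq_iff pd_mult[OF dp d(1)] d(2))
  obtain K where K: "compact K" "K \<subseteq> ball 0 1" "\<And>x. x \<notin> K \<Longrightarrow> \<phi> x = 0"
    by (rule test_function_support[OF \<phi>]) (rule that)
  have "(LINT x|lball. pd i (\<lambda>x. p x * of_real (\<phi> x)) x) = 0"
  proof (rule integral_pd_eq_zero(2)[OF pdiff_mult[OF dp d(1)] _ compact_imp_closed[OF K(1)] K(2)])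
    show "continuous_on UNIV (pd i (\<lambda>x. p x * of_real (\<phi> x)))"
      unfolding e by (intro continuous_intros polys_below_continuous[OF assms] polys_below_continuous[OF q]
          test_function_continuous[OF \<phi>] test_function_continuous[OF test_functions_partial_deriv[OF \<phi>]])
  qed (simp add: K(3))
  then have "(LINT x|lball. p x * of_real (partial_deriv i \<phi> x)) + (LINT x|lball. pd i p x * of_real (\<phi> x)) = 0"
    unfolding e using loc_integrable_test[OF loc(1) test_functions_partial_deriv[OF \<phi>]] loc_integrable_test[OF loc(2) \<phi>]
    by simp
  then show "(LINT x|lball. p x * of_real (mi_deriv (inc i (\<lambda>_. 0)) \<phi> x)) =
        (- 1) ^ mi_abs (inc i (\<lambda>_. 0)) * (LINT x|lball. pd i p x * of_real (\<phi> x))"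
    by (simp add: mi_deriv_unit test_function_smooth[OF \<phi>] eq_neg_iff_add_eq_0)
qed

section \<open>Approximation by polynomials and the fundamental lemma\<close>

lemma polys_below_mult:
  assumes "p \<in> polys_below N" "q \<in> polys_below M"
  shows "(\<lambda>x. p x * q x) \<in> polys_below (N + M)"
  using assms(1)
proof (induction rule: polys_below_induct)
  case (add \<gamma> c p)
  have "(\<lambda>x. of_real (rmono \<gamma> x) * q x) \<in> polys_below (mi_abs \<gamma> + M)"
  proof (induction \<gamma> rule: rmono_induct)
    case (2 \<gamma> i)
    from polys_below_coord[OF this, of i] show ?case by (simp add: rmono_inc mult.assoc)
  qed (use assms(2) in simp)
  then have "(\<lambda>x. of_real (rmono \<gamma> x) * q x) \<in> polys_below (N + M)"
    using polys_below_mono[of "mi_abs \<gamma> + M" "N + M"] add by auto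
  from polys_below_add[OF polys_below_cmult[OF this, of c] add(3)] show ?case
    by (simp add: algebra_simps)
qed (simp add: polys_below_zero)

lemma polys_below_max: "p \<in> polys_below N \<Longrightarrow> p \<in> polys_below (max N M)" "p \<in> polys_below N \<Longrightarrow> p \<in> polys_below (max M N)"
  using polys_below_mono[of N "max N M"] by (auto simp: max.commute)

text \<open>Connects \<open>polys_below\<close> with the notion of polynomial function used in the
  Stone-Weierstrass theorem.\<close>

lemma real_polynomial_function_polys_below:
  fixes g :: "real ^ 'n::finite \<Rightarrow> real"
  assumes "real_polynomial_function g"
  shows "\<exists>N. (\<lambda>x. complex_of_real (g x)) \<in> polys_below N"
  using assms
proof (induction rule: real_polynomial_function.induct)
  case (linear f)
  have "complex_of_real (f x) = (\<Sum>i\<in>UNIV. of_real (x $ i) * of_real (f (axis i 1)))" for x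
  proof -
    have "f x = f (\<Sum>i\<in>UNIV. x $ i *\<^sub>R axis i 1)"
      by (subst (1) basis_expansion[of x, symmetric]) (simp only: scalar_mult_eq_scaleR)
    also have "\<dots> = (\<Sum>i\<in>UNIV. x $ i * f (axis i 1))"
      using bounded_linear.linear[OF linear] by (simp add: linear_sum linear_cmul)
    finally show ?thesis by (simp only: of_real_sum of_real_mult)
  qed
  then have "(\<lambda>x. complex_of_real (f x)) = (\<lambda>x. \<Sum>i\<in>UNIV. of_real (x $ i) * of_real (f (axis i 1)))"
    by (rule ext)
  moreover have "(\<lambda>x. \<Sum>i\<in>UNIV. complex_of_real (x $ i) * of_real (f (axis i 1))) \<in> polys_below (Suc (Suc 0))"
    by (intro polys_below_sum polys_below_coord polys_below_const) simp
  ultimately show ?case by (intro exI) (simp only:)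
next
  case (const c)
  from polys_below_const[of 1 "of_real c"] show ?case by auto
next
  case (add f g)
  then obtain N M where "(\<lambda>x. complex_of_real (f x)) \<in> polys_below N" "(\<lambda>x. complex_of_real (g x)) \<in> polys_below M"
    by blast
  from polys_below_add[OF polys_below_max(1)[OF this(1), of M] polys_below_max(2)[OF this(2), of N]]
  show ?case by auto
next
  case (mult f g)
  then obtain N M where "(\<lambda>x. complex_of_real (f x)) \<in> polys_below N" "(\<lambda>x. complex_of_real (g x)) \<in> polys_below M"
    by blast
  from polys_below_mult[OF this] show ?case by auto
qed

lemma polynomial_function_polys_below:
  fixes g :: "real ^ 'n::finite \<Rightarrow> complex"
  assumes "polynomial_function g"
  shows "\<exists>N. g \<in> polys_below N"
proof -
  have "real_polynomial_function (\<lambda>x. Re (g x))" "real_polynomial_function (\<lambda>x. Im (g x))"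
    using assms bounded_linear_Re bounded_linear_Im by (auto simp: polynomial_function_def o_def)
  then obtain N M where "(\<lambda>x. complex_of_real (Re (g x))) \<in> polys_below N" "(\<lambda>x. complex_of_real (Im (g x))) \<in> polys_below M"
    using real_polynomial_function_polys_below by blast
  from polys_below_add[OF polys_below_max(1)[OF this(1), of M] polys_below_cmult[OF polys_below_max(2)[OF this(2), of N], of \<i>]]
  have "g \<in> polys_below (max N M)" by (simp add: complex_eq[symmetric])
  then show ?thesis ..
qed

text \<open>\<open>measurable_on\<close> supplies continuous functions converging off a null set.
  Clipping makes them bounded, and Stone-Weierstrass replaces the n-th one by a polynomial within 1
  / (n + 1) on the closed ball; hence the bound C + 1.\<close>

lemma bounded_measurable_limit_of_polys:
  fixes f :: "real ^ 'n::finite \<Rightarrow> complex"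
  assumes f: "f \<in> borel_measurable lball" and bd: "\<And>x. norm x < 1 \<Longrightarrow> cmod (f x) \<le> C" and C: "0 \<le> C"
  obtains p where "\<And>n. \<exists>N. p n \<in> polys_below N" "\<And>n x. norm x < 1 \<Longrightarrow> cmod (p n x) \<le> C + 1"
    "AE x in lball. (\<lambda>n. p n x) \<longlonglongrightarrow> f x"
proof -
  have "f measurable_on (ball 0 1)" using f by (simp add: measurable_on_iff_borel_measurable)
  then obtain Z g where Z: "negligible Z" and g: "\<And>n. continuous_on UNIV (g n)"
    and lim: "\<And>x. x \<notin> Z \<Longrightarrow> (\<lambda>n. g n x) \<longlonglongrightarrow> (if x \<in> ball 0 1 then f x else 0)"
    unfolding measurable_on_def by blast
  \<comment> \<open>Clipping by the nearest point of the disc of radius C: a continuous map that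
    fixes the values of f on the ball, so the limit is kept.\<close>
  define h where "h n x = closest_point (cball 0 C) (g n x)" for n x
  have ne: "cball (0::complex) C \<noteq> {}" using C by simp
  have hc: "continuous_on UNIV (h n)" for n unfolding h_def
    by (intro continuous_on_compose2[OF continuous_on_closest_point[OF convex_cball closed_cball ne, of UNIV] g]) auto
  have hb: "cmod (h n x) \<le> C" for n x
    using closest_point_in_set[OF closed_cball ne, of "g n x"] by (simp add: h_def)
  have "\<exists>p. polynomial_function p \<and> (\<forall>x\<in>cball 0 1. norm (h n x - p x) < 1 / real (Suc n))" for n
    by (rule Stone_Weierstrass_polynomial_function[OF compact_cball continuous_on_subset[OF hc]]) auto
  then obtain p where p: "\<And>n. polynomial_function (p n)" "\<And>n x. x \<in> cball 0 1 \<Longrightarrow> norm (h n x - p n x) < 1 / real (Suc n)"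
    by metis
  show ?thesis
  proof (rule that[of p])
    show "\<exists>N. p n \<in> polys_below N" for n by (rule polynomial_function_polys_below[OF p(1)])
    fix n and x :: "real ^ 'n" assume "norm x < 1"
    then have "cmod (h n x - p n x) < 1 / real (Suc n)" using p(2)[of x n] by simp
    also have "\<dots> \<le> 1" by simp
    finally show "cmod (p n x) \<le> C + 1"
      using hb[of n x] norm_triangle_ineq3[of "h n x" "p n x"] by linarith
  next
    have "AE x in lball. x \<notin> Z"
      using AE_not_in[OF Z[unfolded negligible_iff_null_sets]]
      by (subst AE_restrict_space_iff) (auto elim: AE_mp)
    then show "AE x in lball. (\<lambda>n. p n x) \<longlonglongrightarrow> f x"
    proof (rule AE_mp, intro AE_I2 impI)
      fix x :: "real ^ 'n" assume "x \<in> space lball" "x \<notin> Z"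
      then have x: "norm x < 1" and gl: "(\<lambda>n. g n x) \<longlonglongrightarrow> f x" using lim[of x] by auto
      have "isCont (closest_point (cball 0 C)) (f x)"
        using continuous_on_closest_point[OF convex_cball closed_cball ne, of UNIV] continuous_on_eq_continuous_at open_UNIV by blast
      from isCont_tendsto_compose[OF this gl] have "(\<lambda>n. h n x) \<longlonglongrightarrow> closest_point (cball 0 C) (f x)"
        by (simp add: h_def)
      also have "closest_point (cball 0 C) (f x) = f x"
        using bd[OF x] by (intro closest_point_self) simp
      finally have hl: "(\<lambda>n. h n x) \<longlonglongrightarrow> f x" .
      have "(\<lambda>n. 1 / real (Suc n)) \<longlonglongrightarrow> 0" using LIMSEQ_inverse_real_of_nat by (simp add: inverse_eq_divide)
      then have "(\<lambda>n. h n x - p n x) \<longlonglongrightarrow> 0"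
        by (rule Lim_null_comparison[rotated]) (use p(2)[of x] x in \<open>auto intro!: always_eventually less_imp_le\<close>)
      from tendsto_diff[OF hl this] show "(\<lambda>n. p n x) \<longlonglongrightarrow> f x" by simp
    qed
  qed
qed

lemma cut_poly_rmono: "cut_poly n f \<Longrightarrow> cut_poly n (\<lambda>x. rmono \<gamma> x * f x)"
proof (induction \<gamma> rule: rmono_induct)
  case (2 \<gamma> i)
  from cut_poly.coord[OF 2(1)[OF 2(2)], of i] show ?case by (simp add: rmono_inc mult.assoc)
qed simp

lemma trunc_rmono_test_function: "(\<lambda>x. rmono \<gamma> x * trunc_weight n b x) \<in> test_functions"
  by (rule cut_poly_test_function[OF cut_poly_rmono[OF cut_poly_trunc_weight]]) simp

lemma trunc_weight_test_function: "trunc_weight n b \<in> test_functions"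
  by (rule cut_poly_test_function[OF cut_poly_trunc_weight]) simp

text \<open>Polynomials times radial truncations are enough test functions, since every bounded
  measurable function is a bounded limit of polynomials.\<close>

lemma fundamental_lemma:
  fixes u :: "real ^ 'n::finite \<Rightarrow> complex"
  assumes u: "loc_integrable u" and zero: "\<And>\<phi>. \<phi> \<in> test_functions \<Longrightarrow> (LINT x|lball. u x * of_real (\<phi> x)) = 0"
  shows "AE x in lball. u x = 0"
proof -
  interpret finite_measure "lball :: (real ^ 'n) measure" by (rule finite_measure_lball)
  \<comment> \<open>With exponent 0 the truncations tend to 1 on the ball, so it is enough that all
    these products vanish; they are integrable although u is only locally so.\<close>
  have "AE x in lball. u x * of_real (trunc_weight n 0 x) = 0" for n
  proof (rule density_zero)
    define f where "f x = u x * of_real (trunc_weight n 0 x)" for x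
    show f: "integrable lball (\<lambda>x. u x * of_real (trunc_weight n 0 x))"
      by (rule loc_integrable_test[OF u trunc_weight_test_function])
    note fm = borel_measurable_integrable[OF f, folded f_def]
    \<comment> \<open>f integrates to zero against polynomials, because monomials times the
      truncation are test functions. Bounded limits of polynomials then give the indicator
      functions.\<close>
    have fp: "integrable lball (\<lambda>x. f x * p x) \<and> (LINT x|lball. f x * p x) = 0" if "p \<in> polys_below N" for p N
      using that
    proof (induction rule: polys_below_induct)
      case (add \<gamma> c p)
      have eq: "f x * (c * of_real (rmono \<gamma> x) + p x) = c * (u x * of_real (rmono \<gamma> x * trunc_weight n 0 x)) + f x * p x" for x
        by (simp add: f_def algebra_simps)
      have "integrable lball (\<lambda>x. u x * of_real (rmono \<gamma> x * trunc_weight n 0 x))"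
        by (rule loc_integrable_test[OF u trunc_rmono_test_function])
      then show ?case
        unfolding eq using add zero[OF trunc_rmono_test_function, of \<gamma> n 0] by (auto simp del: of_real_mult)
    qed simp
    fix A :: "(real ^ 'n) set" assume A: "A \<in> sets lball"
    have Am: "(\<lambda>x. indicator A x :: complex) \<in> borel_measurable lball" using A by simp
    obtain p where p: "\<And>k. \<exists>N. p k \<in> polys_below N" "\<And>k x. norm x < 1 \<Longrightarrow> cmod (p k x) \<le> 1 + 1"
      "AE x in lball. (\<lambda>k. p k x) \<longlonglongrightarrow> indicator A x"
    proof (rule bounded_measurable_limit_of_polys[OF Am, of 1])
      show "cmod (indicator A x) \<le> 1" for x by (simp add: indicator_def)
    qed (simp, rule that, simp_all)
    have "(\<lambda>k. LINT x|lball. f x * p k x) \<longlonglongrightarrow> (LINT x|lball. f x * indicator A x)"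
    proof (rule integral_dominated_convergence)
      show "(\<lambda>x. f x * indicator A x) \<in> borel_measurable lball" using fm Am by measurable
      show "(\<lambda>x. f x * p k x) \<in> borel_measurable lball" for k
        using fm p(1)[of k] polys_below_continuous measurable_lball_continuous by (metis borel_measurable_times)
      show "integrable lball (\<lambda>x. 2 * norm (f x))" using f by (intro integrable_mult_right integrable_norm) (simp add: f_def)
      show "AE x in lball. (\<lambda>k. f x * p k x) \<longlonglongrightarrow> f x * indicator A x"
        using p(3) by (rule AE_mp) (auto intro!: AE_I2 tendsto_mult tendsto_const)
      show "AE x in lball. norm (f x * p k x) \<le> 2 * norm (f x)" for k
      proof (rule AE_I2)
        fix x :: "real ^ 'n" assume "x \<in> space lball"
        then have "cmod (p k x) \<le> 2" using p(2)[of x k] by simp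
        then show "norm (f x * p k x) \<le> 2 * norm (f x)"
          by (simp add: norm_mult mult.commute[of "cmod (f x)"] mult_right_mono)
      qed
    qed
    moreover have "(LINT x|lball. f x * p k x) = 0" for k using fp p(1)[of k] by blast
    ultimately have "(LINT x|lball. f x * indicator A x) = 0" by (simp add: LIMSEQ_const_iff)
    moreover have "indicator A x *\<^sub>R f x = f x * indicator A x" for x by (simp add: indicator_def)
    ultimately show "set_lebesgue_integral lball A (\<lambda>x. u x * of_real (trunc_weight n 0 x)) = 0"
      by (simp add: set_lebesgue_integral_def f_def)
  qed
  then have "AE x in lball. \<forall>n. u x * of_real (trunc_weight n 0 x) = 0" unfolding AE_all_countable by blast
  then show ?thesis
  proof (rule AE_mp, intro AE_I2 impI)
    fix x :: "real ^ 'n" assume "x \<in> space lball" and z: "\<forall>n. u x * of_real (trunc_weight n 0 x) = 0"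
    then have x: "norm x < 1" by simp
    have "(\<lambda>n. u x * of_real (trunc_weight n 0 x)) \<longlonglongrightarrow> u x * of_real (weight 0 x)"
      by (intro tendsto_intros trunc_weight_tendsto x)
    then have "u x * of_real (weight 0 x) = 0" using z by (simp add: LIMSEQ_const_iff)
    moreover have "weight 0 x = 1" using x abs_square_less_1[of "norm x"] by (simp add: weight_def)
    ultimately show "u x = 0" by simp
  qed
qed

lemma weak_deriv_unique:
  assumes "is_weak_deriv \<gamma> u v" "is_weak_deriv \<gamma> u w"
  shows "AE x in lball. v x = w x"
proof -
  have d: "is_weak_deriv \<gamma> (\<lambda>x. 0) (\<lambda>x. v x - w x)"
    using is_weak_deriv_diff[OF assms] by simp
  have "AE x in lball. v x - w x = 0"
    using is_weak_deriv_test[OF d] by (intro fundamental_lemma is_weak_deriv_loc(2)[OF d]) simp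
  then show ?thesis by (rule AE_mp) (auto intro!: AE_I2)
qed

lemma L2_norm_cong_AE:
  assumes "AE x in lball. u x = v x" "u \<in> borel_measurable lball" "v \<in> borel_measurable lball"
  shows "L2_norm a u = L2_norm a v"
  unfolding L2_norm_def
  by (rule arg_cong[of _ _ sqrt], rule integral_cong_AE) (use assms weight_measurable in \<open>measurable, auto\<close>)

text \<open>Removes the choice operator: any weak derivative at hand may stand for
  \<open>weak_deriv\<close>, as two of them agree almost everywhere.\<close>

lemma L2_norm_weak_deriv:
  assumes "is_weak_deriv \<gamma> u w"
  shows "L2_norm a (weak_deriv \<gamma> u) = L2_norm a w"
proof -
  have "is_weak_deriv \<gamma> u (weak_deriv \<gamma> u)"
    unfolding weak_deriv_def by (rule someI[of _ w]) (rule assms)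
  then show ?thesis
    using weak_deriv_unique[OF _ assms] assms
    by (intro L2_norm_cong_AE) (auto intro: loc_integrable_measurable dest: is_weak_deriv_loc)
qed

text \<open>Truncate the values of u first, then approximate the resulting bounded function by
  uniformly bounded polynomials. Dominated convergence applies in the second step because the weight
  has finite integral.\<close>

lemma polys_dense:
  fixes u :: "real ^ 'n::finite \<Rightarrow> complex"
  assumes a: "a > -1" and u: "u \<in> L2 a" and e: "e > 0"
  obtains p N where "p \<in> polys_below N" "L2_norm a (\<lambda>x. u x - p x) < e"
proof -
  define v where "v k x = (if cmod (u x) \<le> real k then u x else 0)" for k :: nat and x
  have um[measurable]: "u \<in> borel_measurable lball" by (rule L2_measurable[OF u])
  have wm[measurable]: "weight a \<in> borel_measurable (lball :: (real ^ 'n) measure)" by (rule weight_measurable)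
  have vm[measurable]: "v k \<in> borel_measurable lball" for k unfolding v_def[abs_def] by measurable
  have vb: "cmod (v k x) \<le> real k" for k x by (simp add: v_def)
  have vL: "v k \<in> L2 a" for k
    by (rule L2_I[OF vm, of "\<lambda>x. (cmod (u x))\<^sup>2 * weight a x"]) (use u in \<open>auto simp: L2_iff v_def\<close>)
  have "(\<lambda>k. LINT x|lball. (cmod (u x - v k x))\<^sup>2 * weight a x) \<longlonglongrightarrow> (LINT x|(lball :: (real ^ 'n) measure). 0)"
  proof (rule integral_dominated_convergence)
    show "integrable lball (\<lambda>x. (cmod (u x))\<^sup>2 * weight a x)" using u by (simp add: L2_iff)
    show "AE x in lball. (\<lambda>k. (cmod (u x - v k x))\<^sup>2 * weight a x) \<longlonglongrightarrow> 0"
    proof (rule AE_I2)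
      fix x
      have "\<forall>\<^sub>F k in sequentially. cmod (u x) \<le> real k"
        using filterlim_real_sequentially by (simp add: filterlim_at_top)
      then have "\<forall>\<^sub>F k in sequentially. 0 = (cmod (u x - v k x))\<^sup>2 * weight a x"
        by (rule eventually_mono) (simp add: v_def)
      then show "(\<lambda>k. (cmod (u x - v k x))\<^sup>2 * weight a x) \<longlonglongrightarrow> 0"
        by (rule Lim_transform_eventually[OF tendsto_const])
    qed
    show "AE x in lball. norm ((cmod (u x - v k x))\<^sup>2 * weight a x) \<le> (cmod (u x))\<^sup>2 * weight a x" for k
      by (intro AE_I2) (simp add: v_def)
  qed measurable
  then have "(\<lambda>k. L2_norm a (\<lambda>x. u x - v k x)) \<longlonglongrightarrow> sqrt 0"
    unfolding L2_norm_def by (intro tendsto_real_sqrt) simp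
  then have "\<forall>\<^sub>F k in sequentially. L2_norm a (\<lambda>x. u x - v k x) < e / 2"
    using e by (intro order_tendstoD(2)[where y = "0::real"]) auto
  then obtain k where k: "L2_norm a (\<lambda>x. u x - v k x) < e / 2" by (auto simp: eventually_sequentially)
  obtain p where p: "\<And>n. \<exists>N. p n \<in> polys_below N" "\<And>n x. norm x < 1 \<Longrightarrow> cmod (p n x) \<le> real k + 1"
    "AE x in lball. (\<lambda>n. p n x) \<longlonglongrightarrow> v k x"
    using bounded_measurable_limit_of_polys[OF vm[of k], of "real k"] vb by auto
  have pm[measurable]: "p n \<in> borel_measurable lball" for n
    using p(1)[of n] polys_below_continuous measurable_lball_continuous by blast
  have "(\<lambda>n. LINT x|lball. (cmod (v k x - p n x))\<^sup>2 * weight a x) \<longlonglongrightarrow> (LINT x|(lball :: (real ^ 'n) measure). 0)"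
  proof (rule integral_dominated_convergence)
    \<comment> \<open>The function \<open>v k\<close> is bounded by k and the polynomials by k +
      1.\<close>
    show "integrable lball (\<lambda>x::real^'n. (2 * real k + 1)\<^sup>2 * weight a x)"
      by (intro integrable_mult_right weight_integrable a)
    show "AE x in lball. (\<lambda>n. (cmod (v k x - p n x))\<^sup>2 * weight a x) \<longlonglongrightarrow> 0"
      using p(3)
    proof (rule AE_mp, intro AE_I2 impI)
      fix x assume "(\<lambda>n. p n x) \<longlonglongrightarrow> v k x"
      then have "(\<lambda>n. (cmod (v k x - p n x))\<^sup>2 * weight a x) \<longlonglongrightarrow> (cmod (v k x - v k x))\<^sup>2 * weight a x"
        by (intro tendsto_intros)
      then show "(\<lambda>n. (cmod (v k x - p n x))\<^sup>2 * weight a x) \<longlonglongrightarrow> 0" by simp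
    qed
    show "AE x in lball. norm ((cmod (v k x - p n x))\<^sup>2 * weight a x) \<le> (2 * real k + 1)\<^sup>2 * weight a x" for n
    proof (rule AE_I2)
      fix x :: "real ^ 'n" assume "x \<in> space lball"
      then have "cmod (v k x - p n x) \<le> 2 * real k + 1"
        using norm_triangle_ineq4[of "v k x" "p n x"] vb[of k x] p(2)[of x n] by simp
      then have "(cmod (v k x - p n x))\<^sup>2 \<le> (2 * real k + 1)\<^sup>2" by (intro power_mono) auto
      then show "norm ((cmod (v k x - p n x))\<^sup>2 * weight a x) \<le> (2 * real k + 1)\<^sup>2 * weight a x"
        by (simp add: mult_right_mono)
    qed
  qed measurable
  then have "(\<lambda>n. L2_norm a (\<lambda>x. v k x - p n x)) \<longlonglongrightarrow> sqrt 0"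
    unfolding L2_norm_def by (intro tendsto_real_sqrt) simp
  then have "\<forall>\<^sub>F n in sequentially. L2_norm a (\<lambda>x. v k x - p n x) < e / 2"
    using e by (intro order_tendstoD(2)[where y = "0::real"]) auto
  then obtain n where n: "L2_norm a (\<lambda>x. v k x - p n x) < e / 2" by (auto simp: eventually_sequentially)
  obtain N where N: "p n \<in> polys_below N" using p(1) by blast
  have "L2_norm a (\<lambda>x. (u x - v k x) + (v k x - p n x)) \<le> L2_norm a (\<lambda>x. u x - v k x) + L2_norm a (\<lambda>x. v k x - p n x)"
    by (intro L2_norm_triangle L2_diff u vL polys_below_L2[OF a N])
  also have "\<dots> < e" using k n by simp
  finally show ?thesis using that[OF N] by simp
qed

section \<open>Divergence theorem and orthogonal projections\<close>

lemma inner_mult_of_real: "(z * of_real r) \<bullet> c = z \<bullet> (c * of_real r)" for z c :: complex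
  by (simp add: inner_complex_def)

text \<open>A monomial times the truncated weight is a real test function, so the definition of the
  weak derivative applies; complex coefficients and sums follow by linearity. Integrability is part
  of the claim so that the induction can add integrals.\<close>

lemma truncated_ibp:
  assumes uv: "wpd i u v" and q: "q \<in> polys_below N"
  shows "integrable lball (\<lambda>x. v x \<bullet> (q x * of_real (trunc_weight n b x))) \<and>
    integrable lball (\<lambda>x. u x \<bullet> (pd i q x * of_real (trunc_weight n b x) + q x * of_real (trunc_weight' n b x * x $ i))) \<and>
    (LINT x|lball. v x \<bullet> (q x * of_real (trunc_weight n b x))) =
    - (LINT x|lball. u x \<bullet> (pd i q x * of_real (trunc_weight n b x) + q x * of_real (trunc_weight' n b x * x $ i)))"
    (is "?P q")
  using q
proof (induction rule: polys_below_induct)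
  case zero
  then show ?case by simp
next
  case (add \<gamma> c p)
  define \<phi> where "\<phi> x = rmono \<gamma> x * trunc_weight n b x" for x :: "real ^ 'a"
  have \<phi>: "\<phi> \<in> test_functions" unfolding \<phi>_def by (rule trunc_rmono_test_function)
  let ?r = "\<lambda>x::real^'a. complex_of_real (rmono \<gamma> x)"
  have d: "of_real (partial_deriv i \<phi> x) = pd i ?r x * of_real (trunc_weight n b x) + ?r x * of_real (trunc_weight' n b x * x $ i)" for x
  proof -
    have dt: "((\<lambda>x. complex_of_real (trunc_weight n b x)) has_derivative (\<lambda>h. of_real (trunc_weight' n b x * (x \<bullet> h)))) (at x)" for x :: "real ^ 'a"
      by (intro has_derivative_of_real_complex trunc_weight_has_derivative)
    have pt: "pdiff (\<lambda>x::real^'a. complex_of_real (trunc_weight n b x))" by (rule has_derivative_imp_pdiff[OF dt])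
    obtain D where D: "(\<phi> has_derivative D) (at x)"
      using smooth_imp_differentiable[OF test_function_smooth[OF \<phi>]] by (auto simp: differentiable_on_def differentiable_def)
    have "of_real (partial_deriv i \<phi> x) = pd i (\<lambda>x. complex_of_real (\<phi> x)) x"
      by (simp add: partial_deriv_eq[OF D] pd_eq[OF has_derivative_of_real_complex[OF D]])
    also have "\<dots> = pd i (\<lambda>x. ?r x * of_real (trunc_weight n b x)) x" by (simp add: \<phi>_def)
    also have "\<dots> = ?r x * pd i (\<lambda>x. complex_of_real (trunc_weight n b x)) x + pd i ?r x * of_real (trunc_weight n b x)"
      by (rule pd_mult[OF pdiff_rmono pt])
    also have "pd i (\<lambda>x. complex_of_real (trunc_weight n b x)) x = of_real (trunc_weight' n b x * x $ i)"
      by (simp add: pd_eq[OF dt] inner_axis)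
    finally show ?thesis by simp
  qed
  note i1 = loc_integrable_test[OF is_weak_deriv_loc(2)[OF uv] \<phi>]
  note i2 = loc_integrable_test[OF is_weak_deriv_loc(1)[OF uv] test_functions_partial_deriv[OF \<phi>]]
  define q0 where "q0 = (\<lambda>x. c * ?r x)"
  have pd0: "pd i q0 x = c * pd i ?r x" for x unfolding q0_def by (rule pd_cmult[OF pdiff_rmono])
  have e1: "v x \<bullet> (q0 x * of_real (trunc_weight n b x)) = (v x * of_real (\<phi> x)) \<bullet> c" for x
    unfolding inner_mult_of_real by (simp add: q0_def \<phi>_def mult.assoc)
  have e2: "u x \<bullet> (pd i q0 x * of_real (trunc_weight n b x) + q0 x * of_real (trunc_weight' n b x * x $ i))
      = (u x * of_real (partial_deriv i \<phi> x)) \<bullet> c" for x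
  proof -
    have "(u x * of_real (partial_deriv i \<phi> x)) \<bullet> c = u x \<bullet> (c * of_real (partial_deriv i \<phi> x))"
      by (rule inner_mult_of_real)
    also have "c * of_real (partial_deriv i \<phi> x) = pd i q0 x * of_real (trunc_weight n b x) + q0 x * of_real (trunc_weight' n b x * x $ i)"
      by (simp only: d pd0) (simp add: q0_def algebra_simps)
    finally show ?thesis ..
  qed
  have "?P q0"
    unfolding e1 e2 using i1 i2 wpd_test[OF uv \<phi>] by (simp del: of_real_mult)
  moreover have "?P p" by (rule add(3))
  moreover have "pd i (\<lambda>x. q0 x + p x) x = pd i q0 x + pd i p x" for x
    unfolding q0_def by (rule pd_add[OF pdiff_cmult[OF pdiff_rmono] polys_below_pdiff[OF add(2)]])
  moreover have "v x \<bullet> ((q0 x + p x) * of_real (trunc_weight n b x))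
     = v x \<bullet> (q0 x * of_real (trunc_weight n b x)) + v x \<bullet> (p x * of_real (trunc_weight n b x))" for x
    by (simp add: distrib_right inner_add_right)
  moreover have "u x \<bullet> ((pd i q0 x + pd i p x) * of_real (trunc_weight n b x) + (q0 x + p x) * of_real (trunc_weight' n b x * x $ i))
     = u x \<bullet> (pd i q0 x * of_real (trunc_weight n b x) + q0 x * of_real (trunc_weight' n b x * x $ i))
     + u x \<bullet> (pd i p x * of_real (trunc_weight n b x) + p x * of_real (trunc_weight' n b x * x $ i))" for x
    by (simp add: distrib_right inner_add_right del: of_real_mult)
  ultimately have "?P (\<lambda>x. q0 x + p x)" by (simp del: of_real_mult)
  then show ?case by (simp add: q0_def)
qed

text \<open>The tangency condition on \<open>X\<close> makes the boundary terms vanish in the limit.\<close>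

lemma weak_divergence_theorem:
  fixes u :: "real ^ 'n::finite \<Rightarrow> complex"
  assumes a: "a > -1" and u: "u \<in> L2 a" and v: "\<And>i. v i \<in> L2 a" and uv: "\<And>i. wpd i u (v i)"
    and X: "\<And>i. X i \<in> polys_below N" and Y: "Y \<in> polys_below M"
    and tangent: "\<And>x. (\<Sum>i\<in>UNIV. of_real (x $ i) * X i x) = of_real (1 - (norm x)\<^sup>2) * Y x"
  shows "(\<Sum>i\<in>UNIV. ip a (v i) (X i)) = - ip a u (\<lambda>x. (\<Sum>i\<in>UNIV. pd i (X i) x) - of_real (2 * a) * Y x)"
proof -
  define dv where "dv x = (\<Sum>i\<in>UNIV. pd i (X i) x)" for x
  have dvp: "dv \<in> polys_below (N - 1)"
    unfolding dv_def[abs_def] by (intro polys_below_sum pd_polys_below X)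
  note L = polys_below_L2[OF a X] polys_below_L2[OF a Y] polys_below_L2[OF a dvp]
  define f where "f n x = (\<Sum>i\<in>UNIV. (v i x \<bullet> X i x) * trunc_weight n a x)" for n x
  \<comment> \<open>By tangency the derivative of the truncated weight enters only multiplied by 1 -
    |x|^2. In this combination it is dominated by a multiple of W_a for all n at once, as dominated
    convergence requires.\<close>
  define g where "g n x = (u x \<bullet> dv x) * trunc_weight n a x + (u x \<bullet> Y x) * (trunc_weight' n a x * (1 - (norm x)\<^sup>2))" for n x
  have eq: "(LINT x|lball. f n x) = - (LINT x|lball. g n x)" for n
  proof -
    note t = truncated_ibp[OF uv X, where n = n and b = a]
    have 1: "(v i x \<bullet> X i x) * trunc_weight n a x = v i x \<bullet> (X i x * of_real (trunc_weight n a x))" for i x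
      by (simp add: inner_complex_def algebra_simps)
    have 2: "g n x = (\<Sum>i\<in>UNIV. u x \<bullet> (pd i (X i) x * of_real (trunc_weight n a x) + X i x * of_real (trunc_weight' n a x * x $ i)))" for x
    proof -
      have "(\<Sum>i\<in>UNIV. u x \<bullet> (pd i (X i) x * of_real (trunc_weight n a x) + X i x * of_real (trunc_weight' n a x * x $ i)))
        = u x \<bullet> (dv x * of_real (trunc_weight n a x) + (\<Sum>i\<in>UNIV. of_real (x $ i) * X i x) * of_real (trunc_weight' n a x))"
      proof -
        have "X i x * of_real (trunc_weight' n a x * x $ i) = of_real (x $ i) * X i x * of_real (trunc_weight' n a x)" for i
          by simp
        then show ?thesis
          by (simp only: inner_sum_right[symmetric] sum.distrib dv_def sum_distrib_right)
      qed
      also have "\<dots> = g n x"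
        unfolding tangent g_def by (simp add: inner_complex_def algebra_simps)
      finally show ?thesis by simp
    qed
    have "(LINT x|lball. f n x) = (\<Sum>i\<in>UNIV. LINT x|lball. v i x \<bullet> (X i x * of_real (trunc_weight n a x)))"
      unfolding f_def 1 using t by (intro Bochner_Integration.integral_sum) blast
    also have "\<dots> = - (\<Sum>i\<in>UNIV. LINT x|lball. u x \<bullet> (pd i (X i) x * of_real (trunc_weight n a x) + X i x * of_real (trunc_weight' n a x * x $ i)))"
      using t by (simp add: sum_negf del: of_real_mult)
    also have "(\<Sum>i\<in>UNIV. LINT x|lball. u x \<bullet> (pd i (X i) x * of_real (trunc_weight n a x) + X i x * of_real (trunc_weight' n a x * x $ i)))
      = (LINT x|lball. g n x)"
      unfolding 2 using t by (intro Bochner_Integration.integral_sum[symmetric]) blast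
    finally show ?thesis .
  qed
  have mv[measurable]: "v i \<in> borel_measurable lball" for i by (rule L2_measurable[OF v])
  have mX[measurable]: "X i \<in> borel_measurable lball" for i by (rule L2_measurable[OF L(1)])
  have mY[measurable]: "Y \<in> borel_measurable lball" by (rule L2_measurable[OF L(2)])
  have md[measurable]: "dv \<in> borel_measurable lball" by (rule L2_measurable[OF L(3)])
  have mu[measurable]: "u \<in> borel_measurable lball" by (rule L2_measurable[OF u])
  have mw[measurable]: "weight a \<in> borel_measurable (lball :: (real^'n) measure)" by (rule weight_measurable)
  have mt[measurable]: "trunc_weight n a \<in> borel_measurable (lball :: (real^'n) measure)" for n
    by (intro measurable_lball_continuous trunc_weight_continuous)
  have mt'[measurable]: "(\<lambda>x. trunc_weight' n a x * (1 - (norm x)\<^sup>2)) \<in> borel_measurable (lball :: (real^'n) measure)" for n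
    by (intro measurable_lball_continuous continuous_intros trunc_weight'_continuous)
  have "(\<lambda>n. LINT x|lball. f n x) \<longlonglongrightarrow> (LINT x|lball. (\<Sum>i\<in>UNIV. (v i x \<bullet> X i x) * weight a x))"
  proof (rule integral_dominated_convergence)
    show "integrable lball (\<lambda>x. \<Sum>i\<in>UNIV. \<bar>(v i x \<bullet> X i x) * weight a x\<bar>)"
      by (intro Bochner_Integration.integrable_sum integrable_abs ip_integrable v L)
    show "AE x in lball. (\<lambda>n. f n x) \<longlonglongrightarrow> (\<Sum>i\<in>UNIV. (v i x \<bullet> X i x) * weight a x)"
      unfolding f_def by (intro AE_I2 tendsto_intros trunc_weight_tendsto) simp
    show "AE x in lball. norm (f n x) \<le> (\<Sum>i\<in>UNIV. \<bar>(v i x \<bullet> X i x) * weight a x\<bar>)" for n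
    proof (rule AE_I2)
      fix x :: "real ^ 'n" assume "x \<in> space lball"
      then show "norm (f n x) \<le> (\<Sum>i\<in>UNIV. \<bar>(v i x \<bullet> X i x) * weight a x\<bar>)"
        unfolding f_def using trunc_weight_bounds[of x n a]
        by (intro sum_norm_le) (auto simp: abs_mult intro!: mult_left_mono)
    qed
    show "f n \<in> borel_measurable lball" for n unfolding f_def[abs_def] by measurable
  qed measurable
  also have "(LINT x|lball. (\<Sum>i\<in>UNIV. (v i x \<bullet> X i x) * weight a x)) = (\<Sum>i\<in>UNIV. ip a (v i) (X i))"
    unfolding ip_def by (intro Bochner_Integration.integral_sum ip_integrable v L)
  finally have lim1: "(\<lambda>n. LINT x|lball. f n x) \<longlonglongrightarrow> (\<Sum>i\<in>UNIV. ip a (v i) (X i))" .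
  have "(\<lambda>n. LINT x|lball. g n x) \<longlonglongrightarrow> (LINT x|lball. (u x \<bullet> dv x) * weight a x + (u x \<bullet> Y x) * (- 2 * a * weight a x))"
  proof (rule integral_dominated_convergence)
    show "integrable lball (\<lambda>x. \<bar>(u x \<bullet> dv x) * weight a x\<bar> + (6 + 2 * \<bar>a\<bar>) * \<bar>(u x \<bullet> Y x) * weight a x\<bar>)"
      by (intro Bochner_Integration.integrable_add integrable_mult_right integrable_abs ip_integrable u L)
    show "AE x in lball. (\<lambda>n. g n x) \<longlonglongrightarrow> (u x \<bullet> dv x) * weight a x + (u x \<bullet> Y x) * (- 2 * a * weight a x)"
      unfolding g_def by (intro AE_I2 tendsto_add tendsto_mult tendsto_const trunc_weight_tendsto trunc_weight'_tendsto) simp_all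
    show "AE x in lball. norm (g n x) \<le> \<bar>(u x \<bullet> dv x) * weight a x\<bar> + (6 + 2 * \<bar>a\<bar>) * \<bar>(u x \<bullet> Y x) * weight a x\<bar>" for n
    proof (rule AE_I2)
      fix x :: "real ^ 'n" assume "x \<in> space lball"
      then have x: "norm x < 1" by simp
      have "\<bar>(u x \<bullet> dv x) * trunc_weight n a x\<bar> \<le> \<bar>(u x \<bullet> dv x) * weight a x\<bar>"
        using trunc_weight_bounds[OF x, of n a] by (auto simp: abs_mult intro!: mult_left_mono)
      moreover have bY: "\<bar>u x \<bullet> Y x\<bar> * \<bar>trunc_weight' n a x * (1 - (norm x)\<^sup>2)\<bar> \<le> \<bar>u x \<bullet> Y x\<bar> * ((6 + 2 * \<bar>a\<bar>) * weight a x)"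
        by (intro mult_left_mono trunc_weight'_bound x) simp
      from bY have "\<bar>(u x \<bullet> Y x) * (trunc_weight' n a x * (1 - (norm x)\<^sup>2))\<bar> \<le> (6 + 2 * \<bar>a\<bar>) * \<bar>(u x \<bullet> Y x) * weight a x\<bar>"
      proof -
        have R: "(6 + 2 * \<bar>a\<bar>) * \<bar>(u x \<bullet> Y x) * weight a x\<bar> = \<bar>u x \<bullet> Y x\<bar> * ((6 + 2 * \<bar>a\<bar>) * weight a x)"
          by (simp add: abs_mult)
        have L: "\<bar>(u x \<bullet> Y x) * (trunc_weight' n a x * (1 - (norm x)\<^sup>2))\<bar> = \<bar>u x \<bullet> Y x\<bar> * \<bar>trunc_weight' n a x * (1 - (norm x)\<^sup>2)\<bar>"
          by (rule abs_mult)
        show ?thesis unfolding R L by (rule bY)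
      qed
      ultimately show "norm (g n x) \<le> \<bar>(u x \<bullet> dv x) * weight a x\<bar> + (6 + 2 * \<bar>a\<bar>) * \<bar>(u x \<bullet> Y x) * weight a x\<bar>"
        unfolding g_def real_norm_def by (intro order_trans[OF abs_triangle_ineq] add_mono)
    qed
    show "g n \<in> borel_measurable lball" for n unfolding g_def[abs_def] by measurable
  qed measurable
  also have "(LINT x|lball. (u x \<bullet> dv x) * weight a x + (u x \<bullet> Y x) * (- 2 * a * weight a x))
     = ip a u (\<lambda>x. dv x - of_real (2 * a) * Y x)"
    unfolding ip_def by (rule Bochner_Integration.integral_cong) (auto simp: inner_complex_def algebra_simps)
  finally have "(\<lambda>n. - (LINT x|lball. g n x)) \<longlonglongrightarrow> - ip a u (\<lambda>x. dv x - of_real (2 * a) * Y x)"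
    by (rule tendsto_minus)
  with lim1 show ?thesis
    unfolding eq dv_def[symmetric] by (rule LIMSEQ_unique)
qed

text \<open>Use the field whose only nonzero component is (1 - |x|^2) q in direction i. The factor
  makes the field tangent and at the same time turns W_a into W_(a+1); its own derivative
  contributes the 1 in 2 (a + 1).\<close>

lemma weak_divergence_single:
  fixes u :: "real ^ 'n::finite \<Rightarrow> complex"
  assumes a: "a > -1" and u: "u \<in> L2 a" and v: "v \<in> L2 a" and uv: "wpd i u v" and q: "q \<in> polys_below N"
    and ex: "\<And>j. \<exists>w\<in>L2 a. wpd j u w"
  shows "ip (a + 1) v q = - ip a u (\<lambda>x. of_real (1 - (norm x)\<^sup>2) * pd i q x - of_real (2 * (a + 1)) * of_real (x $ i) * q x)"
proof -
  obtain w where w: "\<And>j. w j \<in> L2 a" "\<And>j. wpd j u (w j)" using ex by metis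
  define v' where "v' = w(i := v)"
  define X where "X j = (if j = i then (\<lambda>x. of_real (1 - (norm x)\<^sup>2) * q x) else (\<lambda>x. 0))" for j
  have Y: "(\<lambda>x. of_real (x $ i) * q x) \<in> polys_below (Suc N)" by (rule polys_below_coord[OF q])
  have X: "X j \<in> polys_below (Suc (Suc N))" for j
    unfolding X_def by (cases "j = i") (simp_all only: if_True if_False simp_thms polys_below_one_minus_norm[OF q] polys_below_zero)
  have tan: "(\<Sum>j\<in>UNIV. of_real (x $ j) * X j x) = of_real (1 - (norm x)\<^sup>2) * (of_real (x $ i) * q x)" for x
  proof -
    have "(\<Sum>j\<in>UNIV. of_real (x $ j) * X j x) = (\<Sum>j\<in>UNIV. if j = i then of_real (x $ i) * (of_real (1 - (norm x)\<^sup>2) * q x) else 0)"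
      by (intro sum.cong refl) (simp add: X_def)
    then show ?thesis by (simp add: mult.left_commute)
  qed
  have "(\<Sum>j\<in>UNIV. ip a (v' j) (X j)) = - ip a u (\<lambda>x. (\<Sum>j\<in>UNIV. pd j (X j) x) - of_real (2 * a) * (of_real (x $ i) * q x))"
    by (rule weak_divergence_theorem[OF a u _ _ X Y tan]) (auto simp: v'_def v uv w)
  moreover have "(\<Sum>j\<in>UNIV. ip a (v' j) (X j)) = (\<Sum>j\<in>UNIV. if j = i then ip (a + 1) v q else 0)"
    by (intro sum.cong refl) (simp add: X_def v'_def ip_weight_Suc)
  moreover have "(\<Sum>j\<in>UNIV. pd j (X j) x) = of_real (1 - (norm x)\<^sup>2) * pd i q x - 2 * of_real (x $ i) * q x" for x
  proof -
    have dn: "((\<lambda>x::real^'n. complex_of_real (1 - (norm x)\<^sup>2)) has_derivative (\<lambda>h. of_real (- 2 * (x \<bullet> h)))) (at x)" for x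
      unfolding power2_norm_eq_inner
      by (rule has_derivative_of_real_complex) (auto intro!: derivative_eq_intros simp: inner_commute)
    have "(\<Sum>j\<in>UNIV. pd j (X j) x) = (\<Sum>j\<in>UNIV. if j = i then pd i (\<lambda>x. of_real (1 - (norm x)\<^sup>2) * q x) x else 0)"
      by (intro sum.cong refl) (simp add: X_def)
    also have "\<dots> = pd i (\<lambda>x. of_real (1 - (norm x)\<^sup>2) * q x) x" by simp
    also have "\<dots> = of_real (1 - (norm x)\<^sup>2) * pd i q x + pd i (\<lambda>x. of_real (1 - (norm x)\<^sup>2)) x * q x"
      by (rule pd_mult[OF has_derivative_imp_pdiff[OF dn] polys_below_pdiff[OF q]])
    also have "pd i (\<lambda>x. of_real (1 - (norm x)\<^sup>2)) x = - 2 * of_real (x $ i)"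
      by (subst pd_eq[OF dn]) (simp add: inner_axis)
    finally show ?thesis by simp
  qed
  ultimately show ?thesis by (simp add: algebra_simps)
qed

section \<open>Existence, uniqueness and basic properties of orthogonal projections\<close>

lemma proj_step:
  assumes V: "V \<subseteq> L2 a" "\<And>v w s. v \<in> V \<Longrightarrow> w \<in> V \<Longrightarrow> (\<lambda>x. v x + of_real s * w x) \<in> V"
    and P: "\<And>u. u \<in> L2 a \<Longrightarrow> \<exists>p\<in>V. \<forall>q\<in>V. ip a (\<lambda>x. u x - p x) q = 0"
    and b: "b \<in> L2 a" and u: "u \<in> L2 a"
  shows "\<exists>p\<in>V. \<exists>s. \<forall>q\<in>V. \<forall>t. ip a (\<lambda>x. u x - (p x + of_real s * b x)) (\<lambda>x. q x + of_real t * b x) = 0"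
proof -
  obtain pb where pb: "pb \<in> V" "\<And>q. q \<in> V \<Longrightarrow> ip a (\<lambda>x. b x - pb x) q = 0" using P[OF b] by blast
  obtain pu where pu: "pu \<in> V" "\<And>q. q \<in> V \<Longrightarrow> ip a (\<lambda>x. u x - pu x) q = 0" using P[OF u] by blast
  \<comment> \<open>A Gram-Schmidt step: c is the part of b orthogonal to V, and the projection onto
    the enlarged space adds s times c to \<open>pu\<close>.\<close>
  define c where "c x = b x - pb x" for x
  have L: "pb \<in> L2 a" "pu \<in> L2 a" "c \<in> L2 a" using pb pu V(1) L2_diff[OF b, of pb] by (auto simp: c_def[abs_def])
  \<comment> \<open>If c has norm zero, Cauchy-Schwarz makes r orthogonal to c whatever s is, so 0
    will do.\<close>
  define s where "s = (if ip a c c = 0 then 0 else ip a u c / ip a c c)"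
  define p where "p x = pu x + of_real (- s) * pb x" for x
  have p: "p \<in> V" unfolding p_def[abs_def] by (rule V(2)[OF pu(1) pb(1)])
  define r where "r x = u x - pu x - of_real s * c x" for x
  have r: "r \<in> L2 a" unfolding r_def[abs_def] by (intro L2_diff L2_cmult u L)
  have rq: "ip a r q = 0" if "q \<in> V" for q
  proof -
    have q: "q \<in> L2 a" using that V(1) by auto
    have "ip a c q = 0" using pb(2)[OF that] by (simp add: c_def[abs_def])
    moreover have "ip a r q = ip a (\<lambda>x. u x - pu x) q - s * ip a c q"
      unfolding r_def[abs_def] ip_cmult[symmetric] by (intro ip_diff L2_diff L2_cmult u L q)
    ultimately show ?thesis using pu(2)[OF that] by simp
  qed
  have puc: "ip a pu c = 0" using pb(2)[OF pu(1)] by (simp add: c_def[abs_def] ip_commute)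
  have rc: "ip a r c = 0"
  proof (cases "ip a c c = 0")
    case True
    then have "\<bar>ip a r c\<bar> \<le> 0" using ip_Cauchy_Schwarz[OF r L(3)] by (simp add: L2_norm_ip)
    then show ?thesis by simp
  next
    case False
    have "ip a r c = ip a (\<lambda>x. u x - pu x) c - s * ip a c c"
      unfolding r_def[abs_def] ip_cmult[symmetric] by (intro ip_diff L2_diff L2_cmult u L)
    also have "ip a (\<lambda>x. u x - pu x) c = ip a u c" using ip_diff[OF u L(2,3)] puc by simp
    finally show ?thesis using False by (simp add: s_def)
  qed
  have "ip a (\<lambda>x. u x - (p x + of_real s * b x)) (\<lambda>x. q x + of_real t * b x) = 0" if q: "q \<in> V" for q t
  proof -
    have "ip a (\<lambda>x. u x - (p x + of_real s * b x)) (\<lambda>x. q x + of_real t * b x) = ip a r (\<lambda>x. (q x + of_real t * pb x) + of_real t * c x)"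
      by (rule arg_cong2[of _ _ _ _ "ip a"]) (auto simp: fun_eq_iff p_def r_def c_def algebra_simps)
    also have "\<dots> = ip a r (\<lambda>x. q x + of_real t * pb x) + t * ip a r c"
      by (simp only: ip_add_right[OF L2_add[OF subsetD[OF V(1) q] L2_cmult[OF L(1)]] L2_cmult[OF L(3)] r] ip_cmult_right)
    finally show ?thesis using rq[OF V(2)[OF q pb(1)]] rc by simp
  qed
  with p show ?thesis by blast
qed

lemma exists_projection:
  fixes u :: "real ^ 'n::finite \<Rightarrow> complex"
  assumes a: "a > -1" and u: "u \<in> L2 a"
  shows "\<exists>p\<in>polys_below N. \<forall>q\<in>polys_below N. ip a (\<lambda>x. u x - p x) q = 0"
proof -
  define W where "W A = {p. \<exists>c. p = (\<lambda>x::real^'n. \<Sum>\<gamma>\<in>A. c \<gamma> * complex_of_real (rmono \<gamma> x))}" for A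
  have WL: "W A \<subseteq> L2 a" for A
  proof
    fix p assume "p \<in> W A"
    moreover have "(\<lambda>x. complex_of_real (rmono \<gamma> x)) \<in> L2 a" for \<gamma> :: "'n multi_index"
      using polys_below_L2[OF a polys_below_rmono[of \<gamma> "Suc (mi_abs \<gamma>)" 1]] by simp
    ultimately show "p \<in> L2 a" unfolding W_def by (auto intro!: L2_sum L2_cmult)
  qed
  have Wadd: "(\<lambda>x. v x + c * w x) \<in> W A" if "v \<in> W A" "w \<in> W A" for v w c A
  proof -
    from that(1) obtain d where d: "v = (\<lambda>x. \<Sum>\<gamma>\<in>A. d \<gamma> * complex_of_real (rmono \<gamma> x))"
      unfolding W_def mem_Collect_eq ..
    from that(2) obtain e where e: "w = (\<lambda>x. \<Sum>\<gamma>\<in>A. e \<gamma> * complex_of_real (rmono \<gamma> x))"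
      unfolding W_def mem_Collect_eq ..
    show ?thesis unfolding d e unfolding W_def
      by (auto intro!: exI[of _ "\<lambda>\<gamma>. d \<gamma> + c * e \<gamma>"] simp: sum_distrib_left sum.distrib[symmetric] distrib_right mult.assoc)
  qed
  have "\<forall>u\<in>L2 a. \<exists>p\<in>W A. \<forall>q\<in>W A. ip a (\<lambda>x. u x - p x) q = 0" if "finite A" for A
    using that
  proof (induction A rule: finite_induct)
    case empty
    then show ?case by (auto simp: W_def)
  next
    case (insert \<gamma> A)
    \<comment> \<open>\<open>ip\<close> is only real bilinear, so a monomial contributes two real
      directions, itself and \<i> times itself, added one after the other by
      \<open>proj_step\<close>.\<close>
    let ?b = "\<lambda>x::real^'n. complex_of_real (rmono \<gamma> x)" and ?b' = "\<lambda>x::real^'n. \<i> * complex_of_real (rmono \<gamma> x)"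
    have bL: "?b \<in> L2 a" "?b' \<in> L2 a"
      using polys_below_L2[OF a polys_below_rmono[of \<gamma> "Suc (mi_abs \<gamma>)" 1]] L2_cmult by auto
    define V where "V = {\<lambda>x. p x + of_real s * ?b x | p s. p \<in> W A}"
    have Wadd': "(\<lambda>x. v x + of_real s * w x) \<in> W A" if "v \<in> W A" "w \<in> W A" for v w s
      by (rule Wadd[OF that])
    have V1: "V \<subseteq> L2 a" using WL bL unfolding V_def by (auto intro!: L2_add L2_cmult)
    have V2: "(\<lambda>x. v x + of_real s * w x) \<in> V" if vw: "v \<in> V" "w \<in> V" for v w s
    proof -
      obtain p t p' t' where "v = (\<lambda>x. p x + of_real t * ?b x)" "w = (\<lambda>x. p' x + of_real t' * ?b x)" "p \<in> W A" "p' \<in> W A"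
        using vw unfolding V_def by blast
      then show ?thesis unfolding V_def using Wadd[of p A p' "of_real s"]
        by (auto intro!: exI[of _ "\<lambda>x. p x + of_real s * p' x"] exI[of _ "t + s * t'"] simp: algebra_simps)
    qed
    have V3: "\<exists>p\<in>V. \<forall>q\<in>V. ip a (\<lambda>x. u x - p x) q = 0" if uL: "u \<in> L2 a" for u
    proof -
      obtain p s where "p \<in> W A" "\<And>q t. q \<in> W A \<Longrightarrow> ip a (\<lambda>x. u x - (p x + of_real s * ?b x)) (\<lambda>x. q x + of_real t * ?b x) = 0"
        using proj_step[OF WL[of A] Wadd' _ bL(1) uL] insert.IH by blast
      then show ?thesis unfolding V_def by (intro bexI[of _ "\<lambda>x. p x + of_real s * ?b x"]) auto
    qed
    have W_eq: "W (insert \<gamma> A) = {\<lambda>x. p x + of_real s * ?b' x | p s. p \<in> V}"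
    proof (intro set_eqI iffI)
      fix p assume "p \<in> W (insert \<gamma> A)"
      then obtain c where c: "p = (\<lambda>x. \<Sum>\<gamma>\<in>insert \<gamma> A. c \<gamma> * complex_of_real (rmono \<gamma> x))"
        unfolding W_def mem_Collect_eq ..
      define p0 where "p0 = (\<lambda>x::real^'n. \<Sum>\<gamma>\<in>A. c \<gamma> * complex_of_real (rmono \<gamma> x))"
      have "p0 \<in> W A" by (auto simp: W_def p0_def)
      then have "(\<lambda>x. p0 x + of_real (Re (c \<gamma>)) * ?b x) \<in> V" unfolding V_def by blast
      moreover have "p = (\<lambda>x. (p0 x + of_real (Re (c \<gamma>)) * ?b x) + of_real (Im (c \<gamma>)) * ?b' x)"
      proof
        fix x
        have "p x = p0 x + c \<gamma> * ?b x" using insert by (simp add: c p0_def)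
        also have "c \<gamma> = of_real (Re (c \<gamma>)) + \<i> * of_real (Im (c \<gamma>))" by (rule complex_eq)
        finally show "p x = (p0 x + of_real (Re (c \<gamma>)) * ?b x) + of_real (Im (c \<gamma>)) * ?b' x"
          by (simp add: algebra_simps)
      qed
      ultimately show "p \<in> {\<lambda>x. p x + of_real s * ?b' x | p s. p \<in> V}"
        unfolding mem_Collect_eq
        by (intro exI[of _ "\<lambda>x. p0 x + of_real (Re (c \<gamma>)) * ?b x"] exI[of _ "Im (c \<gamma>)"] conjI)
    next
      fix p assume "p \<in> {\<lambda>x. p x + of_real s * ?b' x | p s. p \<in> V}"
      then obtain p0 s t where p: "p0 \<in> W A" "p = (\<lambda>x. (p0 x + of_real s * ?b x) + of_real t * ?b' x)"
        unfolding V_def by blast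
      then obtain c where c: "p0 = (\<lambda>x. \<Sum>\<gamma>\<in>A. c \<gamma> * complex_of_real (rmono \<gamma> x))"
        unfolding W_def by blast
      have "p = (\<lambda>x. \<Sum>\<delta>\<in>insert \<gamma> A. (if \<delta> = \<gamma> then Complex s t else c \<delta>) * complex_of_real (rmono \<delta> x))"
      proof
        fix x
        have "(\<Sum>\<delta>\<in>A. (if \<delta> = \<gamma> then Complex s t else c \<delta>) * complex_of_real (rmono \<delta> x)) = p0 x"
          unfolding c using insert by (intro sum.cong) auto
        then show "p x = (\<Sum>\<delta>\<in>insert \<gamma> A. (if \<delta> = \<gamma> then Complex s t else c \<delta>) * complex_of_real (rmono \<delta> x))"
          using insert by (simp add: p(2) Complex_eq algebra_simps)
      qed
      then show "p \<in> W (insert \<gamma> A)" unfolding W_def mem_Collect_eq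
        by (intro exI[of _ "\<lambda>\<delta>. if \<delta> = \<gamma> then Complex s t else c \<delta>"])
    qed
    show ?case
    proof
      fix u :: "real ^ 'n \<Rightarrow> complex" assume "u \<in> L2 a"
      from proj_step[OF V1 V2 V3 bL(2) this] obtain p s where
        "p \<in> V" "\<And>q t. q \<in> V \<Longrightarrow> ip a (\<lambda>x. u x - (p x + of_real s * ?b' x)) (\<lambda>x. q x + of_real t * ?b' x) = 0"
        by blast
      then show "\<exists>p\<in>W (insert \<gamma> A). \<forall>q\<in>W (insert \<gamma> A). ip a (\<lambda>x. u x - p x) q = 0"
        unfolding W_eq by (intro bexI[of _ "\<lambda>x. p x + of_real s * ?b' x"]) auto
    qed
  qed
  from this[OF finite_mi_abs_less[of N]] u show ?thesis
    by (simp add: W_def polys_below_def)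
qed

lemma polys_below_line:
  assumes "p \<in> polys_below N"
  shows "\<exists>c. \<forall>t. p (t *\<^sub>R x) = (\<Sum>k\<le>N. c k * complex_of_real t ^ k)"
  using assms
proof (induction rule: polys_below_induct)
  case zero
  then show ?case by (intro exI[of _ "\<lambda>_. 0"]) simp
next
  case (add \<gamma> c p)
  then obtain d where d: "\<And>t. p (t *\<^sub>R x) = (\<Sum>k\<le>N. d k * complex_of_real t ^ k)" by blast
  have r: "rmono \<gamma> (t *\<^sub>R x) = t ^ mi_abs \<gamma> * rmono \<gamma> x" for t
    by (simp add: rmono_def mi_abs_def power_mult_distrib prod.distrib power_sum)
  have "c * complex_of_real (rmono \<gamma> (t *\<^sub>R x)) + p (t *\<^sub>R x)
     = (\<Sum>k\<le>N. (d k + (if k = mi_abs \<gamma> then c * of_real (rmono \<gamma> x) else 0)) * complex_of_real t ^ k)" for t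
    using add(1) by (simp add: d r distrib_right sum.distrib if_distrib[of "\<lambda>a. a * _"] sum.delta cong: if_cong)
  then show ?case
    by (intro exI[of _ "\<lambda>k. d k + (if k = mi_abs \<gamma> then c * of_real (rmono \<gamma> x) else 0)"] allI)
qed

text \<open>On a line through the origin the polynomial becomes univariate and vanishes for all
  small positive parameters, hence identically.\<close>

lemma polys_below_zero_on_ball:
  assumes p: "p \<in> polys_below N" and z: "\<And>x. norm x < 1 \<Longrightarrow> p x = 0"
  shows "p = (\<lambda>x. 0)"
proof
  fix x
  obtain c where c: "\<And>t. p (t *\<^sub>R x) = (\<Sum>k\<le>N. c k * complex_of_real t ^ k)" using polys_below_line[OF p] by blast
  define e where "e = 1 / (norm x + 1)"
  have e: "e > 0" by (simp add: e_def add_nonneg_pos)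
  have "(\<Sum>k\<le>N. c k * complex_of_real t ^ k) = 0" if "t \<in> {0<..<e}" for t
  proof -
    have "t * norm x < 1"
    proof -
      have "t * norm x \<le> t * (norm x + 1)" using that by simp
      also have "\<dots> < 1" using that by (simp add: e_def pos_less_divide_eq add_nonneg_pos)
      finally show ?thesis .
    qed
    then show ?thesis using z[of "t *\<^sub>R x"] that c[of t] by simp
  qed
  then have "of_real ` {0<..<e} \<subseteq> {z. (\<Sum>k\<le>N. c k * z ^ k) = 0}" by auto
  moreover have "infinite (complex_of_real ` {0<..<e})"
    using e by (subst finite_image_iff) (auto simp: inj_on_def)
  ultimately have "infinite {z. (\<Sum>k\<le>N. c k * z ^ k) = 0}" using finite_subset by blast
  then have "\<forall>k\<le>N. c k = 0" by (simp add: polyfun_finite_roots)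
  then show "p x = 0" using c[of 1] by simp
qed

text \<open>On arbitrary functions \<open>ip\<close> is only semidefinite. A polynomial, however, is
  nonzero in the ball on an open set, and an open null set is empty.\<close>

lemma polys_below_ip_zero:
  assumes a: "a > -1" and p: "p \<in> polys_below N" and z: "ip a p p = 0"
  shows "p = (\<lambda>x. 0)"
proof (rule polys_below_zero_on_ball[OF p])
  have "integrable lball (\<lambda>x. (p x \<bullet> p x) * weight a x)" by (intro ip_integrable polys_below_L2[OF a p])
  then have "AE x in lball. (p x \<bullet> p x) * weight a x = 0"
    using z unfolding ip_def by (subst (asm) integral_nonneg_eq_0_iff_AE) (auto intro: AE_I2)
  then have "AE x in lball. p x = 0"
  proof (rule AE_mp, intro AE_I2 impI)
    fix x :: "real ^ 'a" assume "x \<in> space lball" "(p x \<bullet> p x) * weight a x = 0"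
    moreover from this have "weight a x > 0" using abs_square_less_1[of "norm x"] by (simp add: weight_def)
    ultimately show "p x = 0" by simp
  qed
  then have "AE x in lebesgue. x \<in> ball 0 1 \<longrightarrow> p x = 0" by (subst (asm) AE_restrict_space_iff) auto
  then obtain Z where "{x \<in> space lebesgue. \<not> (x \<in> ball 0 1 \<longrightarrow> p x = 0)} \<subseteq> Z" "Z \<in> null_sets lebesgue"
    unfolding eventually_ae_filter by blast
  then have "negligible {x. \<not> (x \<in> ball 0 1 \<longrightarrow> p x = 0)}"
    using negligible_subset[of Z] by (simp add: negligible_iff_null_sets)
  moreover have "open {x. \<not> (x \<in> ball 0 1 \<longrightarrow> p x = 0)}"
  proof -
    have "{x. \<not> (x \<in> ball 0 1 \<longrightarrow> p x = 0)} = ball 0 1 \<inter> {x. p x \<noteq> 0}" by auto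
    moreover have "open {x. p x \<noteq> 0}" by (intro open_Collect_neq polys_below_continuous[OF p] continuous_intros)
    ultimately show ?thesis by (simp only: open_Int open_ball)
  qed
  ultimately have "{x. \<not> (x \<in> ball 0 1 \<longrightarrow> p x = 0)} = {}" using open_not_negligible by blast
  then show "p x = 0" if "norm x < 1" for x using that by auto
qed

text \<open>The projection for the real form \<open>ip\<close> and a strict degree bound;
  \<open>ortho_proj_eq\<close> identifies \<open>proj a (Suc N)\<close> with
  \<open>ortho_proj a N\<close> on \<open>L2 a\<close>.\<close>

definition proj :: "real \<Rightarrow> nat \<Rightarrow> (real ^ 'n::finite \<Rightarrow> complex) \<Rightarrow> real ^ 'n \<Rightarrow> complex" where
  "proj a N u = (SOME p. p \<in> polys_below N \<and> (\<forall>q\<in>polys_below N. ip a (\<lambda>x. u x - p x) q = 0))"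

lemma
  assumes "a > -1" "u \<in> L2 a"
  shows proj_in: "proj a N u \<in> polys_below N"
    and proj_orth: "q \<in> polys_below N \<Longrightarrow> ip a (\<lambda>x. u x - proj a N u x) q = 0"
proof -
  have "\<exists>p. p \<in> polys_below N \<and> (\<forall>q\<in>polys_below N. ip a (\<lambda>x. u x - p x) q = 0)"
    using exists_projection[OF assms, of N] by (simp only: Bex_def)
  then have *: "proj a N u \<in> polys_below N \<and> (\<forall>q\<in>polys_below N. ip a (\<lambda>x. u x - proj a N u x) q = 0)"
    unfolding proj_def by (rule someI_ex)
  show "proj a N u \<in> polys_below N" by (rule conjunct1[OF *])
  show "q \<in> polys_below N \<Longrightarrow> ip a (\<lambda>x. u x - proj a N u x) q = 0" by (rule bspec[OF conjunct2[OF *]])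
qed

lemma proj_L2: "a > -1 \<Longrightarrow> u \<in> L2 a \<Longrightarrow> proj a N u \<in> L2 a"
  using polys_below_L2 proj_in by blast

lemma proj_unique:
  assumes a: "a > -1" and u: "u \<in> L2 a" and p: "p \<in> polys_below N" and orth: "\<And>q. q \<in> polys_below N \<Longrightarrow> ip a (\<lambda>x. u x - p x) q = 0"
  shows "proj a N u = p"
proof -
  define d where "d x = proj a N u x - p x" for x
  have d: "d \<in> polys_below N" unfolding d_def[abs_def] by (intro polys_below_diff proj_in a u p)
  have L: "d \<in> L2 a" "p \<in> L2 a" "proj a N u \<in> L2 a" using polys_below_L2[OF a] d p proj_L2[OF a u] by auto
  have "ip a (\<lambda>x. (u x - p x) - (u x - proj a N u x)) d = ip a (\<lambda>x. u x - p x) d - ip a (\<lambda>x. u x - proj a N u x) d"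
    by (rule ip_diff[OF L2_diff[OF u L(2)] L2_diff[OF u L(3)] L(1)])
  also have "(\<lambda>x. (u x - p x) - (u x - proj a N u x)) = d" by (simp add: d_def fun_eq_iff)
  finally have "ip a d d = ip a (\<lambda>x. u x - p x) d - ip a (\<lambda>x. u x - proj a N u x) d" .
  then have "ip a d d = 0" using orth[OF d] proj_orth[OF a u d] by simp
  from polys_below_ip_zero[OF a d this] show ?thesis by (simp add: d_def fun_eq_iff)
qed

text \<open>The imaginary part of \<open>L2_inner\<close> against q is \<open>ip\<close> against
  \<i> q, and \<open>polys_below\<close> is closed under multiplication by \<i>.\<close>

lemma L2_inner_eq_zero_iff:
  fixes u :: "real ^ 'a::finite \<Rightarrow> complex"
  assumes a: "a > -1" and u: "u \<in> L2 a"
  shows "(\<forall>q\<in>polys_below N. L2_inner a u q = 0) \<longleftrightarrow> (\<forall>q\<in>polys_below N. ip a u q = 0)"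
proof -
  have int: "integrable lball (\<lambda>x. u x * cnj (q x) * of_real (weight a x))" if q: "q \<in> L2 a" for q
  proof (rule Bochner_Integration.integrable_bound)
    show "integrable lball (\<lambda>x. (cmod (u x))\<^sup>2 * weight a x + (cmod (q x))\<^sup>2 * weight a x)"
      using u q by (intro Bochner_Integration.integrable_add) (auto simp: L2_iff)
    show "(\<lambda>x. u x * cnj (q x) * of_real (weight a x)) \<in> borel_measurable lball"
    proof -
      have [measurable]: "(\<lambda>x. cnj (q x)) \<in> borel_measurable lball"
        by (rule borel_measurable_continuous_on[OF _ L2_measurable[OF q]]) (intro continuous_intros)
      show ?thesis using L2_measurable[OF u] weight_measurable by measurable
    qed
    show "AE x in lball. norm (u x * cnj (q x) * of_real (weight a x)) \<le> norm ((cmod (u x))\<^sup>2 * weight a x + (cmod (q x))\<^sup>2 * weight a x)"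
    proof (rule AE_I2)
      fix x
      have "cmod (u x) * cmod (q x) \<le> 2 * cmod (u x) * cmod (q x)" by simp
      also have "\<dots> \<le> (cmod (u x))\<^sup>2 + (cmod (q x))\<^sup>2" by (rule sum_squares_bound)
      finally have "cmod (u x) * cmod (q x) * weight a x \<le> ((cmod (u x))\<^sup>2 + (cmod (q x))\<^sup>2) * weight a x"
        by (rule mult_right_mono) simp
      then show "norm (u x * cnj (q x) * of_real (weight a x)) \<le> norm ((cmod (u x))\<^sup>2 * weight a x + (cmod (q x))\<^sup>2 * weight a x)"
        by (simp add: norm_mult distrib_right)
    qed
  qed
  have re: "Re (L2_inner a u q) = ip a u q" if q: "q \<in> L2 a" for q
    unfolding L2_inner_def ip_def using integral_Re[OF int[OF q]] by (simp add: inner_complex_def)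
  have im: "Im (L2_inner a u q) = ip a u (\<lambda>x. \<i> * q x)" if q: "q \<in> L2 a" for q
    unfolding L2_inner_def ip_def using integral_Im[OF int[OF q]] by (simp add: inner_complex_def algebra_simps)
  have L: "q \<in> L2 a" "(\<lambda>x. \<i> * q x) \<in> polys_below N" if "q \<in> polys_below N" for q :: "real ^ 'a \<Rightarrow> complex"
    using that by (auto intro: polys_below_L2[OF a] polys_below_cmult)
  show ?thesis
  proof (intro iffI ballI)
    fix q :: "real ^ 'a \<Rightarrow> complex" assume *: "\<forall>q\<in>polys_below N. L2_inner a u q = 0" "q \<in> polys_below N"
    then show "ip a u q = 0" using re[OF L(1)[OF *(2)]] by simp
  next
    fix q :: "real ^ 'a \<Rightarrow> complex" assume *: "\<forall>q\<in>polys_below N. ip a u q = 0" "q \<in> polys_below N"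
    then show "L2_inner a u q = 0"
      using re[OF L(1)[OF *(2)]] im[OF L(1)[OF *(2)]] L(2)[OF *(2)] by (simp add: complex_eq_iff)
  qed
qed

lemma ortho_proj_eq:
  assumes a: "a > -1" and u: "u \<in> L2 a"
  shows "ortho_proj a N u = proj a (Suc N) u"
  unfolding ortho_proj_def polys_eq_below
proof (rule the_equality)
  have L: "(\<lambda>x. u x - p x) \<in> L2 a" if "p \<in> polys_below (Suc N)" for p
    by (intro L2_diff u polys_below_L2[OF a that])
  show "proj a (Suc N) u \<in> polys_below (Suc N) \<and> (\<forall>q\<in>polys_below (Suc N). L2_inner a (\<lambda>x. u x - proj a (Suc N) u x) q = 0)"
    using proj_in[OF a u] proj_orth[OF a u] L2_inner_eq_zero_iff[OF a L[OF proj_in[OF a u]]] by blast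
  fix p assume "p \<in> polys_below (Suc N) \<and> (\<forall>q\<in>polys_below (Suc N). L2_inner a (\<lambda>x. u x - p x) q = 0)"
  then show "p = proj a (Suc N) u"
    using proj_unique[OF a u, of p "Suc N"] L2_inner_eq_zero_iff[OF a L, of p "Suc N"] by auto
qed

lemma proj_best:
  assumes a: "a > -1" and u: "u \<in> L2 a" and q: "q \<in> polys_below N"
  shows "L2_norm a (\<lambda>x. u x - proj a N u x) \<le> L2_norm a (\<lambda>x. u x - q x)"
proof -
  let ?p = "proj a N u"
  have pq: "(\<lambda>x. ?p x - q x) \<in> polys_below N" by (intro polys_below_diff proj_in a u q)
  have L: "(\<lambda>x. u x - ?p x) \<in> L2 a" "(\<lambda>x. ?p x - q x) \<in> L2 a"
    by (intro L2_diff u proj_L2[OF a u] polys_below_L2[OF a q])+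
  have "ip a (\<lambda>x. (u x - ?p x) + (?p x - q x)) (\<lambda>x. (u x - ?p x) + (?p x - q x))
    = ip a (\<lambda>x. u x - ?p x) (\<lambda>x. u x - ?p x) + ip a (\<lambda>x. ?p x - q x) (\<lambda>x. ?p x - q x)"
    using ip_sq_add[OF L] proj_orth[OF a u pq] by simp
  then have "ip a (\<lambda>x. u x - ?p x) (\<lambda>x. u x - ?p x) \<le> ip a (\<lambda>x. u x - q x) (\<lambda>x. u x - q x)"
    using ip_nonneg[of a "\<lambda>x. ?p x - q x"] by simp
  then show ?thesis by (simp add: L2_norm_ip)
qed

lemma proj_pythagoras:
  assumes a: "a > -1" and u: "u \<in> L2 a"
  shows "ip a u u = ip a (\<lambda>x. u x - proj a N u x) (\<lambda>x. u x - proj a N u x) + ip a (proj a N u) (proj a N u)"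
  using ip_sq_add[OF L2_diff[OF u proj_L2[OF a u]] proj_L2[OF a u], of N N] proj_orth[OF a u proj_in[OF a u]] by simp

lemma proj_norm_le:
  assumes "a > -1" "u \<in> L2 a"
  shows "L2_norm a (proj a N u) \<le> L2_norm a u" "L2_norm a (\<lambda>x. u x - proj a N u x) \<le> L2_norm a u"
  using proj_pythagoras[OF assms, of N] ip_nonneg[of a "proj a N u"] ip_nonneg[of a "\<lambda>x. u x - proj a N u x"]
  by (simp_all add: L2_norm_ip)

section \<open>The spectral gap\<close>

text \<open>On gradients, \<open>gform\<close> is the energy form of the self-adjoint operator \<open>- sturm a\<close>.\<close>

definition radial :: "('n::finite \<Rightarrow> real ^ 'n \<Rightarrow> complex) \<Rightarrow> real ^ 'n \<Rightarrow> complex" where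
  "radial F x = (\<Sum>i\<in>UNIV. of_real (x $ i) * F i x)"

definition gform :: "real \<Rightarrow> ('n::finite \<Rightarrow> real ^ 'n \<Rightarrow> complex) \<Rightarrow> ('n \<Rightarrow> real ^ 'n \<Rightarrow> complex) \<Rightarrow> real" where
  "gform a F G = (\<Sum>i\<in>UNIV. ip a (F i) (G i)) - ip a (radial F) (radial G)"

lemma euler_radial: "euler p = radial (\<lambda>i. pd i p)"
  by (simp add: fun_eq_iff euler_def radial_def)

lemma radial_L2: "(\<And>i. F i \<in> L2 a) \<Longrightarrow> radial F \<in> L2 a"
  unfolding radial_def[abs_def] by (intro L2_sum L2_coord)

lemma radial_polys_below: "(\<And>i. F i \<in> polys_below N) \<Longrightarrow> radial F \<in> polys_below (Suc N)"
  unfolding radial_def[abs_def] by (intro polys_below_sum polys_below_coord)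

lemma ip_radial:
  assumes "\<And>i. F i \<in> L2 a" "w \<in> L2 a"
  shows "ip a (radial F) w = (\<Sum>i\<in>UNIV. ip a (F i) (\<lambda>x. of_real (x $ i) * w x))"
  unfolding radial_def[abs_def]
  by (subst ip_sum) (auto intro: L2_coord assms simp: ip_move)

lemma gform_commute: "gform a F G = gform a G F"
  by (simp add: gform_def ip_commute)

lemma gform_diff_left:
  assumes "\<And>i. F i \<in> L2 a" "\<And>i. G i \<in> L2 a" "\<And>i. H i \<in> L2 a"
  shows "gform a (\<lambda>i x. F i x - G i x) H = gform a F H - gform a G H"
proof -
  have "radial (\<lambda>i x. F i x - G i x) = (\<lambda>x. radial F x - radial G x)"
    by (simp add: fun_eq_iff radial_def right_diff_distrib sum_subtractf)
  then show ?thesis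
    using assms by (simp add: gform_def ip_diff radial_L2 sum_subtractf)
qed

lemma gform_diff_right:
  assumes "\<And>i. F i \<in> L2 a" "\<And>i. G i \<in> L2 a" "\<And>i. H i \<in> L2 a"
  shows "gform a H (\<lambda>i x. F i x - G i x) = gform a H F - gform a H G"
  using gform_diff_left[OF assms] by (simp add: gform_commute)

lemma norm_radial_le: "(cmod (radial F x))\<^sup>2 \<le> (norm x)\<^sup>2 * (\<Sum>i\<in>UNIV. (cmod (F i x))\<^sup>2)"
proof -
  have "cmod (radial F x) \<le> (\<Sum>i\<in>UNIV. \<bar>x $ i\<bar> * \<bar>cmod (F i x)\<bar>)"
    unfolding radial_def by (intro sum_norm_le) (simp add: norm_mult)
  also have "\<dots> \<le> L2_set (\<lambda>i. x $ i) UNIV * L2_set (\<lambda>i. cmod (F i x)) UNIV"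
    by (rule L2_set_mult_ineq)
  finally have "(cmod (radial F x))\<^sup>2 \<le> (L2_set (\<lambda>i. x $ i) UNIV * L2_set (\<lambda>i. cmod (F i x)) UNIV)\<^sup>2"
    by (intro power_mono) auto
  also have "\<dots> = (norm x)\<^sup>2 * (\<Sum>i\<in>UNIV. (cmod (F i x))\<^sup>2)"
    by (simp add: power_mult_distrib L2_set_def norm_sq_vec sum_nonneg)
  finally show ?thesis .
qed

text \<open>Pointwise |x . F|^2 is at most |x|^2 |F|^2, so at least (1 - |x|^2) |F|^2 survives the
  subtraction, and the factor 1 - |x|^2 raises the exponent by one.\<close>

lemma gform_lower:
  assumes F: "\<And>i. F i \<in> L2 a"
  shows "(\<Sum>i\<in>UNIV. ip (a + 1) (F i) (F i)) \<le> gform a F F"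
proof -
  have "(\<Sum>i\<in>UNIV. ip (a + 1) (F i) (F i)) + ip a (radial F) (radial F)
      = (LINT x|lball. (\<Sum>i\<in>UNIV. (F i x \<bullet> F i x) * weight (a + 1) x) + (radial F x \<bullet> radial F x) * weight a x)"
    unfolding ip_def
    by (subst Bochner_Integration.integral_add)
      (auto intro!: Bochner_Integration.integrable_sum ip_integrable L2_mono F radial_L2 Bochner_Integration.integral_sum[symmetric])
  also have "\<dots> \<le> (LINT x|lball. (\<Sum>i\<in>UNIV. (F i x \<bullet> F i x) * weight a x))"
  proof (rule integral_mono)
    fix x :: "real ^ 'a" assume "x \<in> space lball"
    then have x: "norm x < 1" by simp
    have "(radial F x \<bullet> radial F x) * weight a x \<le> (norm x)\<^sup>2 * (\<Sum>i\<in>UNIV. F i x \<bullet> F i x) * weight a x"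
      using norm_radial_le[of F x] by (intro mult_right_mono) (simp_all add: power2_norm_eq_inner)
    then show "(\<Sum>i\<in>UNIV. (F i x \<bullet> F i x) * weight (a + 1) x) + (radial F x \<bullet> radial F x) * weight a x
      \<le> (\<Sum>i\<in>UNIV. (F i x \<bullet> F i x) * weight a x)"
      unfolding weight_Suc[OF x] sum_distrib_right[symmetric] by (simp add: algebra_simps)
  qed (intro Bochner_Integration.integrable_add Bochner_Integration.integrable_sum ip_integrable L2_mono F radial_L2)+
  also have "\<dots> = (\<Sum>i\<in>UNIV. ip a (F i) (F i))"
    unfolding ip_def by (intro Bochner_Integration.integral_sum ip_integrable F)
  finally show ?thesis by (simp add: gform_def)
qed

lemma gform_nonneg: "(\<And>i. F i \<in> L2 a) \<Longrightarrow> 0 \<le> gform a F F"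
  using gform_lower[of F a] sum_nonneg[of UNIV "\<lambda>i. ip (a + 1) (F i) (F i)"] by (simp add: ip_nonneg)

lemma gform_upper: "gform a F F \<le> (\<Sum>i\<in>UNIV. ip a (F i) (F i))"
  by (simp add: gform_def ip_nonneg)

lemma pd_L2: "a > -1 \<Longrightarrow> p \<in> polys_below N \<Longrightarrow> pd i p \<in> L2 a"
  using polys_below_L2 pd_polys_below by blast

text \<open>The field G - x (x . G) is tangent: its product with x is (1 - |x|^2) (x . G). Pairing
  it with v reproduces \<open>gform\<close>, because the part x (x . G) pairs x . v with x .
  G.\<close>

lemma gform_weak_divergence:
  assumes a: "a > -1" and u: "u \<in> L2 a" and v: "\<And>i. v i \<in> L2 a" and uv: "\<And>i. wpd i u (v i)"
    and G: "\<And>i. G i \<in> polys_below N"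
  shows "gform a v G = - ip a u (\<lambda>x. (\<Sum>i\<in>UNIV. pd i (\<lambda>x. G i x - of_real (x $ i) * radial G x) x) - of_real (2 * a) * radial G x)"
proof -
  define X where "X i = (\<lambda>x. G i x - of_real (x $ i) * radial G x)" for i
  have R: "radial G \<in> polys_below (Suc N)" by (rule radial_polys_below[OF G])
  have X: "X i \<in> polys_below (Suc (Suc N))" for i
    unfolding X_def by (intro polys_below_diff polys_below_coord R polys_below_Suc G)
  have tan: "(\<Sum>i\<in>UNIV. of_real (x $ i) * X i x) = of_real (1 - (norm x)\<^sup>2) * radial G x" for x
  proof -
    have "(\<Sum>i\<in>UNIV. of_real (x $ i) * X i x) = radial G x - (\<Sum>i\<in>UNIV. of_real ((x $ i)\<^sup>2)) * radial G x"
      by (simp add: X_def right_diff_distrib sum_subtractf radial_def[of G x] sum_distrib_right power2_eq_square mult.assoc)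
    then show ?thesis by (simp add: norm_sq_vec algebra_simps)
  qed
  have "(\<Sum>i\<in>UNIV. ip a (v i) (X i)) = - ip a u (\<lambda>x. (\<Sum>i\<in>UNIV. pd i (X i) x) - of_real (2 * a) * radial G x)"
    by (rule weak_divergence_theorem[OF a u v uv X R tan])
  moreover have "(\<Sum>i\<in>UNIV. ip a (v i) (X i)) = gform a v G"
  proof -
    have RL: "radial G \<in> L2 a" by (rule polys_below_L2[OF a R])
    have "ip a (v i) (X i) = ip a (v i) (G i) - ip a (v i) (\<lambda>x. of_real (x $ i) * radial G x)" for i
      unfolding X_def by (intro ip_diff_right v polys_below_L2[OF a G] L2_coord RL)
    then show ?thesis
      by (simp add: gform_def sum_subtractf ip_radial[OF v RL])
  qed
  ultimately show ?thesis by (simp add: X_def)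
qed

lemma gform_sturm:
  assumes "a > -1" "u \<in> L2 a" "\<And>i. v i \<in> L2 a" "\<And>i. wpd i u (v i)" and p: "p \<in> polys_below N"
  shows "gform a v (\<lambda>i. pd i p) = - ip a u (sturm a p)"
  using gform_weak_divergence[OF assms(1-4) pd_polys_below[OF p]]
  by (simp add: sturm_def[abs_def] euler_radial)

section \<open>Eigenvalue bounds for \<open>sturm\<close> on polynomials\<close>

lemma sturm_symmetric:
  assumes a: "a > -1" and p: "p \<in> polys_below N" and q: "q \<in> polys_below M"
  shows "ip a p (sturm a q) = ip a q (sturm a p)"
  using gform_sturm[OF a polys_below_L2[OF a p] pd_L2[OF a p] polys_below_wpd[OF p] q]
    gform_sturm[OF a polys_below_L2[OF a q] pd_L2[OF a q] polys_below_wpd[OF q] p]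
    gform_commute[of a "\<lambda>i. pd i p" "\<lambda>i. pd i q"] by simp

text \<open>The remainder r left by \<open>sturm_top\<close> has degree below k, so it is orthogonal
  to p. By symmetry it is also orthogonal to \<open>sturm a p\<close>, since
  \<open>sturm a r\<close> has degree below k too; hence r is orthogonal to itself.\<close>

lemma sturm_eigen:
  fixes p :: "real ^ 'n::finite \<Rightarrow> complex"
  assumes a: "a > -1" and p: "p \<in> polys_below (Suc k)" and orth: "\<And>q. q \<in> polys_below k \<Longrightarrow> ip a p q = 0"
  shows "sturm a p = (\<lambda>x. of_real (- eigval TYPE('n) a k) * p x)"
proof -
  define r where "r x = sturm a p x + of_real (eigval TYPE('n) a k) * p x" for x
  have r: "r \<in> polys_below k" unfolding r_def[abs_def] by (rule sturm_top[OF p])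
  have L: "sturm a p \<in> L2 a" "p \<in> L2 a" "r \<in> L2 a"
    using polys_below_L2[OF a] sturm_polys_below[OF p] p r by auto
  have "ip a r r = ip a (sturm a p) r + eigval TYPE('n) a k * ip a p r"
    unfolding ip_cmult[symmetric] by (subst (1) r_def[abs_def]) (intro ip_add L L2_cmult)
  also have "ip a (sturm a p) r = ip a p (sturm a r)"
    using sturm_symmetric[OF a r p] by (simp add: ip_commute)
  also have "\<dots> = 0" by (rule orth[OF sturm_polys_below[OF r]])
  finally have "ip a r r = 0" using orth[OF r] by simp
  from fun_cong[OF polys_below_ip_zero[OF a r this]]
  show ?thesis by (auto simp: r_def fun_eq_iff eq_neg_iff_add_eq_0)
qed

text \<open>Because k + d is at least 2 and 2 a > -2. In degree 0 the factor can be negative, for d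
  = 1 and a < -1/2, so \<open>eigval_mono\<close> starts at degree 1.\<close>

lemma eigval_factor_pos:
  assumes "a > -1" "1 \<le> k"
  shows "0 < real k + real CARD('n::finite) + 2 * a"
proof -
  have "real CARD('n) \<ge> 1" by (simp add: Suc_leI)
  with assms show ?thesis by linarith
qed

lemma eigval_pos: "a > -1 \<Longrightarrow> 1 \<le> k \<Longrightarrow> 0 < eigval TYPE('n::finite) a k"
  unfolding eigval_def using eigval_factor_pos[of a k, where 'n = 'n] by (intro mult_pos_pos) auto

lemma eigval_mono:
  assumes "a > -1" "1 \<le> j" "j \<le> k"
  shows "eigval TYPE('n::finite) a j \<le> eigval TYPE('n) a k"
  unfolding eigval_def using assms eigval_factor_pos[OF assms(1,2), where 'n = 'n]
  by (intro mult_mono) linarith+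

text \<open>The top part \<pi> is an eigenfunction, orthogonal to p' and to
  \<open>sturm a p'\<close>, so the mixed terms vanish. Splitting off one degree at a time takes the
  place of a full eigenfunction expansion.\<close>

lemma sturm_split:
  fixes p :: "real ^ 'n::finite \<Rightarrow> complex"
  assumes a: "a > -1" and p: "p \<in> polys_below (Suc k)"
  defines "p' \<equiv> proj a k p"
  defines "\<pi> \<equiv> \<lambda>x. p x - p' x"
  shows "ip a p (sturm a p) = ip a p' (sturm a p') - eigval TYPE('n) a k * ip a \<pi> \<pi>"
    and "ip a p p = ip a p' p' + ip a \<pi> \<pi>"
proof -
  have pL: "p \<in> L2 a" by (rule polys_below_L2[OF a p])
  have p': "p' \<in> polys_below k" unfolding p'_def by (rule proj_in[OF a pL])
  have \<pi>: "\<pi> \<in> polys_below (Suc k)" unfolding \<pi>_def by (intro polys_below_diff p polys_below_Suc p')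
  have orth: "ip a \<pi> q = 0" if "q \<in> polys_below k" for q
    unfolding \<pi>_def p'_def by (rule proj_orth[OF a pL that])
  have s\<pi>: "sturm a \<pi> = (\<lambda>x. of_real (- eigval TYPE('n) a k) * \<pi> x)"
    by (rule sturm_eigen[OF a \<pi> orth])
  have L: "p' \<in> L2 a" "\<pi> \<in> L2 a" "sturm a p \<in> L2 a" "sturm a p' \<in> L2 a" "sturm a \<pi> \<in> L2 a"
    using polys_below_L2[OF a] p' \<pi> sturm_polys_below p by blast+
  have pe: "p = (\<lambda>x. p' x + \<pi> x)" by (simp add: \<pi>_def)
  have "ip a p (sturm a p) = ip a p' (sturm a p) + ip a \<pi> (sturm a p)"
    by (subst (1) pe) (intro ip_add L)
  also have "ip a p' (sturm a p) = ip a p' (sturm a p') + ip a \<pi> (sturm a p')"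
    using sturm_symmetric[OF a p' p] ip_add[OF L(1,2,4)] pe by simp
  also have "ip a \<pi> (sturm a p') = 0" by (rule orth[OF sturm_polys_below[OF p']])
  also have "ip a \<pi> (sturm a p) = ip a p (sturm a \<pi>)" by (rule sturm_symmetric[OF a \<pi> p])
  also have "\<dots> = - eigval TYPE('n) a k * ip a p \<pi>" unfolding s\<pi> by (rule ip_cmult_right)
  also have "ip a p \<pi> = ip a p' \<pi> + ip a \<pi> \<pi>" by (subst (1) pe) (intro ip_add L)
  also have "ip a p' \<pi> = 0" using orth[OF p'] by (simp add: ip_commute)
  finally show "ip a p (sturm a p) = ip a p' (sturm a p') - eigval TYPE('n) a k * ip a \<pi> \<pi>" by simp
  show "ip a p p = ip a p' p' + ip a \<pi> \<pi>"
    using proj_pythagoras[OF a pL, of k] by (simp add: \<pi>_def p'_def)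
qed

text \<open>Induction splits off the top degree as long as it exceeds N, where the eigenvalue is at
  least that of degree N + 1; once the degree is at most N, p is orthogonal to itself.\<close>

lemma sturm_lower:
  fixes p :: "real ^ 'n::finite \<Rightarrow> complex"
  assumes a: "a > -1" and "p \<in> polys_below M" and "\<And>q. q \<in> polys_below (Suc N) \<Longrightarrow> ip a p q = 0"
  shows "eigval TYPE('n) a (Suc N) * ip a p p \<le> - ip a p (sturm a p)"
  using assms(2,3)
proof (induction M arbitrary: p)
  case 0
  then show ?case by simp
next
  case (Suc k)
  have pL: "p \<in> L2 a" by (rule polys_below_L2[OF a Suc.prems(1)])
  show ?case
  proof (cases "k \<le> N")
    case True
    then have "p \<in> polys_below (Suc N)" using Suc.prems(1) polys_below_mono[of "Suc k" "Suc N"] by auto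
    then have "ip a p p = 0" by (rule Suc.prems(2))
    with polys_below_ip_zero[OF a Suc.prems(1)] have "p = (\<lambda>x. 0)" by blast
    then show ?thesis by simp
  next
    case False
    let ?p = "proj a k p" and ?r = "\<lambda>x. p x - proj a k p x"
    have IH: "eigval TYPE('n) a (Suc N) * ip a ?p ?p \<le> - ip a ?p (sturm a ?p)"
    proof (rule Suc.IH[OF proj_in[OF a pL]])
      fix q :: "real ^ 'n \<Rightarrow> complex" assume q: "q \<in> polys_below (Suc N)"
      then have qk: "q \<in> polys_below k" using False polys_below_mono[of "Suc N" k] by auto
      have "ip a ?r q = ip a p q - ip a ?p q"
        by (intro ip_diff pL proj_L2[OF a pL] polys_below_L2[OF a q])
      then show "ip a ?p q = 0" using proj_orth[OF a pL qk] Suc.prems(2)[OF q] by simp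
    qed
    have "eigval TYPE('n) a (Suc N) * ip a ?r ?r \<le> eigval TYPE('n) a k * ip a ?r ?r"
      using False by (intro mult_right_mono eigval_mono a ip_nonneg) auto
    then show ?thesis
      using IH sturm_split[OF a Suc.prems(1)] by (simp add: distrib_left)
  qed
qed

lemma sturm_upper:
  fixes p :: "real ^ 'n::finite \<Rightarrow> complex"
  assumes a: "a > -1" and "p \<in> polys_below (Suc N)"
  shows "- ip a p (sturm a p) \<le> eigval TYPE('n) a N * ip a p p"
  using assms(2)
proof (induction N arbitrary: p)
  case 0
  then show ?case using sturm_split(1)[OF a, of p 0] proj_in[OF a polys_below_L2[OF a 0], of 0]
    by (simp add: eigval_def)
next
  case (Suc k)
  have pL: "p \<in> L2 a" by (rule polys_below_L2[OF a Suc.prems])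
  let ?p = "proj a (Suc k) p"
  have "- ip a ?p (sturm a ?p) \<le> eigval TYPE('n) a k * ip a ?p ?p"
    by (rule Suc.IH[OF proj_in[OF a pL]])
  also have "\<dots> \<le> eigval TYPE('n) a (Suc k) * ip a ?p ?p"
  \<comment> \<open>\<open>eigval_mono\<close> starts at degree 1; in degree 0 the eigenvalue is 0,
    below the positive next one.\<close>
  proof (cases k)
    case 0
    have "0 \<le> eigval TYPE('n) a (Suc k)"
      using eigval_pos[OF a, of "Suc k", where 'n = 'n] by simp
    then show ?thesis using 0 by (simp add: eigval_def ip_nonneg)
  qed (intro mult_right_mono eigval_mono a ip_nonneg; simp)
  finally show ?case
    using sturm_split[OF a Suc.prems] by (simp add: distrib_left)
qed

lemma proj_tendsto:
  assumes a: "a > -1" and u: "u \<in> L2 a" and e: "e > 0"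
  shows "\<exists>M\<ge>N. L2_norm a (\<lambda>x. u x - proj a M u x) < e"
proof -
  obtain p K where p: "p \<in> polys_below K" "L2_norm a (\<lambda>x. u x - p x) < e"
    by (rule polys_dense[OF a u e]) (rule that)
  have "p \<in> polys_below (max N K)" using p(1) by (rule polys_below_max(2))
  from proj_best[OF a u this] p(2) show ?thesis
    by (intro exI[of _ "max N K"]) simp
qed

lemma proj_of_orth:
  assumes a: "a > -1" and u: "u \<in> L2 a" and "N \<le> M" and q: "q \<in> polys_below N"
  shows "ip a (\<lambda>x. proj a M u x - proj a N u x) q = 0"
proof -
  have qM: "q \<in> polys_below M" using q polys_below_mono[OF \<open>N \<le> M\<close>] by auto
  have L: "proj a M u \<in> L2 a" "proj a N u \<in> L2 a" "q \<in> L2 a"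
    using proj_L2[OF a u] polys_below_L2[OF a q] by auto
  show ?thesis
    using proj_orth[OF a u q] proj_orth[OF a u qM] by (simp add: ip_diff u L)
qed

text \<open>Only the part of the gradient orthogonal to polynomials of lower degree contributes, which
  turns the spectral gap into a statement that can be iterated.\<close>

lemma projection_poincare:
  fixes u :: "real ^ 'n::finite \<Rightarrow> complex"
  assumes a: "a > -1" and u: "u \<in> L2 a" and v: "\<And>i. v i \<in> L2 a" and uv: "\<And>i. wpd i u (v i)"
    and G: "\<And>i. G i \<in> polys_below N"
  shows "eigval TYPE('n) a (Suc N) * (L2_norm a (\<lambda>x. u x - proj a (Suc N) u x))\<^sup>2
    \<le> (\<Sum>i\<in>UNIV. (L2_norm a (\<lambda>x. v i x - G i x))\<^sup>2)" (is "?lam * _ \<le> ?R")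
proof -
  have lam: "?lam > 0"
    by (rule eigval_pos[OF a]) simp
  \<comment> \<open>\<open>sturm_lower\<close> is about polynomials, and u need not be one. The part
    of u in the degrees from N + 1 to M - 1 is bounded independently of M; density of polynomials
    then covers the rest.\<close>
  have main: "?lam * ip a p p \<le> ?R" if M: "Suc N \<le> M" and p_def: "p = (\<lambda>x. proj a M u x - proj a (Suc N) u x)" for M p
  proof -
    have p: "p \<in> polys_below M"
      unfolding p_def using proj_in[OF a u, of "Suc N"] polys_below_mono[OF M]
      by (intro polys_below_diff proj_in a u) auto
    have orth: "ip a p q = 0" if "q \<in> polys_below (Suc N)" for q
      unfolding p_def by (rule proj_of_orth[OF a u M that])
    have pL: "p \<in> L2 a" "sturm a p \<in> L2 a" "pd i p \<in> L2 a" "G i \<in> L2 a" for i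
      by (rule polys_below_L2[OF a], rule p, rule polys_below_L2[OF a], rule sturm_polys_below[OF p],
          rule pd_L2[OF a p], rule polys_below_L2[OF a G])
    define P where "P i = pd i p" for i
    define H where "H i x = v i x - G i x" for i x
    have PL: "\<And>i. P i \<in> L2 a" "\<And>i. H i \<in> L2 a" using pL v by (auto simp: P_def H_def[abs_def] intro!: L2_diff)
    have "gform a v P = - ip a u (sturm a p)" unfolding P_def by (rule gform_sturm[OF a u v uv p])
    also have "ip a u (sturm a p) = ip a p (sturm a p)"
    proof -
      have "ip a (\<lambda>x. u x - proj a M u x) (sturm a p) = 0"
        by (rule proj_orth[OF a u sturm_polys_below[OF p]])
      moreover have "ip a (proj a (Suc N) u) (sturm a p) = 0"
        using sturm_symmetric[OF a proj_in[OF a u, of "Suc N"] p] orth[OF sturm_polys_below[OF proj_in[OF a u, of "Suc N"]]] by simp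
      ultimately show ?thesis
        unfolding p_def using pL(2)[unfolded p_def] by (simp add: ip_diff u proj_L2[OF a u])
    qed
    also have "- ip a p (sturm a p) = gform a P P"
      unfolding P_def using gform_sturm[OF a pL(1) pL(3) polys_below_wpd[OF p] p] by simp
    finally have vP: "gform a v P = gform a P P" .
    \<comment> \<open>By the divergence theorem this is, up to sign, the inner product of p with a
      polynomial of degree at most N built from G, and p is orthogonal to those.\<close>
    have "gform a P G = 0"
    proof -
      have R: "radial G \<in> polys_below (Suc N)" by (rule radial_polys_below[OF G])
      have X: "(\<lambda>x. G i x - of_real (x $ i) * radial G x) \<in> polys_below (Suc (Suc N))" for i
        by (intro polys_below_diff polys_below_coord R polys_below_Suc G)
      have "pd i (\<lambda>x. G i x - of_real (x $ i) * radial G x) \<in> polys_below (Suc N)" for i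
        using pd_polys_below[OF X] by simp
      then have "(\<lambda>x. (\<Sum>i\<in>UNIV. pd i (\<lambda>x. G i x - of_real (x $ i) * radial G x) x) - of_real (2 * a) * radial G x) \<in> polys_below (Suc N)"
        by (intro polys_below_diff polys_below_sum polys_below_cmult R)
      from orth[OF this] show ?thesis
        unfolding P_def using gform_weak_divergence[OF a pL(1) pL(3) polys_below_wpd[OF p] G] by simp
    qed
    then have HP: "gform a H P = gform a P P"
      unfolding H_def[abs_def] using vP gform_diff_left[OF v pL(4) PL(1)] by (simp add: gform_commute[of a G])
    \<comment> \<open>Since \<open>gform a H P\<close> equals \<open>gform a P P\<close>, P acts as
      an orthogonal component of H, and nonnegativity at H - P bounds its energy by that of
      H.\<close>
    have "0 \<le> gform a (\<lambda>i x. H i x - P i x) (\<lambda>i x. H i x - P i x)"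
      by (intro gform_nonneg L2_diff PL)
    also have "\<dots> = gform a H (\<lambda>i x. H i x - P i x) - gform a P (\<lambda>i x. H i x - P i x)"
      by (intro gform_diff_left PL L2_diff)
    also have "\<dots> = gform a H H - gform a P P"
      using HP gform_commute[of a P H] by (simp add: gform_diff_right[OF PL(2,1) PL(2)] gform_diff_right[OF PL(2,1) PL(1)])
    finally have "gform a P P \<le> gform a H H" by simp
    also have "\<dots> \<le> ?R" using gform_upper[of a H] by (simp add: L2_norm_sq H_def[abs_def])
    finally have "gform a P P \<le> ?R" .
    moreover have "?lam * ip a p p \<le> gform a P P"
      using sturm_lower[OF a p orth] gform_sturm[OF a pL(1) pL(3) polys_below_wpd[OF p] p] unfolding P_def by simp
    ultimately show ?thesis by simp
  qed
  let ?e = "L2_norm a (\<lambda>x. u x - proj a (Suc N) u x)"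
  have "?e \<le> sqrt (?R / ?lam) + e" if e: "e > 0" for e
  proof -
    obtain M where M: "Suc N \<le> M" "L2_norm a (\<lambda>x. u x - proj a M u x) < e"
      using proj_tendsto[OF a u e, of "Suc N"] by auto
    define p where "p = (\<lambda>x. proj a M u x - proj a (Suc N) u x)"
    have pL: "p \<in> L2 a" unfolding p_def by (intro L2_diff proj_L2 a u)
    have "?e = L2_norm a (\<lambda>x. (u x - proj a M u x) + p x)" by (simp add: p_def)
    also have "\<dots> \<le> L2_norm a (\<lambda>x. u x - proj a M u x) + L2_norm a p"
      by (intro L2_norm_triangle L2_diff u proj_L2 a pL)
    also have "L2_norm a p \<le> sqrt (?R / ?lam)"
      unfolding L2_norm_ip[of a p] using main[OF M(1) p_def] lam
      by (intro real_sqrt_le_mono) (simp add: pos_le_divide_eq mult.commute)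
    finally show ?thesis using M(2) by simp
  qed
  then have "?e \<le> sqrt (?R / ?lam)" by (rule field_le_epsilon)
  then have "?e\<^sup>2 \<le> (sqrt (?R / ?lam))\<^sup>2" by (intro power_mono) auto
  also have "\<dots> = ?R / ?lam" using lam by (intro real_sqrt_pow2 divide_nonneg_pos sum_nonneg) auto
  finally show ?thesis using lam by (simp add: pos_le_divide_eq mult.commute)
qed

section \<open>Changing the weight exponent\<close>

text \<open>\<open>x W\<^bsub>\<alpha>+1\<^esub>\<close> as the test field in the divergence theorem compares the norms for
  \<open>\<alpha>\<close> and \<open>\<alpha> + 1\<close>.\<close>

lemma weight_shift_identity:
  fixes p :: "real ^ 'n::finite \<Rightarrow> complex"
  assumes a: "a > -1" and p: "p \<in> polys_below N"
  shows "2 * (a + 1) * ip a p p = (real CARD('n) + 2 * a + 2) * ip (a + 1) p p + 2 * ip (a + 1) (euler p) p"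
proof -
  define w where "w x = of_real (real CARD('n) + 2 * (a + 1)) * p x + euler p x" for x
  \<comment> \<open>The right side of \<open>weak_divergence_single\<close> for q = x_i p. Summed
    over i, the left sides give the Euler term of the identity, and the right sides contain it once
    more: hence its factor 2.\<close>
  define T where "T i x = of_real (1 - (norm x)\<^sup>2) * pd i (\<lambda>x. of_real (x $ i) * p x) x
      - of_real (2 * (a + 1)) * of_real (x $ i) * (of_real (x $ i) * p x)" for i x
  have d: "pdiff p" by (rule polys_below_pdiff[OF p])
  have pL: "p \<in> L2 a" by (rule polys_below_L2[OF a p])
  have xp: "(\<lambda>x. of_real (x $ i) * p x) \<in> polys_below (Suc N)" for i by (rule polys_below_coord[OF p])
  have T: "ip (a + 1) (pd i p) (\<lambda>x. of_real (x $ i) * p x) = - ip a p (T i)" for i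
    unfolding T_def[abs_def]
    using weak_divergence_single[OF a pL pd_L2[OF a p] polys_below_wpd[OF p] xp, of i i]
      polys_below_wpd[OF p] pd_L2[OF a p] by blast
  have TL: "T i \<in> L2 a" for i
  proof -
    have "(\<lambda>x. of_real (2 * (a + 1)) * (of_real (x $ i) * (of_real (x $ i) * p x))) \<in> L2 a"
      by (intro L2_cmult L2_coord pL)
    moreover have "(\<lambda>x. of_real (1 - (norm x)\<^sup>2) * pd i (\<lambda>x. of_real (x $ i) * p x) x) \<in> L2 a"
      by (rule polys_below_L2[OF a polys_below_one_minus_norm[OF pd_polys_below[OF xp]]])
    ultimately show ?thesis unfolding T_def[abs_def] by (simp add: L2_diff mult.assoc)
  qed
  have wp: "w \<in> polys_below N" unfolding w_def[abs_def] by (intro polys_below_add polys_below_cmult euler_polys_below p)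
  have wL: "w \<in> L2 a" by (rule polys_below_L2[OF a wp])
  have eL: "euler p \<in> L2 a" by (rule polys_below_L2[OF a euler_polys_below[OF p]])
  have sT: "(\<Sum>i\<in>UNIV. T i x) = of_real (1 - (norm x)\<^sup>2) * w x - of_real (2 * (a + 1)) * p x" for x
  proof -
    have "(\<Sum>i\<in>UNIV. T i x) = of_real (1 - (norm x)\<^sup>2) * (\<Sum>i\<in>UNIV. p x + of_real (x $ i) * pd i p x)
       - of_real (2 * (a + 1)) * ((\<Sum>i\<in>UNIV. of_real ((x $ i)\<^sup>2)) * p x)"
    proof -
      have "T i x = of_real (1 - (norm x)\<^sup>2) * (p x + of_real (x $ i) * pd i p x)
        - of_real (2 * (a + 1)) * (of_real ((x $ i)\<^sup>2) * p x)" for i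
        by (simp add: T_def pd_mult pdiff_coord d pd_coord power2_eq_square add.commute)
      then show ?thesis
        by (simp only: sum_subtractf sum_distrib_left sum_distrib_right)
    qed
    also have "\<dots> = of_real (1 - (norm x)\<^sup>2) * (of_nat CARD('n) * p x + euler p x)
       - of_real (2 * (a + 1)) * (of_real ((norm x)\<^sup>2) * p x)"
      by (simp add: sum.distrib euler_def norm_sq_vec)
    also have "\<dots> = of_real (1 - (norm x)\<^sup>2) * w x - of_real (2 * (a + 1)) * p x"
      by (simp add: w_def algebra_simps)
    finally show ?thesis .
  qed
  have nwL: "(\<lambda>x. of_real (1 - (norm x)\<^sup>2) * w x) \<in> L2 a"
    by (rule polys_below_L2[OF a polys_below_one_minus_norm[OF wp]])
  have "ip (a + 1) (euler p) p = (\<Sum>i\<in>UNIV. ip (a + 1) (pd i p) (\<lambda>x. of_real (x $ i) * p x))"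
    unfolding euler_radial by (intro ip_radial L2_mono pd_L2[OF a p] pL)
  also have "\<dots> = - (\<Sum>i\<in>UNIV. ip a (T i) p)"
    unfolding T by (simp add: sum_negf ip_commute)
  also have "(\<Sum>i\<in>UNIV. ip a (T i) p) = ip a (\<lambda>x. \<Sum>i\<in>UNIV. T i x) p"
    by (intro ip_sum[symmetric] TL pL)
  also have "\<dots> = ip a p (\<lambda>x. of_real (1 - (norm x)\<^sup>2) * w x) - 2 * (a + 1) * ip a p p"
  proof -
    have "ip a (\<lambda>x. \<Sum>i\<in>UNIV. T i x) p = ip a p (\<lambda>x. of_real (1 - (norm x)\<^sup>2) * w x - of_real (2 * (a + 1)) * p x)"
      unfolding sT by (rule ip_commute)
    also have "\<dots> = ip a p (\<lambda>x. of_real (1 - (norm x)\<^sup>2) * w x) - ip a p (\<lambda>x. of_real (2 * (a + 1)) * p x)"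
      by (rule ip_diff_right[OF nwL L2_cmult[OF pL] pL])
    finally show ?thesis by (simp only: ip_cmult_right)
  qed
  also have "ip a p (\<lambda>x. of_real (1 - (norm x)\<^sup>2) * w x) = ip (a + 1) p w" by (rule ip_weight_Suc[symmetric])
  also have "\<dots> = (real CARD('n) + 2 * (a + 1)) * ip (a + 1) p p + ip (a + 1) p (euler p)"
    unfolding w_def[abs_def]
    by (simp only: ip_add_right[OF L2_cmult[OF L2_mono[OF pL]] L2_mono[OF eL] L2_mono[OF pL]] ip_cmult_right)
  finally show ?thesis using ip_commute[of "a + 1" p "euler p"] by (simp add: algebra_simps)
qed

text \<open>Modulo lower degrees, to which p is orthogonal, the Euler operator is multiplication by
  k. The ratio of the squared norms is then exactly linear in k, which is the source of the factor
  \<surd>n.\<close>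

lemma weight_shift_orthogonal:
  fixes p :: "real ^ 'n::finite \<Rightarrow> complex"
  assumes a: "a > -1" and p: "p \<in> polys_below (Suc k)" and orth: "\<And>q. q \<in> polys_below k \<Longrightarrow> ip (a + 1) p q = 0"
  shows "2 * (a + 1) * ip a p p = (2 * real k + real CARD('n) + 2 * a + 2) * ip (a + 1) p p"
proof -
  define q where "q x = euler p x - of_nat k * p x" for x
  have q: "q \<in> polys_below k" unfolding q_def[abs_def] by (rule euler_top[OF p])
  have L: "p \<in> L2 (a + 1)" "q \<in> L2 (a + 1)" by (intro L2_mono polys_below_L2[OF a p] polys_below_L2[OF a q])+
  have "euler p = (\<lambda>x. of_real (real k) * p x + q x)" by (simp add: q_def)
  then have "ip (a + 1) (euler p) p = ip (a + 1) (\<lambda>x. of_real (real k) * p x + q x) p" by (rule arg_cong)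
  also have "\<dots> = real k * ip (a + 1) p p + ip (a + 1) q p"
    unfolding ip_cmult[symmetric] by (intro ip_add L L2_cmult)
  also have "ip (a + 1) q p = 0" using orth[OF q] by (simp add: ip_commute)
  finally show ?thesis using weight_shift_identity[OF a p] by (simp add: algebra_simps)
qed

text \<open>Chosen so that (2 k + d + 2 a + 2) / (2 (a + 1)) is at most this constant times K + 1
  whenever k \<le> K.\<close>

definition gap_const :: "'n::finite itself \<Rightarrow> real \<Rightarrow> real" where
  "gap_const _ a = (real CARD('n) + 2 * a + 4) / (2 * (a + 1))"

lemma gap_const_pos: "a > -1 \<Longrightarrow> 0 < gap_const TYPE('n::finite) a"
  unfolding gap_const_def by (intro divide_pos_pos) (auto intro: add_nonneg_pos)

lemma weight_shift_bound:
  fixes p :: "real ^ 'n::finite \<Rightarrow> complex"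
  assumes a: "a > -1" and p: "p \<in> polys_below (Suc k)" and orth: "\<And>q. q \<in> polys_below k \<Longrightarrow> ip (a + 1) p q = 0"
    and "k \<le> K"
  shows "ip a p p \<le> gap_const TYPE('n) a * (real K + 1) * ip (a + 1) p p"
proof -
  have s: "0 \<le> real CARD('n) + 2 * a + 2" using a by simp
  have "2 * real k + real CARD('n) + 2 * a + 2 \<le> 2 * (real K + 1) + (real CARD('n) + 2 * a + 2) * 1"
    using \<open>k \<le> K\<close> by simp
  also have "\<dots> \<le> 2 * (real K + 1) + (real CARD('n) + 2 * a + 2) * (real K + 1)"
    using s by (intro add_left_mono mult_left_mono) auto
  also have "\<dots> = (real CARD('n) + 2 * a + 4) * (real K + 1)" by (simp add: algebra_simps)
  finally have "(2 * real k + real CARD('n) + 2 * a + 2) * ip (a + 1) p p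
     \<le> (real CARD('n) + 2 * a + 4) * (real K + 1) * ip (a + 1) p p"
    by (intro mult_right_mono ip_nonneg)
  then have "ip a p p * (2 * (a + 1)) \<le> (real CARD('n) + 2 * a + 4) * (real K + 1) * ip (a + 1) p p"
    using weight_shift_orthogonal[OF a p orth] by (simp add: mult.commute)
  then have "ip a p p \<le> (real CARD('n) + 2 * a + 4) * (real K + 1) * ip (a + 1) p p / (2 * (a + 1))"
    using a by (subst pos_le_divide_eq) auto
  then show ?thesis by (simp add: gap_const_def)
qed

text \<open>For exponent \<open>a + 1\<close>, y splits orthogonally into the degrees K and K - 1,
  each covered by \<open>weight_shift_bound\<close>. For exponent \<open>a\<close> the two pieces
  need not be orthogonal, hence the factor 2.\<close>

lemma weight_shift_bound_two_levels:
  fixes y :: "real ^ 'n::finite \<Rightarrow> complex"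
  assumes a: "a > -1" and y: "y \<in> polys_below (Suc K)" and orth: "\<And>q. q \<in> polys_below (K - 1) \<Longrightarrow> ip (a + 1) y q = 0"
  shows "ip a y y \<le> 2 * gap_const TYPE('n) a * (real K + 1) * ip (a + 1) y y"
proof -
  have a1: "a + 1 > -1" using a by simp
  have yL: "y \<in> L2 a" "y \<in> L2 (a + 1)" using polys_below_L2[OF a y] L2_mono by auto
  define z where "z = proj (a + 1) K y"
  define w where "w x = y x - z x" for x
  have z: "z \<in> polys_below K" unfolding z_def by (rule proj_in[OF a1 yL(2)])
  have w: "w \<in> polys_below (Suc K)" unfolding w_def[abs_def] by (intro polys_below_diff y polys_below_Suc z)
  have zwL: "z \<in> L2 a" "w \<in> L2 a" "z \<in> L2 (a + 1)" by (rule polys_below_L2[OF a z], rule polys_below_L2[OF a w], rule polys_below_L2[OF a1 z])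
  have wo: "ip (a + 1) w q = 0" if "q \<in> polys_below K" for q
    unfolding w_def z_def by (rule proj_orth[OF a1 yL(2) that])
  have 1: "ip a w w \<le> gap_const TYPE('n) a * (real K + 1) * ip (a + 1) w w"
    by (rule weight_shift_bound[OF a w wo order_refl])
  have 2: "ip a z z \<le> gap_const TYPE('n) a * (real K + 1) * ip (a + 1) z z"
  \<comment> \<open>For K = 0 there is no degree K - 1, and z lies in the zero space.\<close>
  proof (cases K)
    case 0
    then have "z = (\<lambda>x. 0)" using z by simp
    then show ?thesis by simp
  next
    case (Suc k)
    have "ip (a + 1) z q = 0" if q: "q \<in> polys_below k" for q
    proof -
      have qK: "q \<in> polys_below K" using q Suc polys_below_Suc by blast
      have "ip (a + 1) w q = ip (a + 1) y q - ip (a + 1) z q"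
        unfolding w_def[abs_def] by (intro ip_diff yL zwL polys_below_L2[OF a1 q])
      then show ?thesis using wo[OF qK] orth[of q] q Suc by simp
    qed
    then show ?thesis using z Suc by (intro weight_shift_bound[OF a, of z k]) auto
  qed
  have "0 \<le> ip a (\<lambda>x. w x - z x) (\<lambda>x. w x - z x)" by (rule ip_nonneg)
  then have "2 * ip a w z \<le> ip a w w + ip a z z" by (simp add: ip_sq_diff zwL)
  moreover have "y = (\<lambda>x. w x + z x)" by (simp add: w_def)
  then have "ip a y y = ip a w w + 2 * ip a w z + ip a z z" using ip_sq_add[OF zwL(2,1)] by simp
  ultimately have "ip a y y \<le> 2 * (ip a w w + ip a z z)" by simp
  also have "\<dots> \<le> 2 * (gap_const TYPE('n) a * (real K + 1) * ip (a + 1) w w + gap_const TYPE('n) a * (real K + 1) * ip (a + 1) z z)"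
    using 1 2 by simp
  also have "\<dots> = 2 * gap_const TYPE('n) a * (real K + 1) * (ip (a + 1) w w + ip (a + 1) z z)"
    by (simp add: algebra_simps)
  also have "ip (a + 1) w w + ip (a + 1) z z = ip (a + 1) y y"
    using proj_pythagoras[OF a1 yL(2), of K] by (simp add: w_def[abs_def] z_def)
  finally show ?thesis .
qed

text \<open>A polynomial of degree below \<open>n - 2\<close> times \<open>1 - \<parallel>x\<parallel>\<^sup>2\<close> still has degree below \<open>n\<close>, so the
  two projections differ only in their two highest degrees.\<close>

lemma proj_shift_diff:
  fixes v :: "real ^ 'n::finite \<Rightarrow> complex"
  assumes a: "a > -1" and v: "v \<in> L2 a"
  shows "(L2_norm a (\<lambda>x. proj a n v x - proj (a + 1) n v x))\<^sup>2
    \<le> 2 * gap_const TYPE('n) a * (real n + 1) * (L2_norm a (\<lambda>x. v x - proj a n v x))\<^sup>2"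
proof (cases n)
  case 0
  have "proj a 0 v = (\<lambda>x. 0)" "proj (a + 1) 0 v = (\<lambda>x. 0)"
    using proj_in[OF a v, of 0] proj_in[OF _ L2_mono[OF v], of 0] a by auto
  then show ?thesis using 0 gap_const_pos[OF a, where 'n = 'n] by (simp add: L2_norm_sq ip_nonneg)
next
  case (Suc K)
  have a1: "a + 1 > -1" using a by simp
  note v1 = L2_mono[OF v]
  let ?P = "proj a n v" and ?Q = "proj (a + 1) n v"
  define w where "w x = v x - ?P x" for x
  \<comment> \<open>As \<open>?P\<close> has degree below n, y is the projection of w for exponent
    \<open>a + 1\<close>, and so is no larger than w in that norm.\<close>
  define y where "y x = ?Q x - ?P x" for x
  have P: "?P \<in> polys_below n" and Q: "?Q \<in> polys_below n" by (rule proj_in[OF a v], rule proj_in[OF a1 v1])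
  have y: "y \<in> polys_below n" unfolding y_def[abs_def] by (intro polys_below_diff P Q)
  have L: "w \<in> L2 a" "y \<in> L2 (a + 1)" "?Q \<in> L2 (a + 1)" "?P \<in> L2 (a + 1)"
    using L2_diff[OF v polys_below_L2[OF a P]] polys_below_L2[OF a1 y] polys_below_L2[OF a1 Q] polys_below_L2[OF a1 P]
    by (simp_all add: w_def[abs_def])
  note w1 = L2_mono[OF L(1)]
  have wy: "ip (a + 1) (\<lambda>x. w x - y x) q = 0" if "q \<in> polys_below n" for q
    using proj_orth[OF a1 v1 that] by (simp add: w_def y_def)
  have "ip (a + 1) y q = 0" if q: "q \<in> polys_below (K - 1)" for q
  proof (cases "K = 0")
    case True
    then show ?thesis using q by simp
  next
    case False
    have "K - 1 \<le> n" using Suc by simp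
    then have qn: "q \<in> polys_below n" using q polys_below_mono by blast
    have "(\<lambda>x. of_real (1 - (norm x)\<^sup>2) * q x) \<in> polys_below n"
      using polys_below_one_minus_norm[OF q] Suc False by simp
    then have "ip (a + 1) w q = 0"
      unfolding ip_weight_Suc w_def by (rule proj_orth[OF a v])
    moreover have "ip (a + 1) (\<lambda>x. w x - y x) q = ip (a + 1) w q - ip (a + 1) y q"
      by (intro ip_diff w1 L polys_below_L2[OF a1 q])
    ultimately show ?thesis using wy[OF qn] by simp
  qed
  then have "ip a y y \<le> 2 * gap_const TYPE('n) a * (real K + 1) * ip (a + 1) y y"
    using y Suc by (intro weight_shift_bound_two_levels[OF a]) auto
  also have "\<dots> \<le> 2 * gap_const TYPE('n) a * (real n + 1) * ip a w w"
  proof (intro mult_mono)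
    have "ip (a + 1) (\<lambda>x. (w x - y x) + y x) (\<lambda>x. (w x - y x) + y x)
       = ip (a + 1) (\<lambda>x. w x - y x) (\<lambda>x. w x - y x) + ip (a + 1) y y"
      using ip_sq_add[OF L2_diff[OF w1 L(2)] L(2)] wy[OF y] by simp
    then have "ip (a + 1) y y \<le> ip (a + 1) w w" using ip_nonneg[of "a + 1" "\<lambda>x. w x - y x"] by simp
    also have "\<dots> \<le> ip a w w" by (rule ip_mono_Suc[OF L(1)])
    finally show "ip (a + 1) y y \<le> ip a w w" .
  qed (use gap_const_pos[OF a, where 'n = 'n] Suc in \<open>auto simp: ip_nonneg\<close>)
  finally have "ip a y y \<le> 2 * gap_const TYPE('n) a * (real n + 1) * ip a w w" .
  moreover have "L2_norm a (\<lambda>x. ?P x - ?Q x) = L2_norm a y"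
    using L2_norm_cmult[of a "-1" y] by (simp add: y_def[abs_def])
  ultimately show ?thesis by (simp add: L2_norm_sq w_def[abs_def])
qed

text \<open>Up to sign, the adjoint of \<partial>_i between the exponents a and a + 1 maps q to (1 -
  |x|^2) \<partial>_i q - 2 (a + 1) x_i q. This raises the degree by one only, so the error of the
  projection is orthogonal to the image of every q of degree below n.\<close>

lemma pd_proj:
  assumes a: "a > -1" and u: "u \<in> L2 a" and v: "\<And>i. v i \<in> L2 a" and uv: "\<And>i. wpd i u (v i)"
  shows "pd i (proj a (Suc n) u) = proj (a + 1) n (v i)"
proof (rule proj_unique[symmetric])
  let ?P = "proj a (Suc n) u"
  have P: "?P \<in> polys_below (Suc n)" by (rule proj_in[OF a u])
  show "a + 1 > -1" using a by simp
  show "v i \<in> L2 (a + 1)" by (rule L2_mono[OF v])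
  show "pd i ?P \<in> polys_below n" using pd_polys_below[OF P] by simp
  fix q :: "real ^ 'a \<Rightarrow> complex" assume q: "q \<in> polys_below n"
  have w: "wpd j (\<lambda>x. u x - ?P x) (\<lambda>x. v j x - pd j ?P x)" "(\<lambda>x. v j x - pd j ?P x) \<in> L2 a" for j
    by (intro is_weak_deriv_diff uv polys_below_wpd[OF P]) (intro L2_diff v pd_L2[OF a P])
  have "ip (a + 1) (\<lambda>x. v i x - pd i ?P x) q = - ip a (\<lambda>x. u x - ?P x)
     (\<lambda>x. of_real (1 - (norm x)\<^sup>2) * pd i q x - of_real (2 * (a + 1)) * of_real (x $ i) * q x)"
    by (rule weak_divergence_single[OF a L2_diff[OF u polys_below_L2[OF a P]] w(2) w(1) q]) (use w in blast)
  also have "(\<lambda>x. of_real (1 - (norm x)\<^sup>2) * pd i q x - of_real (2 * (a + 1)) * of_real (x $ i) * q x) \<in> polys_below (Suc n)"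
  proof (cases n)
    \<comment> \<open>The degree count below needs n > 0, as n - 1 is truncated; for n = 0 the
      polynomial q is zero.\<close>
    case 0
    then show ?thesis using q by (simp add: pd_const[abs_def] polys_below_zero[of "Suc 0"])
  next
    case (Suc k)
    have "(\<lambda>x. of_real (1 - (norm x)\<^sup>2) * pd i q x) \<in> polys_below (Suc n)"
      using polys_below_one_minus_norm[OF pd_polys_below[OF q]] Suc by simp
    moreover have "(\<lambda>x. of_real (2 * (a + 1)) * (of_real (x $ i) * q x)) \<in> polys_below (Suc n)"
      by (intro polys_below_cmult polys_below_coord q)
    ultimately have "(\<lambda>x. of_real (1 - (norm x)\<^sup>2) * pd i q x - of_real (2 * (a + 1)) * (of_real (x $ i) * q x)) \<in> polys_below (Suc n)"
      by (rule polys_below_diff)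
    then show ?thesis by (simp add: mult.assoc)
  qed
  then have "ip a (\<lambda>x. u x - ?P x) (\<lambda>x. of_real (1 - (norm x)\<^sup>2) * pd i q x - of_real (2 * (a + 1)) * of_real (x $ i) * q x) = 0"
    by (rule proj_orth[OF a u])
  finally show "ip (a + 1) (\<lambda>x. v i x - pd i ?P x) q = 0" by simp
qed

section \<open>Bernstein and Markov inequalities for polynomials\<close>

definition grad_const :: "'n::finite itself \<Rightarrow> real \<Rightarrow> real" where
  "grad_const _ a = 1 + real CARD('n) + 2 * \<bar>a\<bar>"

text \<open>A Bernstein-type bound: the energy form controls the gradient only with the smaller
  weight of exponent \<open>a + 1\<close>, and in exchange a derivative costs a single factor N in
  norm.\<close>

lemma gradient_bound:
  fixes p :: "real ^ 'n::finite \<Rightarrow> complex"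
  assumes a: "a > -1" and p: "p \<in> polys_below (Suc N)"
  shows "(\<Sum>i\<in>UNIV. ip (a + 1) (pd i p) (pd i p)) \<le> grad_const TYPE('n) a * (real N + 1)\<^sup>2 * ip a p p"
proof -
  have "(\<Sum>i\<in>UNIV. ip (a + 1) (pd i p) (pd i p)) \<le> gform a (\<lambda>i. pd i p) (\<lambda>i. pd i p)"
    by (rule gform_lower) (rule pd_L2[OF a p])
  also have "\<dots> = - ip a p (sturm a p)"
    by (rule gform_sturm[OF a polys_below_L2[OF a p] pd_L2[OF a p] polys_below_wpd[OF p] p])
  also have "\<dots> \<le> eigval TYPE('n) a N * ip a p p" by (rule sturm_upper[OF a p])
  also have "\<dots> \<le> grad_const TYPE('n) a * (real N + 1)\<^sup>2 * ip a p p"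
  proof (intro mult_right_mono ip_nonneg)
    have "real N * (real N + real CARD('n) + 2 * a) \<le> (real N + 1) * ((real N + 1) * (1 + real CARD('n) + 2 * \<bar>a\<bar>))"
    proof (cases "N = 0")
      case False
      have "real N + (real CARD('n) + 2 * a) * 1 \<le> (real N + 1) + (real CARD('n) + 2 * \<bar>a\<bar>) * 1" by simp
      also have "\<dots> \<le> (real N + 1) + (real CARD('n) + 2 * \<bar>a\<bar>) * (real N + 1)"
        by (intro add_left_mono mult_left_mono) auto
      finally have *: "real N + real CARD('n) + 2 * a \<le> (real N + 1) * (1 + real CARD('n) + 2 * \<bar>a\<bar>)"
        by (simp add: algebra_simps)
      have "real N * (real N + real CARD('n) + 2 * a) \<le> real N * ((real N + 1) * (1 + real CARD('n) + 2 * \<bar>a\<bar>))"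
        by (rule mult_left_mono[OF *]) simp
      also have "\<dots> \<le> (real N + 1) * ((real N + 1) * (1 + real CARD('n) + 2 * \<bar>a\<bar>))"
        by (intro mult_right_mono) auto
      finally show ?thesis .
    qed simp
    then show "eigval TYPE('n) a N \<le> grad_const TYPE('n) a * (real N + 1)\<^sup>2"
      by (simp add: eigval_def grad_const_def power2_eq_square mult.commute mult.left_commute)
  qed
  finally show ?thesis .
qed

text \<open>For a general polynomial the Euler term in \<open>weight_shift_identity\<close> is
  bounded by Cauchy-Schwarz and \<open>gradient_bound\<close>. This brings back the norm for
  \<open>a\<close>, which is absorbed on the left. The squared norm thus loses N^2, against N for
  two top degrees in \<open>weight_shift_bound_two_levels\<close>.\<close>

lemma inverse_weight_bound:
  assumes a: "a > -1"
  shows "\<exists>C>0. \<forall>N. \<forall>q\<in>polys_below (Suc N). ip a q q \<le> C * (real N + 1)\<^sup>2 * ip (a + 1) q (q :: real ^ 'n::finite \<Rightarrow> complex)"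
proof -
  define k where "k = 2 * (a + 1)"
  define s where "s = real CARD('n) + 2 * a + 2"
  define E where "E = grad_const TYPE('n) a"
  have pos: "k > 0" "s > 0" "E > 0" using a by (auto simp: k_def s_def E_def grad_const_def intro: add_nonneg_pos add_pos_nonneg)
  define C where "C = (2 / k) * (s + 2 * E / k)"
  have "ip a q q \<le> C * (real N + 1)\<^sup>2 * ip (a + 1) q q" if q: "q \<in> polys_below (Suc N)" for N and q :: "real ^ 'n \<Rightarrow> complex"
  proof -
    have a1: "a + 1 > -1" using a by simp
    define M where "M = real N + 1"
    have M: "M \<ge> 1" by (simp add: M_def)
    let ?X = "L2_norm a q" and ?Y = "L2_norm (a + 1) q"
    have qL: "q \<in> L2 (a + 1)" by (rule polys_below_L2[OF a1 q])
    have eL: "euler q \<in> L2 (a + 1)" by (rule polys_below_L2[OF a1 euler_polys_below[OF q]])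
    have "0 \<le> gform (a + 1) (\<lambda>i. pd i q) (\<lambda>i. pd i q)" by (intro gform_nonneg pd_L2[OF a1 q])
    then have "ip (a + 1) (euler q) (euler q) \<le> (\<Sum>i\<in>UNIV. ip (a + 1) (pd i q) (pd i q))"
      by (simp add: gform_def euler_radial)
    also have "\<dots> \<le> E * M\<^sup>2 * ip a q q" unfolding E_def M_def by (rule gradient_bound[OF a q])
    finally have e: "(L2_norm (a + 1) (euler q))\<^sup>2 \<le> E * M\<^sup>2 * ?X\<^sup>2" by (simp add: L2_norm_sq)
    have id: "k * ?X\<^sup>2 = s * ?Y\<^sup>2 + 2 * ip (a + 1) (euler q) q"
      using weight_shift_identity[OF a q] by (simp add: k_def s_def L2_norm_sq)
    have "2 * ip (a + 1) (euler q) q \<le> 2 * (L2_norm (a + 1) (euler q) * ?Y)"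
      using ip_Cauchy_Schwarz[OF eL qL] by simp
    also have "\<dots> \<le> (k / (2 * E * M\<^sup>2)) * (L2_norm (a + 1) (euler q))\<^sup>2 + (2 * E * M\<^sup>2 / k) * ?Y\<^sup>2"
    proof -
      \<comment> \<open>With this t the product t E M^2 is k / 2, so half of the left side k X^2
        absorbs the gradient term.\<close>
      define t where "t = k / (2 * E * M\<^sup>2)"
      have t: "t > 0" unfolding t_def using pos M by (intro divide_pos_pos mult_pos_pos) auto
      have "0 \<le> (t * L2_norm (a + 1) (euler q) - ?Y)\<^sup>2 / t" using t by simp
      also have "\<dots> = t * (L2_norm (a + 1) (euler q))\<^sup>2 + (1 / t) * ?Y\<^sup>2 - 2 * (L2_norm (a + 1) (euler q) * ?Y)"
        using t by (simp add: power2_diff field_simps power2_eq_square)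
      finally show ?thesis by (simp add: t_def)
    qed
    also have "(k / (2 * E * M\<^sup>2)) * (L2_norm (a + 1) (euler q))\<^sup>2 \<le> (k / (2 * E * M\<^sup>2)) * (E * M\<^sup>2 * ?X\<^sup>2)"
      using pos M by (intro mult_left_mono e divide_nonneg_pos mult_pos_pos) auto
    also have "\<dots> = k / 2 * ?X\<^sup>2" using pos M by (simp add: field_simps)
    finally have "k / 2 * ?X\<^sup>2 \<le> s * ?Y\<^sup>2 + (2 * E * M\<^sup>2 / k) * ?Y\<^sup>2" using id by linarith
    also have "\<dots> \<le> s * M\<^sup>2 * ?Y\<^sup>2 + (2 * E * M\<^sup>2 / k) * ?Y\<^sup>2"
    proof -
      have "s * 1 \<le> s * M\<^sup>2" using pos M by (intro mult_left_mono) (auto simp: one_le_power)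
      then have "s * ?Y\<^sup>2 \<le> s * M\<^sup>2 * ?Y\<^sup>2" by (intro mult_right_mono) auto
      then show ?thesis by simp
    qed
    finally have "?X\<^sup>2 \<le> (s * M\<^sup>2 * ?Y\<^sup>2 + (2 * E * M\<^sup>2 / k) * ?Y\<^sup>2) * (2 / k)"
      using pos by (simp add: field_simps)
    also have "\<dots> = C * M\<^sup>2 * ?Y\<^sup>2" by (simp add: C_def algebra_simps)
    finally show ?thesis by (simp add: L2_norm_sq M_def)
  qed
  moreover have "C > 0" unfolding C_def using pos by (intro mult_pos_pos add_pos_pos divide_pos_pos) auto
  ultimately show ?thesis by blast
qed

text \<open>Each derivative costs N twice: \<open>gradient_bound\<close> moves from exponent
  \<open>a\<close> to \<open>a + 1\<close>, and \<open>inverse_weight_bound\<close> comes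
  back.\<close>

lemma markov_inequality:
  assumes a: "a > -1"
  shows "\<exists>D>0. \<forall>n. \<forall>p\<in>polys_below n. \<forall>i. L2_norm a (pd i p) \<le> D * (real n + 1)\<^sup>2 * L2_norm a (p :: real ^ 'n::finite \<Rightarrow> complex)"
proof -
  obtain C where C: "C > 0" "\<And>N q. q \<in> polys_below (Suc N) \<Longrightarrow> ip a q q \<le> C * (real N + 1)\<^sup>2 * ip (a + 1) q (q :: real ^ 'n \<Rightarrow> complex)"
    using inverse_weight_bound[OF a] by blast
  define E where "E = grad_const TYPE('n) a"
  have E: "E > 0" by (simp add: E_def grad_const_def add_pos_nonneg)
  have "L2_norm a (pd i p) \<le> sqrt (C * E) * (real n + 1)\<^sup>2 * L2_norm a p" if p: "p \<in> polys_below n" for n i and p :: "real ^ 'n \<Rightarrow> complex"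
  proof -
    define M where "M = real n + 1"
    have p': "p \<in> polys_below (Suc n)" by (rule polys_below_Suc[OF p])
    have q: "pd i p \<in> polys_below (Suc n)" using pd_polys_below[OF p'] polys_below_Suc by force
    have "ip a (pd i p) (pd i p) \<le> C * M\<^sup>2 * ip (a + 1) (pd i p) (pd i p)" unfolding M_def by (rule C(2)[OF q])
    also have "\<dots> \<le> C * M\<^sup>2 * (E * M\<^sup>2 * ip a p p)"
    proof (intro mult_left_mono)
      have "ip (a + 1) (pd i p) (pd i p) \<le> (\<Sum>i\<in>UNIV. ip (a + 1) (pd i p) (pd i p))"
        by (rule member_le_sum) (auto simp: ip_nonneg)
      then show "ip (a + 1) (pd i p) (pd i p) \<le> E * M\<^sup>2 * ip a p p"
        unfolding E_def M_def using gradient_bound[OF a p'] by linarith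
    qed (use C in simp)
    also have "\<dots> = (sqrt (C * E) * M\<^sup>2 * L2_norm a p)\<^sup>2"
    proof -
      have "(sqrt (C * E))\<^sup>2 = C * E" using C E by simp
      then show ?thesis by (simp only: power_mult_distrib L2_norm_sq) (simp add: power2_eq_square)
    qed
    finally have "(L2_norm a (pd i p))\<^sup>2 \<le> (sqrt (C * E) * M\<^sup>2 * L2_norm a p)\<^sup>2" by (simp add: L2_norm_sq)
    then show ?thesis unfolding M_def
      by (rule power2_le_imp_le) (use C E in \<open>intro mult_nonneg_nonneg, auto\<close>)
  qed
  moreover have "sqrt (C * E) > 0" using C E by simp
  ultimately show ?thesis by blast
qed

section \<open>Projection errors in Sobolev norms\<close>

text \<open>One bound for each weak derivative separately, in place of the Sobolev norm: it passes
  unchanged from u to its first derivatives, as the inductions on l require.\<close>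

definition sobolev_bounded :: "real \<Rightarrow> nat \<Rightarrow> (real ^ 'n::finite \<Rightarrow> complex) \<Rightarrow> real \<Rightarrow> bool" where
  "sobolev_bounded a l u B \<longleftrightarrow> u \<in> L2 a \<and>
     (\<forall>\<gamma>. mi_abs \<gamma> \<le> l \<longrightarrow> (\<exists>w\<in>L2 a. is_weak_deriv \<gamma> u w \<and> L2_norm a w \<le> B))"

lemma L2_norm_weak_deriv_unique:
  "is_weak_deriv \<gamma> u v \<Longrightarrow> is_weak_deriv \<gamma> u w \<Longrightarrow> L2_norm a v = L2_norm a w"
  using L2_norm_weak_deriv[of \<gamma> u v a] L2_norm_weak_deriv[of \<gamma> u w a] by simp

lemma sobolev_bounded_L2: "sobolev_bounded a l u B \<Longrightarrow> u \<in> L2 a"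
  by (simp add: sobolev_bounded_def)

lemma sobolev_bounded_derivE:
  assumes "sobolev_bounded a l u B" "mi_abs \<gamma> \<le> l"
  obtains w where "w \<in> L2 a" "is_weak_deriv \<gamma> u w" "L2_norm a w \<le> B"
  using assms unfolding sobolev_bounded_def by blast

lemma sobolev_bounded_norm:
  assumes "sobolev_bounded a l u B"
  shows "loc_integrable u" "L2_norm a u \<le> B" "0 \<le> B"
proof -
  have "mi_abs (\<lambda>_. 0) \<le> l" by simp
  from sobolev_bounded_derivE[OF assms this] obtain w
    where w: "w \<in> L2 a" "is_weak_deriv (\<lambda>_. 0) u w" "L2_norm a w \<le> B" by metis
  show loc: "loc_integrable u" by (rule is_weak_deriv_loc(1)[OF w(2)])
  show "L2_norm a u \<le> B"
    using L2_norm_weak_deriv_unique[OF is_weak_deriv_zero[OF loc] w(2), of a] w(3) by simp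
  then show "0 \<le> B" using L2_norm_nonneg[of a u] by linarith
qed

lemma sobolev_bounded_gradient:
  assumes u: "sobolev_bounded a (Suc l) u B"
  obtains v where "\<And>i. wpd i u (v i)" "\<And>i. sobolev_bounded a l (v i) B"
proof -
  have "\<exists>w. w \<in> L2 a \<and> wpd i u w" for i
  proof -
    have "mi_abs (inc i (\<lambda>_. 0)) \<le> Suc l" by simp
    from sobolev_bounded_derivE[OF u this] show ?thesis by metis
  qed
  then obtain v where v: "\<And>i. v i \<in> L2 a" "\<And>i. wpd i u (v i)" by metis
  have "sobolev_bounded a l (v i) B" for i
    unfolding sobolev_bounded_def
  proof (intro conjI allI impI v(1))
    fix \<gamma> :: "'a multi_index" assume "mi_abs \<gamma> \<le> l"
    then have "mi_abs (inc i \<gamma>) \<le> Suc l" by simp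
    from sobolev_bounded_derivE[OF u this] obtain w
      where "w \<in> L2 a" "is_weak_deriv (inc i \<gamma>) u w" "L2_norm a w \<le> B" by metis
    then show "\<exists>w\<in>L2 a. is_weak_deriv \<gamma> (v i) w \<and> L2_norm a w \<le> B"
      unfolding wpd_inc[OF v(2)] by blast
  qed
  with v(2) show ?thesis by (rule that)
qed

text \<open>With the projections of the gradient components as G, the right side of
  \<open>projection_poincare\<close> falls under the induction hypothesis. Using
  \<open>real n + 1\<close> includes n = 0, where the projection is zero.\<close>

lemma L2_projection_error:
  assumes a: "a > -1"
  shows "\<exists>C>0. \<forall>u B n. sobolev_bounded a l (u :: real ^ 'n::finite \<Rightarrow> complex) B \<longrightarrow>
    L2_norm a (\<lambda>x. u x - proj a n u x) * (real n + 1) ^ l \<le> C * B"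
proof (induction l)
  case 0
  have "L2_norm a (\<lambda>x. u x - proj a n u x) \<le> B" if u: "sobolev_bounded a 0 u B" for n B and u :: "real ^ 'n \<Rightarrow> complex"
    using proj_norm_le(2)[OF a sobolev_bounded_L2[OF u], of n] sobolev_bounded_norm(2)[OF u] by linarith
  then show ?case by (intro exI[of _ 1]) auto
next
  case (Suc l)
  then obtain C where C: "C > 0" "\<And>u B n. sobolev_bounded a l (u :: real ^ 'n \<Rightarrow> complex) B \<Longrightarrow>
    L2_norm a (\<lambda>x. u x - proj a n u x) * (real n + 1) ^ l \<le> C * B" by blast
  define d where "d = real CARD('n)"
  \<comment> \<open>With x = N + 1 the eigenvalue is x (x + d + 2 a), and x + d + 2 a = N + (d + 1 +
    2 a) is at least k x. Positivity of k follows from d \<ge> 1 and a > -1.\<close>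
  define k where "k = min 1 (d + 1 + 2 * a)"
  have d: "d \<ge> 1" by (simp add: d_def Suc_leI)
  then have k: "k > 0" using a by (simp add: k_def)
  \<comment> \<open>The summand 1 serves n = 0; for n = N + 1 the power of 2 comes from n + 1 \<le>
    2 (N + 1).\<close>
  define C' where "C' = 1 + 2 ^ Suc l * (sqrt (d / k) * C)"
  have C'1: "C' \<ge> 1" using d k C by (simp add: C'_def)
  have "L2_norm a (\<lambda>x. u x - proj a n u x) * (real n + 1) ^ Suc l \<le> C' * B"
    if u: "sobolev_bounded a (Suc l) u B" for u :: "real ^ 'n \<Rightarrow> complex" and B n
  proof (cases n)
    case 0
    have B: "0 \<le> B" "L2_norm a u \<le> B" using sobolev_bounded_norm[OF u] by auto
    have "L2_norm a (\<lambda>x. u x - proj a n u x) \<le> B"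
      using proj_norm_le(2)[OF a sobolev_bounded_L2[OF u], of n] B by linarith
    also have "B = 1 * B" by simp
    also have "\<dots> \<le> C' * B" using C'1 B by (intro mult_right_mono)
    finally show ?thesis using 0 by simp
  next
    case (Suc N)
    obtain v where v: "\<And>i. wpd i u (v i)" "\<And>i. sobolev_bounded a l (v i) B"
      by (rule sobolev_bounded_gradient[OF u]) (rule that)
    have vL: "v i \<in> L2 a" for i by (rule sobolev_bounded_L2[OF v(2)])
    define x where "x = real N + 1"
    have x: "x \<ge> 1" by (simp add: x_def)
    define e where "e = L2_norm a (\<lambda>x. u x - proj a n u x)"
    have e0: "e \<ge> 0" by (simp add: e_def)
    have B: "0 \<le> B" using sobolev_bounded_norm[OF u] by auto
    have "k * x\<^sup>2 * e\<^sup>2 \<le> eigval TYPE('n) a (Suc N) * e\<^sup>2"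
    proof (rule mult_right_mono)
      have "k * x \<le> x + d + 2 * a"
      proof -
        have "k * x = k * real N + k" by (simp add: x_def algebra_simps)
        also have "\<dots> \<le> 1 * real N + (d + 1 + 2 * a)"
          by (intro add_mono mult_right_mono) (auto simp: k_def)
        finally show ?thesis by (simp add: x_def)
      qed
      then have "x * (k * x) \<le> x * (x + d + 2 * a)" using x by (intro mult_left_mono) auto
      then show "k * x\<^sup>2 \<le> eigval TYPE('n) a (Suc N)"
        by (simp add: eigval_def x_def d_def power2_eq_square algebra_simps)
    qed simp
    also have "\<dots> \<le> (\<Sum>i\<in>UNIV. (L2_norm a (\<lambda>x. v i x - proj a N (v i) x))\<^sup>2)"
      unfolding e_def Suc by (intro projection_poincare a sobolev_bounded_L2[OF u] vL v(1) proj_in)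
    finally have 1: "k * x\<^sup>2 * e\<^sup>2 \<le> (\<Sum>i\<in>UNIV. (L2_norm a (\<lambda>x. v i x - proj a N (v i) x))\<^sup>2)" .
    have "k * (x ^ Suc l * e)\<^sup>2 = (k * x\<^sup>2 * e\<^sup>2) * (x ^ l)\<^sup>2"
      by (simp add: power_mult_distrib)
    also have "\<dots> \<le> (\<Sum>i\<in>UNIV. (L2_norm a (\<lambda>x. v i x - proj a N (v i) x))\<^sup>2) * (x ^ l)\<^sup>2"
      by (rule mult_right_mono[OF 1]) simp
    also have "\<dots> = (\<Sum>i\<in>UNIV. (L2_norm a (\<lambda>x. v i x - proj a N (v i) x) * x ^ l)\<^sup>2)"
      by (simp add: sum_distrib_right power_mult_distrib)
    also have "\<dots> \<le> (\<Sum>i\<in>(UNIV :: 'n set). (C * B)\<^sup>2)"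
      unfolding x_def using x by (intro sum_mono power_mono C(2)[OF v(2)]) (simp add: add_nonneg_nonneg)
    also have "\<dots> = d * (C * B)\<^sup>2" by (simp add: d_def)
    finally have "(x ^ Suc l * e)\<^sup>2 \<le> (d / k) * (C * B)\<^sup>2"
      using k by (simp add: field_simps)
    also have "\<dots> = (sqrt (d / k) * (C * B))\<^sup>2"
      using d k by (simp add: power_mult_distrib)
    finally have "x ^ Suc l * e \<le> sqrt (d / k) * (C * B)"
      by (rule power2_le_imp_le) (use d k C B in \<open>simp add: mult_nonneg_nonneg\<close>)
    then have "2 ^ Suc l * (x ^ Suc l * e) \<le> 2 ^ Suc l * (sqrt (d / k) * (C * B))" by (intro mult_left_mono) auto
    also have "\<dots> \<le> C' * B" using B by (simp add: C'_def algebra_simps)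
    finally have 2: "2 ^ Suc l * (x ^ Suc l * e) \<le> C' * B" .
    have "e * (real n + 1) ^ Suc l \<le> e * (2 * x) ^ Suc l"
      using e0 Suc by (intro mult_left_mono power_mono) (auto simp: x_def)
    also have "\<dots> = 2 ^ Suc l * (x ^ Suc l * e)" by (simp only: power_mult_distrib mult_ac)
    finally show ?thesis using 2 by (simp add: e_def)
  qed
  moreover have "C' > 0" using C'1 by simp
  ultimately show ?case by blast
qed

text \<open>The degree bound stays at n instead of dropping with each derivative, so that a single
  Markov factor serves all k steps.\<close>

lemma polys_below_weak_deriv:
  fixes p :: "real ^ 'n::finite \<Rightarrow> complex"
  assumes D: "D > 0" "\<And>n p i. p \<in> polys_below n \<Longrightarrow> L2_norm a (pd i p) \<le> D * (real n + 1)\<^sup>2 * L2_norm a (p :: real ^ 'n \<Rightarrow> complex)"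
    and p: "p \<in> polys_below n" and "mi_abs \<gamma> = k"
  shows "\<exists>q\<in>polys_below n. is_weak_deriv \<gamma> p q \<and> L2_norm a q \<le> (D * (real n + 1)\<^sup>2) ^ k * L2_norm a p"
  using p \<open>mi_abs \<gamma> = k\<close>
proof (induction k arbitrary: p \<gamma>)
  case 0
  then have "\<gamma> = (\<lambda>_. 0)" by (auto simp: mi_abs_def fun_eq_iff)
  then show ?case
    using 0 is_weak_deriv_zero[OF loc_integrable_continuous[OF polys_below_continuous[OF 0(1)]]] by auto
next
  case (Suc k)
  obtain \<delta> i where \<gamma>: "\<gamma> = inc i \<delta>" "mi_abs \<delta> = k" by (rule mi_abs_Suc_cases[OF Suc.prems(2)]) (rule that)
  have q: "pd i p \<in> polys_below n"
    using pd_polys_below[OF Suc.prems(1), of i] polys_below_mono[of "n - 1" n] by auto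
  obtain r where r: "r \<in> polys_below n" "is_weak_deriv \<delta> (pd i p) r"
    "L2_norm a r \<le> (D * (real n + 1)\<^sup>2) ^ k * L2_norm a (pd i p)"
    using Suc.IH[OF q \<gamma>(2)] by blast
  have "(D * (real n + 1)\<^sup>2) ^ k * L2_norm a (pd i p) \<le> (D * (real n + 1)\<^sup>2) ^ k * (D * (real n + 1)\<^sup>2 * L2_norm a p)"
    by (intro mult_left_mono D(2)[OF Suc.prems(1)]) (use D in simp)
  also have "\<dots> = (D * (real n + 1)\<^sup>2) ^ Suc k * L2_norm a p" by (simp only: power_Suc2 mult.assoc)
  finally have "(D * (real n + 1)\<^sup>2) ^ k * L2_norm a (pd i p) \<le> (D * (real n + 1)\<^sup>2) ^ Suc k * L2_norm a p" .
  with r(3) have "L2_norm a r \<le> (D * (real n + 1)\<^sup>2) ^ Suc k * L2_norm a p" by (rule order_trans)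
  then show ?case using r wpd_inc[OF polys_below_wpd[OF Suc.prems(1)], of i \<delta> r] \<gamma> by blast
qed

text \<open>The exponent may have either sign, so comparability is used in both directions, through
  |ln x - ln y| \<le> ln c.\<close>

lemma powr_comparable:
  fixes x y c s :: real
  assumes "x > 0" "y > 0" "x \<le> c * y" "y \<le> c * x" "c \<ge> 1"
  shows "x powr s \<le> c powr \<bar>s\<bar> * y powr s"
proof -
  have "ln x \<le> ln c + ln y" "ln y \<le> ln c + ln x"
    using assms ln_le_cancel_iff[of x "c * y"] ln_le_cancel_iff[of y "c * x"] by (auto simp: ln_mult)
  then have "\<bar>ln x - ln y\<bar> \<le> ln c" by linarith
  then have "\<bar>s\<bar> * \<bar>ln x - ln y\<bar> \<le> \<bar>s\<bar> * ln c" by (intro mult_left_mono) auto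
  then have "s * (ln x - ln y) \<le> \<bar>s\<bar> * ln c"
    using abs_ge_self[of "s * (ln x - ln y)"] by (simp add: abs_mult)
  then have "s * ln x \<le> \<bar>s\<bar> * ln c + s * ln y" by (simp add: algebra_simps)
  then have "exp (s * ln x) \<le> exp (\<bar>s\<bar> * ln c + s * ln y)" by simp
  then show ?thesis using assms by (simp add: powr_def exp_add)
qed

text \<open>The first derivative costs 3/2 powers, one for the order and one half for the change of
  weight, and each further one costs two. At k = 0 the second formula would promise half a power too
  much.\<close>

definition rate :: "nat \<Rightarrow> nat \<Rightarrow> real" where
  "rate k l = (if k = 0 then - real l else 2 * real k - 1 / 2 - real l)"

text \<open>Existence of a bounded representative is the form that adds up: the derivative of order
  k + 1 is obtained as the sum of representatives for the two summands of the gradient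
  error.\<close>

lemma projection_error_weak_deriv:
  assumes a: "a > -1"
  shows "k \<le> l \<Longrightarrow> \<exists>C>0. \<forall>u B n \<gamma>. sobolev_bounded a l (u :: real ^ 'n::finite \<Rightarrow> complex) B \<longrightarrow> mi_abs \<gamma> = k \<longrightarrow>
    (\<exists>w\<in>L2 a. is_weak_deriv \<gamma> (\<lambda>x. u x - proj a n u x) w \<and> L2_norm a w \<le> C * (real n + 1) powr rate k l * B)"
proof (induction k arbitrary: l)
  case 0
  obtain C where C: "C > 0" "\<And>u B n. sobolev_bounded a l (u :: real ^ 'n \<Rightarrow> complex) B \<Longrightarrow>
    L2_norm a (\<lambda>x. u x - proj a n u x) * (real n + 1) ^ l \<le> C * B"
    using L2_projection_error[OF a, of l] by blast
  have "\<exists>w\<in>L2 a. is_weak_deriv \<gamma> (\<lambda>x. u x - proj a n u x) w \<and> L2_norm a w \<le> C * (real n + 1) powr rate 0 l * B"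
    if u: "sobolev_bounded a l u B" and g: "mi_abs \<gamma> = 0" for u :: "real ^ 'n \<Rightarrow> complex" and B n \<gamma>
  proof -
    have uL: "u \<in> L2 a" by (rule sobolev_bounded_L2[OF u])
    have \<gamma>: "\<gamma> = (\<lambda>_. 0)" using g by (auto simp: mi_abs_def fun_eq_iff)
    have "loc_integrable (\<lambda>x. u x + (-1) * proj a n u x)"
      by (intro loc_integrable_add loc_integrable_cmult sobolev_bounded_norm(1)[OF u]
          loc_integrable_continuous polys_below_continuous[OF proj_in[OF a uL]])
    then have "is_weak_deriv \<gamma> (\<lambda>x. u x - proj a n u x) (\<lambda>x. u x - proj a n u x)"
      unfolding \<gamma> by (intro is_weak_deriv_zero) simp
    moreover have "(\<lambda>x. u x - proj a n u x) \<in> L2 a" by (intro L2_diff uL proj_L2 a)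
    moreover have "L2_norm a (\<lambda>x. u x - proj a n u x) \<le> C * (real n + 1) powr rate 0 l * B"
      using C(2)[OF u, of n] by (simp add: rate_def powr_minus powr_realpow field_simps)
    ultimately show ?thesis by blast
  qed
  then show ?case using C(1) by blast
next
  case (Suc k)
  then obtain m where l: "l = Suc m" and km: "k \<le> m" by (cases l) auto
  obtain C1 where C1: "C1 > 0" "\<And>u B n \<gamma>. sobolev_bounded a m (u :: real ^ 'n \<Rightarrow> complex) B \<Longrightarrow> mi_abs \<gamma> = k \<Longrightarrow>
    \<exists>w\<in>L2 a. is_weak_deriv \<gamma> (\<lambda>x. u x - proj a n u x) w \<and> L2_norm a w \<le> C1 * (real n + 1) powr rate k m * B"
    using Suc.IH[OF km] by blast
  obtain C2 where C2: "C2 > 0" "\<And>u B n. sobolev_bounded a m (u :: real ^ 'n \<Rightarrow> complex) B \<Longrightarrow>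
    L2_norm a (\<lambda>x. u x - proj a n u x) * (real n + 1) ^ m \<le> C2 * B"
    using L2_projection_error[OF a, of m] by blast
  obtain D where D: "D > 0" "\<And>n p i. p \<in> polys_below n \<Longrightarrow> L2_norm a (pd i p) \<le> D * (real n + 1)\<^sup>2 * L2_norm a (p :: real ^ 'n \<Rightarrow> complex)"
    using markov_inequality[OF a] by blast
  define g where "g = gap_const TYPE('n) a"
  have g: "g > 0" unfolding g_def by (rule gap_const_pos[OF a])
  define s where "s = rate (Suc k) l"
  define C3 where "C3 = C1 + D ^ k * (sqrt (2 * g) * C2)"
  have C3: "C3 > 0" unfolding C3_def using C1(1) C2(1) D(1) g by (intro add_pos_pos mult_pos_pos) auto
  \<comment> \<open>The summand 1 serves n = 0, where the projection vanishes; the power of 2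
    replaces N + 1 by n + 1 = N + 2.\<close>
  define C where "C = 1 + 2 powr \<bar>s\<bar> * C3"
  have Cpos: "C \<ge> 1" using C3 by (simp add: C_def)
  have "\<exists>w\<in>L2 a. is_weak_deriv \<gamma> (\<lambda>x. u x - proj a n u x) w \<and> L2_norm a w \<le> C * (real n + 1) powr s * B"
    if u: "sobolev_bounded a l u B" and \<gamma>k: "mi_abs \<gamma> = Suc k" for u :: "real ^ 'n \<Rightarrow> complex" and B n \<gamma>
  proof (cases n)
    case 0
    have uL: "u \<in> L2 a" by (rule sobolev_bounded_L2[OF u])
    have B: "B \<ge> 0" by (rule sobolev_bounded_norm(3)[OF u])
    have "mi_abs \<gamma> \<le> l" using \<gamma>k Suc.prems by simp
    from sobolev_bounded_derivE[OF u this] obtain w where w: "w \<in> L2 a" "is_weak_deriv \<gamma> u w" "L2_norm a w \<le> B" by metis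
    have z: "proj a n u = (\<lambda>x. 0)" using proj_in[OF a uL, of n] 0 by simp
    have "1 * B \<le> C * B" using Cpos B by (intro mult_right_mono)
    then have "L2_norm a w \<le> C * (real n + 1) powr s * B" using w(3) 0 by simp
    then show ?thesis unfolding z using w by auto
  next
    case (Suc N)
    have uL: "u \<in> L2 a" by (rule sobolev_bounded_L2[OF u])
    have B: "B \<ge> 0" by (rule sobolev_bounded_norm(3)[OF u])
    obtain v where v: "\<And>i. wpd i u (v i)" "\<And>i. sobolev_bounded a m (v i) B"
      by (rule sobolev_bounded_gradient[OF u[unfolded l]]) (rule that)
    have vL: "v i \<in> L2 a" for i by (rule sobolev_bounded_L2[OF v(2)])
    obtain \<delta> i where \<gamma>: "\<gamma> = inc i \<delta>" "mi_abs \<delta> = k" by (rule mi_abs_Suc_cases[OF \<gamma>k]) (rule that)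
    define x where "x = real N + 1"
    have x: "x \<ge> 1" by (simp add: x_def)
    obtain w where w: "w \<in> L2 a" "is_weak_deriv \<delta> (\<lambda>x. v i x - proj a N (v i) x) w" "L2_norm a w \<le> C1 * x powr rate k m * B"
      using C1(2)[OF v(2)[of i] \<gamma>(2), of N] unfolding x_def by blast
    \<comment> \<open>\<open>w\<close> accounts for the projection with exponent \<open>a\<close>;
      adding \<open>y\<close> exchanges it for the one with \<open>a + 1\<close> that
      \<open>pd_proj\<close> yields.\<close>
    define y where "y x = proj a N (v i) x - proj (a + 1) N (v i) x" for x
    have y: "y \<in> polys_below N"
      unfolding y_def[abs_def] using a by (intro polys_below_diff proj_in vL L2_mono) auto
    obtain q where q: "q \<in> polys_below N" "is_weak_deriv \<delta> y q" "L2_norm a q \<le> (D * x\<^sup>2) ^ k * L2_norm a y"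
      using polys_below_weak_deriv[OF D y \<gamma>(2)] unfolding x_def by blast
    have ynorm: "L2_norm a y \<le> sqrt (2 * g) * C2 * x powr (1 / 2 - real m) * B"
    proof -
      define e where "e = L2_norm a (\<lambda>x. v i x - proj a N (v i) x)"
      have "(L2_norm a y)\<^sup>2 \<le> 2 * g * x * e\<^sup>2"
        unfolding y_def[abs_def] g_def x_def e_def by (rule proj_shift_diff[OF a vL])
      also have "\<dots> = (sqrt (2 * g) * sqrt x * e)\<^sup>2" using g x by (simp add: power_mult_distrib)
      finally have "L2_norm a y \<le> sqrt (2 * g) * sqrt x * e"
        by (rule power2_le_imp_le) (use g x in \<open>simp add: e_def\<close>)
      also have "\<dots> \<le> sqrt (2 * g) * sqrt x * (C2 * B * x powr - real m)"
      proof (intro mult_left_mono)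
        have "e * x ^ m \<le> C2 * B" unfolding e_def x_def by (rule C2(2)[OF v(2)])
        then show "e \<le> C2 * B * x powr - real m"
          using x by (simp add: powr_minus powr_realpow field_simps)
      qed (use g x in simp)
      also have "\<dots> = sqrt (2 * g) * C2 * (x powr (1 / 2) * x powr - real m) * B"
        using x by (simp add: powr_half_sqrt)
      also have "x powr (1 / 2) * x powr - real m = x powr (1 / 2 - real m)"
        by (simp add: powr_add[symmetric])
      finally show ?thesis .
    qed
    have "L2_norm a q \<le> (D * x\<^sup>2) ^ k * (sqrt (2 * g) * C2 * x powr (1 / 2 - real m) * B)"
      using q(3) by (rule order_trans) (intro mult_left_mono ynorm zero_le_power mult_nonneg_nonneg less_imp_le[OF D(1)] zero_le_power2)
    also have "\<dots> = D ^ k * (sqrt (2 * g) * C2) * (x powr (2 * real k) * x powr (1 / 2 - real m)) * B"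
    proof -
      have "(x\<^sup>2) ^ k = x powr (2 * real k)"
        using x powr_realpow[of x "2 * k"] by (simp add: power_mult)
      then show ?thesis by (simp only: power_mult_distrib mult_ac)
    qed
    \<comment> \<open>With l = m + 1 the exponent 2 k + 1/2 - m is 2 (k + 1) - 1/2 - l.\<close>
    also have "x powr (2 * real k) * x powr (1 / 2 - real m) = x powr s"
      by (simp add: powr_add[symmetric] s_def rate_def l algebra_simps)
    finally have qn: "L2_norm a q \<le> D ^ k * (sqrt (2 * g) * C2) * x powr s * B" .
    have "C1 * x powr rate k m * B \<le> C1 * x powr s * B"
    proof (intro mult_right_mono mult_left_mono powr_mono B)
      \<comment> \<open>The induction hypothesis is better than s by half a power for k = 0 and by a
        full power otherwise, so \<open>q\<close> alone dictates the rate.\<close>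
      show "rate k m \<le> s" by (simp add: s_def rate_def l)
    qed (use x C1 in auto)
    with w(3) have wn: "L2_norm a w \<le> C1 * x powr s * B" by (rule order_trans)
    have qL: "q \<in> L2 a" by (rule polys_below_L2[OF a q(1)])
    have "L2_norm a (\<lambda>x. w x + q x) \<le> L2_norm a w + L2_norm a q" by (rule L2_norm_triangle[OF w(1) qL])
    also have "\<dots> \<le> C1 * x powr s * B + D ^ k * (sqrt (2 * g) * C2) * x powr s * B" by (rule add_mono[OF wn qn])
    also have "\<dots> = C3 * x powr s * B" by (simp add: C3_def algebra_simps)
    also have "\<dots> \<le> C3 * (2 powr \<bar>s\<bar> * (real n + 1) powr s) * B"
      using C3 B Suc x by (intro mult_right_mono mult_left_mono powr_comparable) (auto simp: x_def)
    also have "\<dots> \<le> C * (real n + 1) powr s * B"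
      using B by (simp add: C_def distrib_right mult.assoc mult.left_commute)
    finally have bound: "L2_norm a (\<lambda>x. w x + q x) \<le> C * (real n + 1) powr s * B" .
    have "is_weak_deriv \<delta> (\<lambda>x. (v i x - proj a N (v i) x) + y x) (\<lambda>x. w x + q x)"
      by (rule is_weak_deriv_add[OF w(2) q(2)])
    then have "is_weak_deriv \<delta> (\<lambda>x. v i x - pd i (proj a n u) x) (\<lambda>x. w x + q x)"
      unfolding Suc pd_proj[OF a uL vL v(1)] by (simp add: y_def)
    moreover have "wpd i (\<lambda>x. u x - proj a n u x) (\<lambda>x. v i x - pd i (proj a n u) x)"
      by (intro is_weak_deriv_diff v(1) polys_below_wpd[OF proj_in[OF a uL]])
    ultimately have "is_weak_deriv \<gamma> (\<lambda>x. u x - proj a n u x) (\<lambda>x. w x + q x)"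
      unfolding \<gamma>(1) using wpd_inc by blast
    then show ?thesis using bound L2_add[OF w(1) qL] by blast
  qed
  moreover have "C > 0" using Cpos by simp
  ultimately show ?case unfolding s_def by blast
qed

section \<open>From bounds on single derivatives to the Sobolev norm\<close>

lemma prod_fact_le_fact_sum: "finite A \<Longrightarrow> (\<Prod>i\<in>A. fact (f i)) \<le> (fact (\<Sum>i\<in>A. f i) :: nat)"
proof (induction A rule: finite_induct)
  case (insert i A)
  have "fact (f i) * (\<Prod>i\<in>A. fact (f i)) \<le> fact (f i) * (fact (\<Sum>i\<in>A. f i) :: nat)"
    using insert by (intro mult_left_mono) auto
  also have "\<dots> \<le> fact (f i + (\<Sum>i\<in>A. f i))"
    by (rule dvd_imp_le[OF fact_fact_dvd_fact]) simp
  finally show ?case using insert by simp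
qed simp

text \<open>Lets each single weak derivative be bounded by the Sobolev norm with constant 1.\<close>

lemma multinomial_ge_1:
  assumes "mi_abs \<gamma> = k"
  shows "1 \<le> multinomial k \<gamma>"
proof -
  have "real (\<Prod>i\<in>UNIV. fact (\<gamma> i)) \<le> real (fact (\<Sum>i\<in>UNIV. \<gamma> i))"
    by (intro of_nat_mono prod_fact_le_fact_sum) simp
  then have "(\<Prod>i\<in>UNIV. fact (\<gamma> i)) \<le> (fact k :: real)"
    using assms by (simp add: mi_abs_def)
  then show ?thesis unfolding multinomial_def by (subst le_divide_eq_1_pos) (auto intro: prod_pos)
qed

lemma multinomial_nonneg: "0 \<le> multinomial k \<gamma>"
  by (simp add: multinomial_def prod_nonneg)

lemma finite_mi_abs_eq: "finite {\<gamma> :: 'n::finite multi_index. mi_abs \<gamma> = k}"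
  by (rule finite_subset[OF _ finite_mi_abs_le[of k]]) auto

lemma grad_norm_sq:
  "(grad_norm a k u)\<^sup>2 = (\<Sum>\<gamma> | mi_abs \<gamma> = k. multinomial k \<gamma> * (L2_norm a (weak_deriv \<gamma> u))\<^sup>2)"
proof -
  have "0 \<le> (\<Sum>\<gamma> | mi_abs \<gamma> = k. multinomial k \<gamma> * (L2_norm a (weak_deriv \<gamma> u))\<^sup>2)"
    by (intro sum_nonneg mult_nonneg_nonneg multinomial_nonneg) auto
  then show ?thesis by (simp add: grad_norm_def)
qed

lemma Sobolev_imp_bounded:
  assumes "u \<in> Sobolev a l"
  shows "sobolev_bounded a l u (Sobolev_norm a l u)"
  unfolding sobolev_bounded_def
proof (intro conjI allI impI)
  show "u \<in> L2 a" using assms by (simp add: Sobolev_def)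
  fix \<gamma> :: "'a multi_index" assume \<gamma>: "mi_abs \<gamma> \<le> l"
  then obtain w where w: "w \<in> L2 a" "is_weak_deriv \<gamma> u w" using assms by (auto simp: Sobolev_def)
  have "1 * (L2_norm a w)\<^sup>2 \<le> multinomial (mi_abs \<gamma>) \<gamma> * (L2_norm a (weak_deriv \<gamma> u))\<^sup>2"
    unfolding L2_norm_weak_deriv[OF w(2)] by (intro mult_right_mono multinomial_ge_1) auto
  also have "\<dots> \<le> (grad_norm a (mi_abs \<gamma>) u)\<^sup>2"
    unfolding grad_norm_sq
    by (rule member_le_sum[where f = "\<lambda>\<delta>. multinomial (mi_abs \<gamma>) \<delta> * (L2_norm a (weak_deriv \<delta> u))\<^sup>2"])
       (auto intro!: mult_nonneg_nonneg multinomial_nonneg finite_mi_abs_eq)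
  also have "\<dots> \<le> (\<Sum>k\<le>l. (grad_norm a k u)\<^sup>2)"
    by (rule member_le_sum) (use \<gamma> in auto)
  finally have "sqrt ((L2_norm a w)\<^sup>2) \<le> sqrt (\<Sum>k\<le>l. (grad_norm a k u)\<^sup>2)" by (intro real_sqrt_le_mono) simp
  then have "L2_norm a w \<le> Sobolev_norm a l u" by (simp add: Sobolev_norm_def)
  with w show "\<exists>w\<in>L2 a. is_weak_deriv \<gamma> u w \<and> L2_norm a w \<le> Sobolev_norm a l u" by blast
qed

lemma Sobolev_norm_le:
  assumes "\<And>\<gamma>. mi_abs \<gamma> \<le> r \<Longrightarrow> \<exists>w. is_weak_deriv \<gamma> u w \<and> L2_norm a w \<le> K" and "0 \<le> K"
  shows "Sobolev_norm a r (u :: real ^ 'n::finite \<Rightarrow> complex)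
    \<le> sqrt (\<Sum>k\<le>r. \<Sum>\<gamma> | mi_abs (\<gamma> :: 'n multi_index) = k. multinomial k \<gamma>) * K"
proof -
  have "(\<Sum>k\<le>r. (grad_norm a k u)\<^sup>2) \<le> (\<Sum>k\<le>r. \<Sum>\<gamma> | mi_abs (\<gamma> :: 'n multi_index) = k. multinomial k \<gamma> * K\<^sup>2)"
    unfolding grad_norm_sq
  proof (intro sum_mono mult_left_mono)
    fix k and \<gamma> :: "'n multi_index" assume k: "k \<in> {..r}" and \<gamma>: "\<gamma> \<in> {\<gamma>. mi_abs \<gamma> = k}"
    then obtain w where "is_weak_deriv \<gamma> u w" "L2_norm a w \<le> K" using assms(1)[of \<gamma>] by auto
    then show "(L2_norm a (weak_deriv \<gamma> u))\<^sup>2 \<le> K\<^sup>2"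
      using L2_norm_weak_deriv[of \<gamma> u w a] by (intro power_mono) auto
    show "0 \<le> multinomial k \<gamma>" by (rule multinomial_nonneg)
  qed
  also have "\<dots> = (\<Sum>k\<le>r. \<Sum>\<gamma> | mi_abs (\<gamma> :: 'n multi_index) = k. multinomial k \<gamma>) * K\<^sup>2"
    by (simp add: sum_distrib_right)
  finally have "sqrt (\<Sum>k\<le>r. (grad_norm a k u)\<^sup>2) \<le> sqrt ((\<Sum>k\<le>r. \<Sum>\<gamma> | mi_abs (\<gamma> :: 'n multi_index) = k. multinomial k \<gamma>) * K\<^sup>2)"
    by (rule real_sqrt_le_mono)
  then show ?thesis using assms(2) by (simp add: Sobolev_norm_def real_sqrt_mult)
qed

theorem theorem1p1:
  fixes \<alpha> :: real and l r :: nat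
  assumes "\<alpha> > -1" and "1 \<le> r" and "r \<le> l"
  shows "\<exists>C>0. \<forall>u :: real ^ 'n::finite \<Rightarrow> complex. \<forall>N::nat.
    u \<in> Sobolev \<alpha> l \<longrightarrow> 1 \<le> N \<longrightarrow>
      Sobolev_norm \<alpha> r (\<lambda>x. u x - ortho_proj \<alpha> N u x)
        \<le> C * real N powr (-1/2 + 2 * real r - real l) * Sobolev_norm \<alpha> l u"
proof -
  define s where "s = -1/2 + 2 * real r - real l"
  have "\<forall>k\<in>{..r}. \<exists>C>0. \<forall>u B n \<gamma>. sobolev_bounded \<alpha> l (u :: real ^ 'n \<Rightarrow> complex) B \<longrightarrow> mi_abs \<gamma> = k \<longrightarrow>
    (\<exists>w\<in>L2 \<alpha>. is_weak_deriv \<gamma> (\<lambda>x. u x - proj \<alpha> n u x) w \<and> L2_norm \<alpha> w \<le> C * (real n + 1) powr rate k l * B)"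
    using assms(3) by (intro ballI projection_error_weak_deriv[OF assms(1)]) auto
  from bchoice[OF this] obtain C where C_all: "\<forall>k\<in>{..r}. C k > 0 \<and> (\<forall>u B n \<gamma>. sobolev_bounded \<alpha> l (u :: real ^ 'n \<Rightarrow> complex) B \<longrightarrow> mi_abs \<gamma> = k \<longrightarrow>
    (\<exists>w\<in>L2 \<alpha>. is_weak_deriv \<gamma> (\<lambda>x. u x - proj \<alpha> n u x) w \<and> L2_norm \<alpha> w \<le> C k * (real n + 1) powr rate k l * B))" ..
  have C: "k \<le> r \<Longrightarrow> C k > 0"
    "k \<le> r \<Longrightarrow> sobolev_bounded \<alpha> l (u :: real ^ 'n \<Rightarrow> complex) B \<Longrightarrow> mi_abs \<gamma> = k \<Longrightarrow>
      \<exists>w\<in>L2 \<alpha>. is_weak_deriv \<gamma> (\<lambda>x. u x - proj \<alpha> n u x) w \<and> L2_norm \<alpha> w \<le> C k * (real n + 1) powr rate k l * B"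
    for k u B n \<gamma>
    using bspec[OF C_all, of k] by (simp only: atMost_iff, blast)
  define C0 where "C0 = (\<Sum>k\<le>r. C k)"
  have C0: "C k \<le> C0" if "k \<le> r" for k
    unfolding C0_def by (rule member_le_sum) (use that C(1) in \<open>auto intro: less_imp_le\<close>)
  have C0pos: "C0 > 0" using C(1)[of 0] C0[of 0] by linarith
  define S where "S = sqrt (\<Sum>k\<le>r. \<Sum>\<gamma> | mi_abs (\<gamma> :: 'n multi_index) = k. multinomial k \<gamma>)"
  \<comment> \<open>\<open>C0\<close> serves all orders up to r at once, S collects the multinomial
    factors, and the summand 1 makes positivity immediate.\<close>
  define C' where "C' = 1 + S * (C0 * 3 powr \<bar>s\<bar>)"
  have S: "S \<ge> 0" unfolding S_def
    by (intro real_sqrt_ge_zero sum_nonneg) (rule multinomial_nonneg)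
  have "Sobolev_norm \<alpha> r (\<lambda>x. u x - ortho_proj \<alpha> N u x) \<le> C' * real N powr s * Sobolev_norm \<alpha> l u"
    if u: "u \<in> Sobolev \<alpha> l" and N: "1 \<le> N" for u :: "real ^ 'n \<Rightarrow> complex" and N
  proof -
    let ?B = "Sobolev_norm \<alpha> l u"
    have ub: "sobolev_bounded \<alpha> l u ?B" by (rule Sobolev_imp_bounded[OF u])
    have B: "0 \<le> ?B" by (rule sobolev_bounded_norm(3)[OF ub])
    let ?K = "C0 * 3 powr \<bar>s\<bar> * real N powr s * ?B"
    have "\<exists>w. is_weak_deriv \<gamma> (\<lambda>x. u x - proj \<alpha> (Suc N) u x) w \<and> L2_norm \<alpha> w \<le> ?K" if \<gamma>: "mi_abs \<gamma> \<le> r" for \<gamma>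
    proof -
      obtain w where w: "is_weak_deriv \<gamma> (\<lambda>x. u x - proj \<alpha> (Suc N) u x) w"
        "L2_norm \<alpha> w \<le> C (mi_abs \<gamma>) * (real (Suc N) + 1) powr rate (mi_abs \<gamma>) l * ?B"
        using C(2)[OF \<gamma> ub refl] by blast
      \<comment> \<open>For order 0 the rate is -l; that it is at most s uses
        \<open>1 \<le> r\<close>.\<close>
      have "(real (Suc N) + 1) powr rate (mi_abs \<gamma>) l \<le> (real (Suc N) + 1) powr s"
        using \<gamma> assms by (intro powr_mono) (auto simp: rate_def s_def)
      \<comment> \<open>N + 2 \<le> 3 N because N \<ge> 1. One unit of the shift comes from the
        strict degree bound, the other from stating rates in n + 1.\<close>
      also have "\<dots> \<le> 3 powr \<bar>s\<bar> * real N powr s"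
        using N by (intro powr_comparable) auto
      finally have "C (mi_abs \<gamma>) * (real (Suc N) + 1) powr rate (mi_abs \<gamma>) l * ?B \<le> C0 * (3 powr \<bar>s\<bar> * real N powr s) * ?B"
        using C0[OF \<gamma>] C0pos B by (intro mult_right_mono mult_mono) auto
      with w show ?thesis by (auto simp: mult.assoc)
    qed
    then have "Sobolev_norm \<alpha> r (\<lambda>x. u x - proj \<alpha> (Suc N) u x) \<le> S * ?K"
      unfolding S_def using C0pos B by (intro Sobolev_norm_le) auto
    also have "\<dots> \<le> C' * real N powr s * ?B"
      using B by (simp add: C'_def distrib_right mult.assoc)
    finally show ?thesis
      using ortho_proj_eq[OF assms(1) sobolev_bounded_L2[OF ub]] by simp
  qed
  moreover have "C' > 0" unfolding C'_def using S C0pos by (intro add_pos_nonneg) auto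
  ultimately show ?thesis unfolding s_def by blast
qed

end
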